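(* Let $X$ be a semilocally 2-connected topological space. Then the topological bigroupoid $\Pi_2(X)$ is locally weakly discrete. If moreover $X$ is locally relatively contractible, then $\Pi_2(X)$ is locally trivial.
   Context: **Spaces and 2-tracks.** $I=[0,1]$. A space $X$ is *semilocally 2-connected* if every point has a neighbourhood basis of open simply-connected (in particular path-connected) sets $U$ such that the inclusion induces the zero map $\pi_2(U,u)\to\pi_2(X,u)$ for every $u\in U$. Such open sets $U\subset X$ are called *basic open*. A space $X$ is *locally relatively contractible* if it has a neighbourhood basis of sets $U$ whose inclusion maps $U\hookrightarrow X$ are null-homotopic. $X^I$ has the compact-open topology. A *bigon* is a continuous map $f\colon I^2\to X$, $(s,t)\mapsto f(s,t)$, that is constant on $\{0\}\times I$ and on $\{1\}\times I$. A *2-track* $[f]$ is a homotopy class of bigons relative to $\partial I^2$; $\Pi_2(X)_2$ is the set of 2-tracks. Put $s_1[f]=f(\cdot,0)$, $t_1[f]=f(\cdot,1)\in X^I$, $s_0[f]=f(0,0)$, $t_0[f]=f(1,0)\in X$. If $t_1[f]=s_1[g]$, then $[g]+[f]=[g+f]$ is the class of the bigon equal to $f(s,2t)$ for $t\le 1/2$ and $g(s,2t-1)$ for $t\geq 1/2$. If $t_0[f]=s_0[g]$, then $g\bullet f$ is the bigon equal to $f(2s,t)$ for $s\le 1/2$ and $g(2s-1,t)$ for $s\ge 1/2$. For a path $\beta$, $\mathrm{id}_\beta$ denotes the bigon $(s,t)\mapsto\beta(s)$. **Basic open sets of $X^I$.** For $n\ge 0$, a partition $\mathfrak p=\{0<a_1<\dots<a_{2n}<1\}$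 (with $a_0=0$, $a_{2n+1}=1$) and basic open sets $\mathcal W=\{W_i\}_{i=1}^{2n+1}$ with $W_{2i}\subset W_{2i-1}\cap W_{2i+1}$ for $i=1,\dots,n$, let $N(\mathfrak p,\mathcal W)=\{\eta\in X^I\mid \eta([a_{i-1},a_i])\subset W_i,\ i=1,\dots,2n+1\}$. The sets $N(\mathfrak p,\mathcal W)$ containing $\gamma$ form a neighbourhood basis at $\gamma$ in $X^I$; they are called basic open neighbourhoods of $\gamma$. **Topology on $\Pi_2(X)_2$.** Let $[h]$ be a 2-track, let $V_0=N(\mathfrak p_0,\{W^{(0)}_i\}_{i=1}^{n_0})$ and $V_1=N(\mathfrak p_1,\{W^{(1)}_i\}_{i=1}^{n_1})$ be basic open neighbourhoods of $s_1[h]$ and $t_1[h]$, and let $U_0\ni s_0[h]$, $U_1\ni t_0[h]$ be basic open sets of $X$ with $U_0\subset W^{(0)}_1\cap W^{(1)}_1$ and $U_1\subset W^{(0)}_{n_0}\cap W^{(1)}_{n_1}$. Define $\langle [h],U_0,U_1,V_0,V_1\rangle\subset\Pi_2(X)_2$ to be the set of those $[f]$ for which there exist paths $\beta_\epsilon\colon I\to U_\epsilon$ and bigons $\lambda_\epsilon$ with $\lambda_\epsilon(\cdot,t)\in V_\epsilon$ for all $t\in I$ (that is, $\lambda_\epsilon$ corresponds to a path $I\to V_\epsilon$), $\epsilon=0,1$, such that $[f]=[\lambda_1+(\mathrm{id}_{\beta_1}\bullet(h\bullet\mathrm{id}_{\beta_0}))+\lambda_0]$ (in particular the compositions are defined,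 so $\beta_0(1)=s_0[h]$ and $\beta_1(0)=t_0[h]$). These sets are the open neighbourhood basis (at $[h]$) of the topology used on $\Pi_2(X)_2$. **The bigroupoid.** $\Pi_2(X)$ is the fundamental bigroupoid of $X$, with object space $B_0=X$, space of 1-arrows $B_1=X^I$ and space of 2-arrows $B_2=\Pi_2(X)_2$ with the topology above. The vertical source and target maps are $s_1,t_1\colon B_2\to B_1$, and on 1-arrows $S(\gamma)=\gamma(0)$, $T(\gamma)=\gamma(1)$. Only this part of the structure enters the definitions below. **Local triviality.** Let $B$ be a topological bigroupoid with object space $B_0$, 1-arrow space $B_1$ and 2-arrow space $B_2$. For $b\in B_0$, $\mathrm{Obj}(S^{-1}(b))$ denotes the subspace $\{f\in B_1\mid S(f)=b\}$, which maps to $B_0$ by $T$. $B_1\times_{B_0\times B_0}B_1$ is the space of pairs of 1-arrows with the same source and the same target. - If $B_0$ is locally path-connected, $B$ is *locally trivial* if (I) for every $b\in B_0$ there is an open neighbourhood $U$ of $b$ such that $T\colon\mathrm{Obj}(S^{-1}(b))\to B_0$ has a continuous section over $U$; and (II) the image of $(s_1,t_1)\colon B_2\to B_1\times_{B_0\times B_0}B_1$ is open and closed, and $B_2\to\mathrm{im}(s_1,t_1)$ admits continuous local sections. - $B$ is *locally weakly discrete* if (II$'$) the map $(s_1,t_1)\colon B_2\to B_1\times_{B_0\times B_0}B_1$ has discrete (possibly empty) fibres and is locally trivial, i.e. each point of the codomain has an open neighbourhood $N$ over which the map is isomorphic to the projection $N\times F\to N$ with $F$ a (possibly empty) discrete 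space.
   Formalization: In the sets ⟨[h],U0,U1,V0,V1⟩ the bigon id_β1•(h•id_β0) is first reparametrised in s so that h keeps its own parameter on the middle intervals of the partitions; read literally, these sets need not contain [h] and can be empty. *)

theory Defs
  imports "HOL-Analysis.Analysis"
begin

section \<open>Homotopy relative to a subset, and semilocal 2-connectedness\<close>

abbreviation unit_interval :: "real topology" where
  "unit_interval \<equiv> top_of_set {0..1}"

abbreviation unit_square :: "(real \<times> real) topology" where
  "unit_square \<equiv> top_of_set ({0..1} \<times> {0..1})"

definition square_boundary :: "(real \<times> real) set" where
  "square_boundary = {0, 1} \<times> {0..1} \<union> {0..1} \<times> {0, 1}"

definition homotopic_rel :: "'z set \<Rightarrow> 'z topology \<Rightarrow> 'a topology \<Rightarrow> ('z \<Rightarrow> 'a) \<Rightarrow> ('z \<Rightarrow> 'a) \<Rightarrow> bool" where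
  "homotopic_rel A Z X f g \<longleftrightarrow> homotopic_with (\<lambda>k. \<forall>z\<in>A. k z = f z) Z X f g"

definition simply_connected_in :: "'a topology \<Rightarrow> 'a set \<Rightarrow> bool" where
  "simply_connected_in X U \<longleftrightarrow> path_connectedin X U \<and>
     (\<forall>p. pathin (subtopology X U) p \<and> p 0 = p 1 \<longrightarrow>
        homotopic_rel {0, 1} unit_interval (subtopology X U) p (\<lambda>_. p 0))"

text \<open>The set underlying \<open>\<pi>\<^sub>2(X,u)\<close>, as homotopy classes of maps of pairs from the square and its
  boundary to \<open>X\<close> and \<open>u\<close>. Maps are only relevant on the square: every class contains, with a map,
  all functions that agree with it on the square.\<close>

definition spheroids :: "'a topology \<Rightarrow> 'a \<Rightarrow> (real \<times> real \<Rightarrow> 'a) set" where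
  "spheroids X u = {f. continuous_map unit_square X f \<and> (\<forall>p\<in>square_boundary. f p = u)}"

definition pi2_rel :: "'a topology \<Rightarrow> 'a \<Rightarrow> (real \<times> real \<Rightarrow> 'a) rel" where
  "pi2_rel X u = {(f, g). f \<in> spheroids X u \<and> g \<in> spheroids X u \<and>
     homotopic_rel square_boundary unit_square X f g}"

definition pi2 :: "'a topology \<Rightarrow> 'a \<Rightarrow> (real \<times> real \<Rightarrow> 'a) set set" where
  "pi2 X u = spheroids X u // pi2_rel X u"

definition pi2_zero :: "'a topology \<Rightarrow> 'a \<Rightarrow> (real \<times> real \<Rightarrow> 'a) set" where
  "pi2_zero X u = pi2_rel X u `` {\<lambda>_. u}"

text \<open>For \<open>c \<in> \<pi>\<^sub>2(U,u)\<close> with \<open>U \<subseteq> X\<close>, the image of \<open>c\<close> under the map induced by the inclusion.\<close>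

definition pi2_incl :: "'a topology \<Rightarrow> 'a \<Rightarrow> (real \<times> real \<Rightarrow> 'a) set \<Rightarrow> (real \<times> real \<Rightarrow> 'a) set" where
  "pi2_incl X u c = pi2_rel X u `` c"

definition basic_open :: "'a topology \<Rightarrow> 'a set \<Rightarrow> bool" where
  "basic_open X U \<longleftrightarrow> openin X U \<and> simply_connected_in X U \<and>
     (\<forall>u\<in>U. \<forall>c\<in>pi2 (subtopology X U) u. pi2_incl X u c = pi2_zero X u)"

definition semilocally_2_connected :: "'a topology \<Rightarrow> bool" where
  "semilocally_2_connected X \<longleftrightarrow> neighbourhood_base_of (basic_open X) X"

definition locally_relatively_contractible :: "'a topology \<Rightarrow> bool" where
  "locally_relatively_contractible X \<longleftrightarrow>
     neighbourhood_base_of (\<lambda>U. \<exists>c. homotopic_with (\<lambda>_. True) (subtopology X U) X id (\<lambda>_. c)) X"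


section \<open>The path space and its basic open sets\<close>

definition compact_open_topology :: "'a topology \<Rightarrow> 'b topology \<Rightarrow> ('a \<Rightarrow> 'b) topology" where
  "compact_open_topology X Y = topology_generated_by
     {{f \<in> extensional (topspace X). continuous_map X Y f \<and> f ` K \<subseteq> U} | K U.
        compactin X K \<and> openin Y U}"

definition path_space :: "'a topology \<Rightarrow> (real \<Rightarrow> 'a) topology" where
  "path_space X = compact_open_topology unit_interval X"

text \<open>\<open>a 0 = 0\<close> and \<open>a (2 * n + 1) = 1\<close> are the end points of the partition, and \<open>W\<close> is indexed by
  \<open>1, \<dots>, 2 * n + 1\<close>.\<close>

definition chain_data :: "'a topology \<Rightarrow> nat \<Rightarrow> (nat \<Rightarrow> real) \<Rightarrow> (nat \<Rightarrow> 'a set) \<Rightarrow> bool" where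
  "chain_data X n a W \<longleftrightarrow>
     a 0 = 0 \<and> a (2 * n + 1) = 1 \<and> (\<forall>i\<le>2 * n. a i < a (i + 1)) \<and>
     (\<forall>i\<in>{1..2 * n + 1}. basic_open X (W i)) \<and>
     (\<forall>i\<in>{1..n}. W (2 * i) \<subseteq> W (2 * i - 1) \<inter> W (2 * i + 1))"

definition path_nbhd :: "'a topology \<Rightarrow> nat \<Rightarrow> (nat \<Rightarrow> real) \<Rightarrow> (nat \<Rightarrow> 'a set) \<Rightarrow> (real \<Rightarrow> 'a) set" where
  "path_nbhd X n a W =
     {\<eta> \<in> topspace (path_space X). \<forall>i\<in>{1..2 * n + 1}. \<eta> ` {a (i - 1)..a i} \<subseteq> W i}"


section \<open>Bigons and 2-tracks\<close>

definition bigon :: "'a topology \<Rightarrow> (real \<times> real \<Rightarrow> 'a) \<Rightarrow> bool" where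
  "bigon X f \<longleftrightarrow> continuous_map unit_square X f \<and>
     (\<forall>t\<in>{0..1}. f (0, t) = f (0, 0) \<and> f (1, t) = f (1, 0))"

definition track_rel :: "'a topology \<Rightarrow> (real \<times> real \<Rightarrow> 'a) rel" where
  "track_rel X = {(f, g). bigon X f \<and> bigon X g \<and> homotopic_rel square_boundary unit_square X f g}"

definition two_track :: "'a topology \<Rightarrow> (real \<times> real \<Rightarrow> 'a) \<Rightarrow> (real \<times> real \<Rightarrow> 'a) set" where
  "two_track X f = track_rel X `` {f}"

definition two_tracks :: "'a topology \<Rightarrow> (real \<times> real \<Rightarrow> 'a) set set" where
  "two_tracks X = Collect (bigon X) // track_rel X"

definition slice :: "(real \<times> real \<Rightarrow> 'a) \<Rightarrow> real \<Rightarrow> real \<Rightarrow> 'a" where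
  "slice f t = restrict (\<lambda>s. f (s, t)) {0..1}"

text \<open>The maps below are constant on a 2-track, so their image of it is a singleton.\<close>

definition source1 :: "(real \<times> real \<Rightarrow> 'a) set \<Rightarrow> real \<Rightarrow> 'a" where
  "source1 c = the_elem ((\<lambda>f. slice f 0) ` c)"

definition target1 :: "(real \<times> real \<Rightarrow> 'a) set \<Rightarrow> real \<Rightarrow> 'a" where
  "target1 c = the_elem ((\<lambda>f. slice f 1) ` c)"

definition source0 :: "(real \<times> real \<Rightarrow> 'a) set \<Rightarrow> 'a" where
  "source0 c = the_elem ((\<lambda>f. f (0, 0)) ` c)"

definition target0 :: "(real \<times> real \<Rightarrow> 'a) set \<Rightarrow> 'a" where
  "target0 c = the_elem ((\<lambda>f. f (1, 0)) ` c)"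

definition vcomp :: "(real \<times> real \<Rightarrow> 'a) \<Rightarrow> (real \<times> real \<Rightarrow> 'a) \<Rightarrow> real \<times> real \<Rightarrow> 'a" where
  "vcomp g f = (\<lambda>(s, t). if t \<le> 1/2 then f (s, 2 * t) else g (s, 2 * t - 1))"

definition hcomp :: "(real \<times> real \<Rightarrow> 'a) \<Rightarrow> (real \<times> real \<Rightarrow> 'a) \<Rightarrow> real \<times> real \<Rightarrow> 'a" where
  "hcomp g f = (\<lambda>(s, t). if s \<le> 1/2 then f (2 * s, t) else g (2 * s - 1, t))"

definition id_bigon :: "(real \<Rightarrow> 'a) \<Rightarrow> real \<times> real \<Rightarrow> 'a" where
  "id_bigon \<beta> = (\<lambda>(s, t). \<beta> s)"


section \<open>The topology on the set of 2-tracks\<close>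

text \<open>
  The whiskered bigon \<open>hcomp (id_bigon \<beta>1) (hcomp h (id_bigon \<beta>0))\<close> runs through \<open>h\<close> during
  \<open>1/4 \<le> s \<le> 1/2\<close> only. Hence its source and target need not lie in the given neighbourhoods
  \<open>N(a,W)\<close> of the source and target of \<open>h\<close>, even when \<open>\<beta>0\<close> and \<open>\<beta>1\<close> are constant, and it can be pasted
  to bigons in these neighbourhoods only after the usual reparametrisation in the \<open>s\<close>-direction. The
  reparametrisations used are those for which \<open>\<beta>0\<close> is traversed within the first and \<open>\<beta>1\<close> within the last
  interval of the partition, the path in between keeping its own parameter: at time
  \<open>(1 + s) / 4\<close> the whiskered bigon is at time \<open>s\<close> of \<open>h\<close>. As \<open>U0\<close> and \<open>U1\<close> are contained in the
  first and last members of the chains, the reparametrised source and target then lie in \<open>N(a,W)\<close>.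
  (For \<open>n = 0\<close> there is only one interval and the last condition is void.)
\<close>

definition reparam_for :: "nat \<Rightarrow> (nat \<Rightarrow> real) \<Rightarrow> (real \<Rightarrow> real) \<Rightarrow> bool" where
  "reparam_for n a \<rho> \<longleftrightarrow> continuous_on {0..1} \<rho> \<and> mono_on {0..1} \<rho> \<and> \<rho> 0 = 0 \<and> \<rho> 1 = 1 \<and>
     (\<forall>s\<in>{a 1..a (2 * n)}. \<rho> s = (1 + s) / 4)"

text \<open>Reparametrise by \<open>\<rho>0\<close> at the source \<open>t = 0\<close>, by \<open>\<rho>1\<close> at the target \<open>t = 1\<close>, and linearly in
  between.\<close>

definition reparam :: "(real \<Rightarrow> real) \<Rightarrow> (real \<Rightarrow> real) \<Rightarrow> (real \<times> real \<Rightarrow> 'a) \<Rightarrow> real \<times> real \<Rightarrow> 'a" where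
  "reparam \<rho>0 \<rho>1 f = (\<lambda>(s, t). f ((1 - t) * \<rho>0 s + t * \<rho>1 s, t))"

definition track_nbhd :: "'a topology \<Rightarrow> (real \<times> real \<Rightarrow> 'a) set \<Rightarrow> 'a set \<Rightarrow> 'a set \<Rightarrow>
    nat \<Rightarrow> (nat \<Rightarrow> real) \<Rightarrow> (nat \<Rightarrow> 'a set) \<Rightarrow> nat \<Rightarrow> (nat \<Rightarrow> real) \<Rightarrow> (nat \<Rightarrow> 'a set) \<Rightarrow>
    (real \<times> real \<Rightarrow> 'a) set set" where
  "track_nbhd X c U0 U1 n0 a0 W0 n1 a1 W1 =
     {d \<in> two_tracks X. \<exists>h \<beta>0 \<beta>1 \<mu>0 \<mu>1 \<rho>0 \<rho>1 m.
        h \<in> c \<and>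
        pathin (subtopology X U0) \<beta>0 \<and> pathin (subtopology X U1) \<beta>1 \<and>
        bigon X \<mu>0 \<and> (\<forall>t\<in>{0..1}. slice \<mu>0 t \<in> path_nbhd X n0 a0 W0) \<and>
        bigon X \<mu>1 \<and> (\<forall>t\<in>{0..1}. slice \<mu>1 t \<in> path_nbhd X n1 a1 W1) \<and>
        \<beta>0 1 = source0 c \<and> \<beta>1 0 = target0 c \<and>
        reparam_for n0 a0 \<rho>0 \<and> reparam_for n1 a1 \<rho>1 \<and>
        m = reparam \<rho>0 \<rho>1 (hcomp (id_bigon \<beta>1) (hcomp h (id_bigon \<beta>0))) \<and>
        slice \<mu>0 1 = slice m 0 \<and> slice m 1 = slice \<mu>1 0 \<and>
        d = two_track X (vcomp \<mu>1 (vcomp m \<mu>0))}"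

definition two_track_topology :: "'a topology \<Rightarrow> (real \<times> real \<Rightarrow> 'a) set topology" where
  "two_track_topology X = topology_generated_by
     {track_nbhd X c U0 U1 n0 a0 W0 n1 a1 W1 | c U0 U1 n0 a0 W0 n1 a1 W1.
        c \<in> two_tracks X \<and>
        chain_data X n0 a0 W0 \<and> source1 c \<in> path_nbhd X n0 a0 W0 \<and>
        chain_data X n1 a1 W1 \<and> target1 c \<in> path_nbhd X n1 a1 W1 \<and>
        basic_open X U0 \<and> source0 c \<in> U0 \<and> U0 \<subseteq> W0 1 \<inter> W1 1 \<and>
        basic_open X U1 \<and> target0 c \<in> U1 \<and> U1 \<subseteq> W0 (2 * n0 + 1) \<inter> W1 (2 * n1 + 1)}"


section \<open>Local triviality of topological bigroupoids\<close>

text \<open>The part of the structure of a topological bigroupoid that enters the definitions below.\<close>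

record ('o, 'p, 'q) bigroupoid_data =
  objects :: "'o topology"
  arrows1 :: "'p topology"
  arrows2 :: "'q topology"
  src :: "'p \<Rightarrow> 'o"
  tgt :: "'p \<Rightarrow> 'o"
  vsrc :: "'q \<Rightarrow> 'p"
  vtgt :: "'q \<Rightarrow> 'p"

definition fundamental_bigroupoid ::
    "'a topology \<Rightarrow> ('a, real \<Rightarrow> 'a, (real \<times> real \<Rightarrow> 'a) set) bigroupoid_data" where
  "fundamental_bigroupoid X =
     \<lparr>objects = X, arrows1 = path_space X, arrows2 = two_track_topology X,
      src = (\<lambda>\<gamma>. \<gamma> 0), tgt = (\<lambda>\<gamma>. \<gamma> 1), vsrc = source1, vtgt = target1\<rparr>"

definition parallel_arrows :: "('o, 'p, 'q) bigroupoid_data \<Rightarrow> ('p \<times> 'p) topology" where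
  "parallel_arrows B = subtopology (prod_topology (arrows1 B) (arrows1 B))
     {(f, g). src B f = src B g \<and> tgt B f = tgt B g}"

definition boundary_map :: "('o, 'p, 'q) bigroupoid_data \<Rightarrow> 'q \<Rightarrow> 'p \<times> 'p" where
  "boundary_map B x = (vsrc B x, vtgt B x)"

definition boundary_image :: "('o, 'p, 'q) bigroupoid_data \<Rightarrow> ('p \<times> 'p) set" where
  "boundary_image B = boundary_map B ` topspace (arrows2 B)"

definition out_arrows :: "('o, 'p, 'q) bigroupoid_data \<Rightarrow> 'o \<Rightarrow> 'p topology" where
  "out_arrows B b = subtopology (arrows1 B) {f. src B f = b}"

definition has_section_over :: "'e topology \<Rightarrow> 'b topology \<Rightarrow> ('e \<Rightarrow> 'b) \<Rightarrow> 'b set \<Rightarrow> bool" where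
  "has_section_over E Y p U \<longleftrightarrow>
     (\<exists>\<sigma>. continuous_map (subtopology Y U) E \<sigma> \<and> (\<forall>y\<in>U. p (\<sigma> y) = y))"

definition locally_trivial :: "('o, 'p, 'q) bigroupoid_data \<Rightarrow> bool" where
  "locally_trivial B \<longleftrightarrow>
     locally_path_connected_space (objects B) \<and>
     (\<forall>b\<in>topspace (objects B). \<exists>U. openin (objects B) U \<and> b \<in> U \<and>
        has_section_over (out_arrows B b) (objects B) (tgt B) U) \<and>
     openin (parallel_arrows B) (boundary_image B) \<and>
     closedin (parallel_arrows B) (boundary_image B) \<and>
     (\<forall>y\<in>boundary_image B. \<exists>N.
        openin (subtopology (parallel_arrows B) (boundary_image B)) N \<and> y \<in> N \<and>
        has_section_over (arrows2 B) (subtopology (parallel_arrows B) (boundary_image B))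
          (boundary_map B) N)"

definition trivial_discrete_over :: "'e topology \<Rightarrow> 'b topology \<Rightarrow> ('e \<Rightarrow> 'b) \<Rightarrow> 'b set \<Rightarrow> bool" where
  "trivial_discrete_over E Y p N \<longleftrightarrow>
     (\<exists>(F :: 'e set) \<Phi>.
        homeomorphic_map (subtopology E {e. p e \<in> N})
          (prod_topology (subtopology Y N) (discrete_topology F)) \<Phi> \<and>
        (\<forall>e\<in>topspace E. p e \<in> N \<longrightarrow> fst (\<Phi> e) = p e))"

definition locally_weakly_discrete :: "('o, 'p, 'q) bigroupoid_data \<Rightarrow> bool" where
  "locally_weakly_discrete B \<longleftrightarrow>
     (\<forall>y\<in>topspace (parallel_arrows B).
        subtopology (arrows2 B) {x. boundary_map B x = y} =
        discrete_topology {x \<in> topspace (arrows2 B). boundary_map B x = y}) \<and>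
     (\<forall>y\<in>topspace (parallel_arrows B). \<exists>N. openin (parallel_arrows B) N \<and> y \<in> N \<and>
        trivial_discrete_over (arrows2 B) (parallel_arrows B) (boundary_map B) N)"

end

(*
  A neighbourhood <[h],U0,U1,V0,V1> consists of the 2-tracks that can be deformed to [h] through
  bigons whose source, target and end points stay in V0, V1, U0 and U1: the whiskers and the bigons
  lambda are the sides of the cube traced out by such a deformation, and conversely. In this form the
  neighbourhoods ("sheets") over the same V0, V1, U0, U1 are equal or disjoint.

  Every sheet maps bijectively to the pairs of parallel paths in V0 and V1 with end points in U0 and
  U1. For existence, fill the squares between two paths in V0 = N(a,W) strip by strip, using that the
  W i are simply connected and that W (2 i) is contained in its neighbours, and extend the
  deformation from five faces of a cube to the cube. For uniqueness, a deformation between two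
  2-tracks with the same boundary sweeps out loops of paths in V0 and V1; these are null-homotopic in
  X, again strip by strip, because maps from the boundary of a cube to W i extend over the cube with
  values in X. The homotopy extension property then turns the deformation into a homotopy relative
  to the boundary.

  Hence (s1,t1) is a covering map onto an open and closed set. Sections of T come from contracting
  homotopies through the exponential law.
*)

theory Submission
  imports Defs
begin

section \<open>Extension of maps from the boundary of a convex body\<close>

text \<open>The obstacle is that the condition on \<open>pi2\<close> fills spheres in
  \<open>W i\<close> only with values in \<open>X\<close>, whereas path-connectedness and simple
  connectedness fill point pairs and loops inside \<open>W i\<close> itself. Hence
  \<open>chain_fill\<close> carries two families, \<open>W\<close> for the given data and
  \<open>V\<close> for the filling. Squares (existence) are filled with \<open>V\<close> equal to
  \<open>W\<close>, so that the deformation never leaves the neighbourhoods; cubes (uniqueness) may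
  leave them, since there only a homotopy in \<open>X\<close> is wanted. The even members of a chain
  serve the seams: a filling over an inner partition point must lie in both adjacent members before
  the strips can be filled independently. \<open>X\<close> is an arbitrary topological space, so all
  extension arguments act on the Euclidean source: retractions of boxes and ANR theory there,
  composed with maps to \<open>X\<close>. Whiskered pastings are awkward to compare, so they are
  traded once and for all for \<open>deformable_in\<close>, which is symmetric and transitive. The
  constants 1/4 and 1/2 in that translation are the breakpoints of the nested compositions
  \<open>hcomp\<close> and \<open>vcomp\<close>.\<close>

lemma continuous_map_compose_on:
  assumes "continuous_map (top_of_set T) X f" and "continuous_on S g" and "\<And>x. x \<in> S \<Longrightarrow> g x \<in> T"
  shows "continuous_map (top_of_set S) X (\<lambda>x. f (g x))"
proof -
  have "continuous_map (top_of_set S) (top_of_set T) g"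
    using assms(2,3) by (simp add: continuous_map_in_subtopology Pi_iff)
  then show ?thesis
    by (rule continuous_map_compose[unfolded o_def, OF _ assms(1)])
qed

lemma continuous_map_eq_on:
  assumes "continuous_map (top_of_set S) X f" and "\<And>x. x \<in> S \<Longrightarrow> f x = g x"
  shows "continuous_map (top_of_set S) X g"
  using assms by (auto intro: continuous_map_eq)

lemma continuous_map_compose_eq_on:
  assumes "continuous_map (top_of_set T) X f" and "continuous_on S g" and "\<And>x. x \<in> S \<Longrightarrow> g x \<in> T"
    and "\<And>x. x \<in> S \<Longrightarrow> f (g x) = k x"
  shows "continuous_map (top_of_set S) X k"
  using continuous_map_eq_on[OF continuous_map_compose_on[OF assms(1-3)] assms(4)] .

lemma continuous_map_homotopy_at:
  assumes "continuous_map (top_of_set ({0..1::real} \<times> S)) X K" "r \<in> {0..1}"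
  shows "continuous_map (top_of_set S) X (\<lambda>x. K (r, x))"
  by (rule continuous_map_compose_on[OF assms(1)]) (use assms(2) in \<open>auto intro!: continuous_intros\<close>)

lemma continuous_map_on_Un_closed:
  assumes "closed A" "closed B" "continuous_map (top_of_set A) X f" "continuous_map (top_of_set B) X f"
  shows "continuous_map (top_of_set (A \<union> B)) X f"
proof (rule pasting_lemma_closed[where I = "{A, B}" and T = id and f = "\<lambda>_. f"])
  show "closedin (top_of_set (A \<union> B)) (id C)" if "C \<in> {A, B}" for C
    using that assms(1,2) by (auto intro: closed_subset)
  show "continuous_map (subtopology (top_of_set (A \<union> B)) (id C)) X f" if "C \<in> {A, B}" for C
    using that assms(3,4) by (auto simp: subtopology_subtopology inf.absorb2)
qed auto

lemma homotopic_with_top_of_setI: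
  assumes "continuous_map (top_of_set ({0..1::real} \<times> S)) X K"
    and "\<And>h k. (\<And>x. x \<in> S \<Longrightarrow> h x = k x) \<Longrightarrow> P h = P k"
    and "\<And>x. x \<in> S \<Longrightarrow> K (0, x) = f x" and "\<And>x. x \<in> S \<Longrightarrow> K (1, x) = g x"
    and "\<And>r. 0 \<le> r \<Longrightarrow> r \<le> 1 \<Longrightarrow> P (\<lambda>x. K (r, x))"
  shows "homotopic_with P (top_of_set S) X f g"
proof (rule homotopic_with[THEN iffD2])
  show "P h = P k" if "\<And>x. x \<in> topspace (top_of_set S) \<Longrightarrow> h x = k x" for h k
    by (rule assms(2)) (use that in simp)
  show "\<exists>h. continuous_map (prod_topology (top_of_set {0..1::real}) (top_of_set S)) X h \<and>
      (\<forall>x\<in>topspace (top_of_set S). h (0, x) = f x) \<and> (\<forall>x\<in>topspace (top_of_set S). h (1, x) = g x) \<and>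
      (\<forall>t\<in>{0..1}. P (\<lambda>x. h (t, x)))"
    by (rule exI[of _ K]) (simp add: assms(1,3,4,5))
qed

lemma homotopic_with_top_of_setD:
  assumes "homotopic_with P (top_of_set S) X f g"
  shows "\<exists>K. continuous_map (top_of_set ({0..1::real} \<times> S)) X K \<and> (\<forall>x. K (0, x) = f x) \<and>
    (\<forall>x. K (1, x) = g x) \<and> (\<forall>r\<in>{0..1}. P (\<lambda>x. K (r, x)))"
  using assms unfolding homotopic_with_def prod_topology_subtopology_eu .

lemma homotopic_relI:
  assumes "continuous_map (top_of_set ({0..1::real} \<times> S)) X K" and "A \<subseteq> S"
    and "\<And>x. x \<in> S \<Longrightarrow> K (0, x) = f x" and "\<And>x. x \<in> S \<Longrightarrow> K (1, x) = g x"
    and "\<And>r x. 0 \<le> r \<Longrightarrow> r \<le> 1 \<Longrightarrow> x \<in> A \<Longrightarrow> K (r, x) = f x"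
  shows "homotopic_rel A (top_of_set S) X f g"
  unfolding homotopic_rel_def
proof (rule homotopic_with_top_of_setI[OF assms(1) _ assms(3,4)])
  show "(\<forall>z\<in>A. h z = f z) = (\<forall>z\<in>A. k z = f z)" if "\<And>x. x \<in> S \<Longrightarrow> h x = k x" for h k
    using that assms(2) by (metis subsetD)
qed (use assms(5) in auto)

lemma homotopic_relD:
  assumes "homotopic_rel A (top_of_set S) X f g"
  shows "\<exists>K. continuous_map (top_of_set ({0..1::real} \<times> S)) X K \<and> (\<forall>x. K (0, x) = f x) \<and>
    (\<forall>x. K (1, x) = g x) \<and> (\<forall>r\<in>{0..1}. \<forall>x\<in>A. K (r, x) = f x)"
  using assms unfolding homotopic_rel_def by (rule homotopic_with_top_of_setD)

text \<open>The cylinder without its lid is a union of two closed ANRs along an ANR, and it is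
  contractible: push it down to the bottom, then shrink the convex \<open>S\<close>. So it is an AR,
  and an AR is a retract of every Euclidean set in which it is closed.\<close>

lemma retract_cylinder:
  fixes S :: "'e::euclidean_space set"
  assumes "compact S" "convex S" "interior S \<noteq> {}"
  shows "({0} \<times> S \<union> {0..1} \<times> frontier S) retract_of ({0..1::real} \<times> S)"
proof -
  let ?J = "{0::real} \<times> S \<union> {0..1} \<times> frontier S"
  have closed: "closed S"
    using assms compact_imp_closed by blast
  have sub: "frontier S \<subseteq> S"
    using closed by (simp add: frontier_subset_eq)
  have "ANR (frontier S)"
    using ANR_rel_frontier_convex[of S] assms
    by (simp add: rel_frontier_nonempty_interior compact_imp_bounded)
  moreover have "({0} \<times> S) \<inter> ({0..1} \<times> frontier S) = {0::real} \<times> frontier S"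
    using sub by auto
  ultimately have "ANR ?J"
    using closed assms(2)
    by (intro ANR_closed_Un closed_Times) (auto simp: ANR_Times convex_imp_ANR)
  moreover have "contractible ?J"
  proof -
    obtain x0 where x0: "x0 \<in> S"
      using assms(3) interior_subset by blast
    have "homotopic_with (\<lambda>_. True) (top_of_set ?J) (top_of_set ?J) id (\<lambda>(r, x). (0, x))"
      by (rule homotopic_with_top_of_setI[where K = "\<lambda>(c, r, x). ((1 - c) * r, x)"])
        (auto simp: continuous_map_in_subtopology case_prod_unfold Pi_iff intro!: mult_le_one continuous_intros)
    moreover have "homotopic_with (\<lambda>_. True) (top_of_set ?J) (top_of_set ?J) (\<lambda>(r, x). (0, x)) (\<lambda>_. (0, x0))"
      by (rule homotopic_with_top_of_setI[where K = "\<lambda>(c, r, x). (0, (1 - c) *\<^sub>R x + c *\<^sub>R x0)"])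
        (use x0 sub in \<open>auto simp: continuous_map_in_subtopology case_prod_unfold
          intro!: continuous_intros convexD_alt[OF assms(2)]\<close>)
    ultimately show ?thesis
      unfolding contractible_def by (meson homotopic_with_trans)
  qed
  moreover have "?J \<noteq> {}"
    using assms(3) by auto
  ultimately have "AR ?J"
    by (simp add: AR_ANR)
  moreover have "closedin (top_of_set ({0..1} \<times> S)) ?J"
    using closed sub by (intro closed_subset closed_Un closed_Times) auto
  ultimately show ?thesis
    by (metis AR_imp_retract)
qed

text \<open>Glue \<open>f\<close> and \<open>G\<close> on the open box and precompose with the
  retraction. Since the retraction acts on the source, nothing is required of the target
  \<open>X\<close>.\<close>

lemma homotopy_extension_convex:
  fixes S :: "'e::euclidean_space set"
  assumes "compact S" "convex S" "interior S \<noteq> {}"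
    and f: "continuous_map (top_of_set S) X f"
    and G: "continuous_map (top_of_set ({0..1::real} \<times> frontier S)) X G"
    and fG: "\<And>x. x \<in> frontier S \<Longrightarrow> G (0, x) = f x"
  obtains K where "continuous_map (top_of_set ({0..1} \<times> S)) X K"
    "\<And>x. x \<in> S \<Longrightarrow> K (0, x) = f x"
    "\<And>r x. 0 \<le> r \<Longrightarrow> r \<le> 1 \<Longrightarrow> x \<in> frontier S \<Longrightarrow> K (r, x) = G (r, x)"
proof -
  let ?J = "{0::real} \<times> S \<union> {0..1} \<times> frontier S"
  obtain \<rho> where \<rho>: "retraction ({0..1} \<times> S) ?J \<rho>"
    using retract_cylinder[OF assms(1-3)] unfolding retract_of_def by blast
  define g where "g = (\<lambda>(r, x). if x \<in> frontier S then G (r, x) else f x)"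
  have closed: "closed S"
    using assms compact_imp_closed by blast
  have "continuous_map (top_of_set ?J) X g"
  proof (rule continuous_map_on_Un_closed)
    show "continuous_map (top_of_set ({0} \<times> S)) X g"
      by (rule continuous_map_compose_eq_on[OF f, of _ snd])
        (auto simp: g_def fG intro: continuous_intros)
    show "continuous_map (top_of_set ({0..1} \<times> frontier S)) X g"
      by (rule continuous_map_eq_on[OF G]) (auto simp: g_def)
  qed (use closed in \<open>auto intro: closed_Times\<close>)
  then have "continuous_map (top_of_set ({0..1} \<times> S)) X (\<lambda>x. g (\<rho> x))"
    by (rule continuous_map_compose_on) (use \<rho> in \<open>auto simp: retraction_def\<close>)
  moreover have "g (\<rho> (0, x)) = f x" if "x \<in> S" for x
    using \<rho> that fG by (auto simp: retraction_def g_def)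
  moreover have "g (\<rho> (r, x)) = G (r, x)" if "0 \<le> r" "r \<le> 1" "x \<in> frontier S" for r x
    using \<rho> that by (auto simp: retraction_def g_def)
  ultimately show ?thesis
    using that by blast
qed

text \<open>Two topologies occur because a map into a basic open set may extend only with values in
  a larger space; this happens for cubes.\<close>

definition extendable :: "'e::euclidean_space set \<Rightarrow> 'a topology \<Rightarrow> 'a topology \<Rightarrow> bool" where
  "extendable C A Y \<longleftrightarrow> (\<forall>\<phi>. continuous_map (top_of_set (frontier C)) A \<phi> \<longrightarrow>
     (\<exists>\<psi>. continuous_map (top_of_set C) Y \<psi> \<and> (\<forall>z\<in>frontier C. \<psi> z = \<phi> z)))"

text \<open>Run the null-homotopy backwards: the constant map extends over \<open>C\<close>, and
  homotopy extension carries this extension along to one of \<open>\<phi>\<close>. The null-homotopy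
  may be free, without base point.\<close>

lemma nullhomotopic_imp_extendable:
  fixes C :: "'e::euclidean_space set"
  assumes "compact C" "convex C" "interior C \<noteq> {}"
    and "\<And>\<phi>. continuous_map (top_of_set (frontier C)) A \<phi> \<Longrightarrow>
      \<exists>u\<in>topspace Y. homotopic_with (\<lambda>_. True) (top_of_set (frontier C)) Y \<phi> (\<lambda>_. u)"
  shows "extendable C A Y"
  unfolding extendable_def
proof (intro allI impI)
  fix \<phi> assume "continuous_map (top_of_set (frontier C)) A \<phi>"
  then obtain u where u: "u \<in> topspace Y"
    and "homotopic_with (\<lambda>_. True) (top_of_set (frontier C)) Y \<phi> (\<lambda>_. u)"
    using assms(4) by blast
  then have "homotopic_with (\<lambda>_. True) (top_of_set (frontier C)) Y (\<lambda>_. u) \<phi>"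
    by (simp add: homotopic_with_sym)
  then obtain G where G: "continuous_map (top_of_set ({0..1} \<times> frontier C)) Y G"
    "\<forall>x. G (0::real, x) = u" "\<forall>x. G (1, x) = \<phi> x"
    using homotopic_with_top_of_setD by blast
  obtain K where K: "continuous_map (top_of_set ({0..1} \<times> C)) Y K"
    "\<And>r x. 0 \<le> r \<Longrightarrow> r \<le> 1 \<Longrightarrow> x \<in> frontier C \<Longrightarrow> K (r::real, x) = G (r, x)"
    by (rule homotopy_extension_convex[OF assms(1-3), of Y "\<lambda>_. u" G]) (use u G in auto)
  have "continuous_map (top_of_set C) Y (\<lambda>x. K (1, x))"
    by (rule continuous_map_homotopy_at[OF K(1)]) simp
  moreover have "\<forall>x\<in>frontier C. K (1, x) = \<phi> x"
    using K(2) G(3) by simp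
  ultimately show "\<exists>\<psi>. continuous_map (top_of_set C) Y \<psi> \<and> (\<forall>z\<in>frontier C. \<psi> z = \<phi> z)"
    by blast
qed

lemma frontier_prism:
  assumes "p < q" "closed S"
  shows "frontier ({p..q::real} \<times> S) = {p, q} \<times> S \<union> {p..q} \<times> frontier S"
proof -
  have "frontier ({p..q} \<times> S) = {p..q} \<times> S - {p<..<q} \<times> interior S"
    using assms by (simp add: frontier_def closure_Times interior_Times)
  also have "\<dots> = {p, q} \<times> S \<union> {p..q} \<times> frontier S"
    using assms by (auto simp: frontier_def)
  finally show ?thesis .
qed

text \<open>The identity of \<open>frontier C\<close> is homotopic to a map collapsing the contractible part
  \<open>J\<close> (everything but the face over \<open>q\<close>) to a point. Composed with it, a map on \<open>frontier C\<close> becomes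
  a map on the remaining face that is constant on its boundary.\<close>

lemma extendable_prism:
  fixes S :: "'e::euclidean_space set" and p q :: real
  assumes "p < q" "compact S" "convex S" "interior S \<noteq> {}"
    and null: "\<And>g u. \<lbrakk>continuous_map (top_of_set S) (subtopology Y U) g; u \<in> topspace Y; u \<in> U;
        \<And>x. x \<in> frontier S \<Longrightarrow> g x = u\<rbrakk> \<Longrightarrow> homotopic_rel (frontier S) (top_of_set S) (subtopology Y V) g (\<lambda>_. u)"
    and "U \<subseteq> V"
  shows "extendable ({p..q} \<times> S) (subtopology Y U) (subtopology Y V)"
proof (rule nullhomotopic_imp_extendable)
  let ?C = "{p..q} \<times> S"
  have closed: "closed S"
    using assms compact_imp_closed by blast
  have sub: "frontier S \<subseteq> S"
    using closed by (simp add: frontier_subset_eq)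
  obtain x0 where x0: "x0 \<in> S"
    using assms(4) interior_subset by blast
  show C: "compact ?C" "convex ?C" "interior ?C \<noteq> {}"
    using assms by (auto simp: compact_Times convex_Times interior_Times)
  let ?J = "{p} \<times> S \<union> {p..q} \<times> frontier S"
  have fC: "frontier ?C = ?J \<union> {q} \<times> S"
    using assms(1) closed by (auto simp: frontier_prism)
  fix \<phi> assume \<phi>: "continuous_map (top_of_set (frontier ?C)) (subtopology Y U) \<phi>"
  have "homotopic_with (\<lambda>_. True) (top_of_set ?J) (top_of_set (frontier ?C)) id (\<lambda>(r, x). (p, x))"
  proof (rule homotopic_with_top_of_setI[where K = "\<lambda>(c, r, x). ((1 - c) * r + c * p, x)"])
    have "p \<le> (1 - c) * r + c * p \<and> (1 - c) * r + c * p \<le> q"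
      if "0 \<le> c" "c \<le> 1" "p \<le> r" "r \<le> q" for c r
    proof -
      have "(1 - c) * r + c * p \<in> {p..q}"
        using convexD_alt[of "{p..q}" r p c] that by auto
      then show ?thesis by simp
    qed
    then show "continuous_map (top_of_set ({0..1} \<times> ?J)) (top_of_set (frontier ?C))
        (\<lambda>(c, r, x). ((1 - c) * r + c * p, x))"
      by (auto simp: continuous_map_in_subtopology case_prod_unfold fC intro!: continuous_intros)
        (auto simp: algebra_simps)
  qed auto
  moreover have "homotopic_with (\<lambda>_. True) (top_of_set ?J) (top_of_set (frontier ?C)) (\<lambda>(r, x). (p, x)) (\<lambda>_. (p, x0))"
    by (rule homotopic_with_top_of_setI[where K = "\<lambda>(c, r, x). (p, (1 - c) *\<^sub>R x + c *\<^sub>R x0)"])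
      (use x0 sub in \<open>auto simp: continuous_map_in_subtopology case_prod_unfold fC
        intro!: continuous_intros convexD_alt[OF assms(3)]\<close>)
  ultimately have J: "homotopic_with (\<lambda>_. True) (top_of_set ?J) (top_of_set (frontier ?C)) id (\<lambda>_. (p, x0))"
    by (rule homotopic_with_trans)
  have "ANR (frontier ?C)"
    using ANR_rel_frontier_convex[of ?C] C
    by (simp add: rel_frontier_nonempty_interior compact_imp_bounded)
  moreover have "closedin (top_of_set (frontier ?C)) ?J"
    using closed fC by (intro closed_subset closed_Un closed_Times) auto
  \<comment> \<open>Borsuk's theorem asks for an ANR as target. The sphere
    \<open>frontier ?C\<close> is one, so the collapse of \<open>?J\<close> is extended here, before
    any map into \<open>Y\<close> is involved.\<close>
  ultimately obtain g where
    g: "homotopic_with (\<lambda>_. True) (top_of_set (frontier ?C)) (top_of_set (frontier ?C)) id g"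
      "continuous_on (frontier ?C) g" "g ` frontier ?C \<subseteq> frontier ?C" "\<And>x. x \<in> ?J \<Longrightarrow> g x = (p, x0)"
    by (elim Borsuk_homotopy_extension_homotopic[OF _ disjI2 _ _ J]) (auto simp: continuous_on_id id_def)
  define u where "u = \<phi> (p, x0)"
  have "(p, x0) \<in> frontier ?C"
    using x0 fC by auto
  then have u: "u \<in> topspace Y" "u \<in> U"
    using continuous_map_image_subset_topspace[OF \<phi>] by (auto simp: u_def)
  have "homotopic_with (\<lambda>_. True) (top_of_set (frontier ?C)) (subtopology Y U) (\<phi> \<circ> id) (\<phi> \<circ> g)"
    by (rule homotopic_with_compose_continuous_map_left[OF g(1) \<phi>]) auto
  then have 1: "homotopic_with (\<lambda>_. True) (top_of_set (frontier ?C)) (subtopology Y V) \<phi> (\<phi> \<circ> g)"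
    using \<open>U \<subseteq> V\<close> by (auto simp: homotopic_with_def continuous_map_in_subtopology)
  have "continuous_map (top_of_set S) (subtopology Y U) (\<lambda>x. \<phi> (g (q, x)))"
  proof (rule continuous_map_compose_on[OF \<phi>])
    show "continuous_on S (\<lambda>x. g (q, x))"
      by (rule continuous_on_compose2[OF g(2)]) (auto simp: fC intro!: continuous_intros)
  qed (use fC g(3) in auto)
  moreover have gu: "\<phi> (g (q, x)) = u" if "x \<in> frontier S" for x
    using g(4) that assms(1) by (simp add: u_def)
  ultimately have "homotopic_rel (frontier S) (top_of_set S) (subtopology Y V) (\<lambda>x. \<phi> (g (q, x))) (\<lambda>_. u)"
    using null u by blast
  from homotopic_relD[OF this] obtain H where H: "continuous_map (top_of_set ({0..1} \<times> S)) (subtopology Y V) H"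
    "\<forall>x. H (0::real, x) = \<phi> (g (q, x))" "\<forall>x. H (1, x) = u"
    "\<forall>r\<in>{0..1}. \<forall>x\<in>frontier S. H (r, x) = \<phi> (g (q, x))"
    by (elim exE conjE)
  \<comment> \<open>After the collapse only the face over \<open>q\<close> is not yet constant, so
    it is enough to run the null-homotopy \<open>H\<close> there. It keeps the rim at
    \<open>u\<close>, where this face meets the rest.\<close>
  define K where "K = (\<lambda>(c, r, x). if r = q then H (c, x) else u)"
  have "homotopic_with (\<lambda>_. True) (top_of_set (frontier ?C)) (subtopology Y V) (\<phi> \<circ> g) (\<lambda>_. u)"
  proof (rule homotopic_with_top_of_setI[where K = K])
    have "continuous_map (top_of_set ({0..1} \<times> ?J \<union> {0..1} \<times> ({q} \<times> S))) (subtopology Y V) K"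
    proof (rule continuous_map_on_Un_closed)
      show "continuous_map (top_of_set ({0..1} \<times> ?J)) (subtopology Y V) K"
      proof (rule continuous_map_eq_on)
        show "continuous_map (top_of_set ({0..1} \<times> ?J)) (subtopology Y V) (\<lambda>_. u)"
          using u \<open>U \<subseteq> V\<close> by auto
        show "u = K z" if "z \<in> {0..1} \<times> ?J" for z
          using that assms(1) H(4) gu unfolding K_def by fastforce
      qed
      show "continuous_map (top_of_set ({0..1} \<times> ({q} \<times> S))) (subtopology Y V) K"
        by (rule continuous_map_compose_eq_on[OF H(1), of _ "\<lambda>(c, r, x). (c, x)"])
          (auto simp: K_def case_prod_unfold intro!: continuous_intros)
    qed (use closed in \<open>auto intro!: closed_Times closed_Un\<close>)
    then show "continuous_map (top_of_set ({0..1} \<times> frontier ?C)) (subtopology Y V) K"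
      by (simp add: fC Sigma_Un_distrib2)
    show "K (0, z) = (\<phi> \<circ> g) z" if "z \<in> frontier ?C" for z
    proof (cases "fst z = q")
      case True
      then show ?thesis
        using H(2) by (auto simp: K_def case_prod_unfold)
    next
      case False
      then have "g z = (p, x0)"
        using that fC by (intro g(4)) auto
      with False show ?thesis
        by (auto simp: K_def u_def case_prod_unfold)
    qed
  qed (use H(3) in \<open>auto simp: K_def\<close>)
  with 1 have "homotopic_with (\<lambda>_. True) (top_of_set (frontier ?C)) (subtopology Y V) \<phi> (\<lambda>_. u)"
    by (rule homotopic_with_trans)
  then show "\<exists>u\<in>topspace (subtopology Y V).
      homotopic_with (\<lambda>_. True) (top_of_set (frontier ?C)) (subtopology Y V) \<phi> (\<lambda>_. u)"
    using u \<open>U \<subseteq> V\<close> by auto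
qed

section \<open>Filling boxes over a chain of basic open sets\<close>

abbreviation unit_cube :: "(real \<times> real \<times> real) set" where
  "unit_cube \<equiv> {0..1} \<times> ({0..1} \<times> {0..1})"

lemma frontier_unit_interval: "frontier {0..1::real} = {0, 1}"
  by (auto simp: frontier_def)

lemma frontier_unit_square: "frontier ({0..1::real} \<times> {0..1::real}) = square_boundary"
  by (auto simp: frontier_prism frontier_unit_interval square_boundary_def)

lemma frontier_unit_square_split:
  "frontier ({0..1::real} \<times> {0..1::real}) = ({0, 1} \<times> {0..1} \<union> {0..1} \<times> {1}) \<union> {0..1} \<times> {0}"
  by (auto simp: frontier_unit_square square_boundary_def)

lemma interior_unit_square: "interior ({0..1::real} \<times> {0..1::real}) \<noteq> {}"
  by (simp add: interior_Times)

text \<open>The three conditions in \<open>basic_open\<close> become extension properties for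
  intervals, squares and cubes: path-connectedness here, contraction of loops and the vanishing of
  the image of \<open>pi2\<close> in the next lemmas. Only the last one leaves
  \<open>U\<close>.\<close>

lemma basic_open_extendable_interval:
  assumes "basic_open X U"
  shows "extendable {0..1::real} (subtopology X U) (subtopology X U)"
  unfolding extendable_def frontier_unit_interval
proof (intro allI impI)
  fix \<phi> assume "continuous_map (top_of_set {0, 1::real}) (subtopology X U) \<phi>"
  then have "\<phi> \<in> {0, 1} \<rightarrow> topspace (subtopology X U)"
    by (simp add: continuous_map_def)
  moreover have "path_connected_space (subtopology X U)"
    using assms by (simp add: basic_open_def simply_connected_in_def path_connectedin_def)
  ultimately obtain g where "pathin (subtopology X U) g" "g 0 = \<phi> 0" "g 1 = \<phi> 1"
    unfolding path_connected_space_def by blast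
  then show "\<exists>\<psi>. continuous_map unit_interval (subtopology X U) \<psi> \<and> (\<forall>z\<in>{0, 1}. \<psi> z = \<phi> z)"
    by (auto simp: pathin_def)
qed

lemma basic_open_extendable_square:
  assumes "basic_open X U" "p < q"
  shows "extendable ({p..q::real} \<times> {0..1::real}) (subtopology X U) (subtopology X U)"
proof (rule extendable_prism)
  fix g and u :: 'a
  assume g: "continuous_map unit_interval (subtopology X U) g" "\<And>x. x \<in> frontier {0..1} \<Longrightarrow> g x = u"
  then have "g 0 = u" "g 1 = u"
    by (auto simp: frontier_unit_interval)
  with g show "homotopic_rel (frontier {0..1}) unit_interval (subtopology X U) g (\<lambda>_. u)"
    using assms(1) unfolding basic_open_def simply_connected_in_def pathin_def frontier_unit_interval by metis
qed (use assms in auto)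

text \<open>The class of \<open>f\<close> in \<open>U\<close> is sent to a class containing
  \<open>f\<close> itself, and that class is zero, so it is also represented by the constant
  map.\<close>

lemma basic_open_spheroid_null:
  assumes "basic_open X U" "u \<in> U" "f \<in> spheroids (subtopology X U) u"
  shows "homotopic_rel square_boundary unit_square X f (\<lambda>_. u)"
proof -
  have fX: "f \<in> spheroids X u"
    using assms(3) by (simp add: spheroids_def continuous_map_in_subtopology)
  have refl: "(f, f) \<in> pi2_rel Y u" if "f \<in> spheroids Y u" for Y
    using that by (auto simp: pi2_rel_def spheroids_def homotopic_rel_def)
  let ?c = "pi2_rel (subtopology X U) u `` {f}"
  have "?c \<in> pi2 (subtopology X U) u"
    using assms(3) by (simp add: pi2_def quotientI)
  then have "pi2_incl X u ?c = pi2_zero X u"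
    using assms(1,2) by (simp add: basic_open_def)
  moreover have "f \<in> pi2_incl X u ?c"
    using refl[OF assms(3)] refl[OF fX] by (auto simp: pi2_incl_def)
  ultimately have "homotopic_rel square_boundary unit_square X (\<lambda>_. u) f"
    by (simp add: pi2_zero_def pi2_rel_def)
  \<comment> \<open>The boundary condition in \<open>homotopic_rel\<close> refers to its first map.
    Both maps are constantly \<open>u\<close> on the boundary, so the homotopy may be
    reversed.\<close>
  then have "homotopic_rel square_boundary unit_square X f (\<lambda>_. u)
      \<longleftrightarrow> homotopic_with (\<lambda>k. \<forall>z\<in>square_boundary. k z = u) unit_square X f (\<lambda>_. u)"
    using fX by (simp add: homotopic_rel_def spheroids_def)
  then show ?thesis
    using \<open>homotopic_rel square_boundary unit_square X (\<lambda>_. u) f\<close>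
    by (simp add: homotopic_rel_def homotopic_with_sym)
qed

lemma basic_open_extendable_cube:
  assumes "basic_open X U" "p < q"
  shows "extendable ({p..q::real} \<times> ({0..1::real} \<times> {0..1::real})) (subtopology X U) X"
proof -
  have "U \<subseteq> topspace X"
    using assms(1) by (simp add: basic_open_def openin_subset)
  \<comment> \<open>\<open>X\<close> is written as a subspace of itself because
    \<open>extendable_prism\<close> compares two subspaces of one space.\<close>
  have "extendable ({p..q::real} \<times> ({0..1::real} \<times> {0..1::real})) (subtopology X U) (subtopology X (topspace X))"
  proof (rule extendable_prism)
    fix g and u :: 'a
    assume "continuous_map unit_square (subtopology X U) g" "u \<in> U"
      "\<And>x. x \<in> frontier ({0..1} \<times> {0..1}) \<Longrightarrow> g x = u"
    then show "homotopic_rel (frontier ({0..1} \<times> {0..1})) unit_square (subtopology X (topspace X)) g (\<lambda>_. u)"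
      using basic_open_spheroid_null[OF assms(1)]
      by (simp add: frontier_unit_square spheroids_def)
  qed (use assms \<open>U \<subseteq> topspace X\<close> in \<open>auto simp: compact_Times convex_Times interior_Times\<close>)
  then show ?thesis
    by simp
qed

text \<open>The values \<open>c i\<close> over all partition points are prescribed in advance. Each
  strip is then a box with prescribed map on its whole frontier, and neighbouring fillings agree on
  their common face. For this \<open>c i\<close> must take values in the sets on both sides. Strips
  are numbered from 0 here.\<close>

lemma extend_over_strips:
  fixes Z :: "'e::euclidean_space set" and a :: "nat \<Rightarrow> real"
  assumes "closed Z"
    and "\<And>i. i < m \<Longrightarrow> a i < a (Suc i)"
    and "\<And>i. i < m \<Longrightarrow> extendable ({a i..a (Suc i)} \<times> Z) (subtopology X (W i)) (subtopology X (V i))"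
    and "continuous_map (top_of_set ({a 0..a m} \<times> frontier Z)) X g"
    and "\<And>i s z. \<lbrakk>i < m; s \<in> {a i..a (Suc i)}; z \<in> frontier Z\<rbrakk> \<Longrightarrow> g (s, z) \<in> W i"
    and "\<And>i. i \<le> m \<Longrightarrow> continuous_map (top_of_set Z) X (c i)"
    and "\<And>i z. \<lbrakk>i \<le> m; z \<in> frontier Z\<rbrakk> \<Longrightarrow> c i z = g (a i, z)"
    and "\<And>i z. \<lbrakk>i < m; z \<in> Z\<rbrakk> \<Longrightarrow> c i z \<in> W i \<and> c (Suc i) z \<in> W i"
  shows "\<exists>H. continuous_map (top_of_set ({a 0..a m} \<times> Z)) X H \<and>
    (\<forall>s\<in>{a 0..a m}. \<forall>z\<in>frontier Z. H (s, z) = g (s, z)) \<and>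
    (\<forall>i\<le>m. \<forall>z\<in>Z. H (a i, z) = c i z) \<and>
    (\<forall>i<m. \<forall>s\<in>{a i..a (Suc i)}. \<forall>z\<in>Z. H (s, z) \<in> V i)"
  using assms
proof (induction m)
  case 0
  have "continuous_map (top_of_set ({a 0..a 0} \<times> Z)) X (\<lambda>x. c 0 (snd x))"
    by (rule continuous_map_compose_on[OF 0(6)]) (auto intro: continuous_intros)
  then show ?case
    using 0(7) by (intro exI[of _ "\<lambda>x. c 0 (snd x)"]) auto
next
  case (Suc m)
  have le: "a i \<le> a j" if "i \<le> j" "j \<le> Suc m" for i j
    using that
  proof (induction j rule: dec_induct)
    case (step j)
    then show ?case
      using Suc.prems(2)[of j] by auto
  qed auto
  have sub: "frontier Z \<subseteq> Z"
    using Suc.prems(1) by (simp add: frontier_subset_eq)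
  have "\<exists>H. continuous_map (top_of_set ({a 0..a m} \<times> Z)) X H \<and>
    (\<forall>s\<in>{a 0..a m}. \<forall>z\<in>frontier Z. H (s, z) = g (s, z)) \<and>
    (\<forall>i\<le>m. \<forall>z\<in>Z. H (a i, z) = c i z) \<and>
    (\<forall>i<m. \<forall>s\<in>{a i..a (Suc i)}. \<forall>z\<in>Z. H (s, z) \<in> V i)"
  proof (rule Suc.IH)
    show "continuous_map (top_of_set ({a 0..a m} \<times> frontier Z)) X g"
      by (rule continuous_map_from_subtopology_mono[OF Suc.prems(4)]) (use le[of m "Suc m"] in auto)
  qed (use Suc.prems in auto)
  then obtain H where H: "continuous_map (top_of_set ({a 0..a m} \<times> Z)) X H"
    "\<forall>s\<in>{a 0..a m}. \<forall>z\<in>frontier Z. H (s, z) = g (s, z)" "\<forall>i\<le>m. \<forall>z\<in>Z. H (a i, z) = c i z"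
    "\<forall>i<m. \<forall>s\<in>{a i..a (Suc i)}. \<forall>z\<in>Z. H (s, z) \<in> V i"
    by blast
  let ?C = "{a m..a (Suc m)} \<times> Z"
  have am: "a m < a (Suc m)"
    using Suc.prems(2) by simp
  have fC: "frontier ?C = {a m} \<times> Z \<union> {a (Suc m)} \<times> Z \<union> {a m..a (Suc m)} \<times> frontier Z"
    using am Suc.prems(1) by (auto simp: frontier_prism)
  \<comment> \<open>On the rim the wall \<open>g\<close> and the caps \<open>c m\<close>,
    \<open>c (Suc m)\<close> agree by assumption, so the order of the cases is harmless.\<close>
  define \<phi> where "\<phi> = (\<lambda>(s, z). if z \<in> frontier Z then g (s, z) else if s = a m then c m z else c (Suc m) z)"
  have \<phi>_simps: "\<phi> (a m, z) = c m z" "\<phi> (a (Suc m), z) = c (Suc m) z" if "z \<in> Z" for z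
    using Suc.prems(7) am by (auto simp: \<phi>_def)
  have cont: "continuous_map (top_of_set (frontier ?C)) X \<phi>"
    unfolding fC
  proof (intro continuous_map_on_Un_closed closed_Un closed_Times closed_atLeastAtMost)
    show "continuous_map (top_of_set ({a m} \<times> Z)) X \<phi>"
      by (rule continuous_map_compose_eq_on[OF Suc.prems(6)[of m], of _ snd])
        (auto simp: \<phi>_simps intro: continuous_intros)
    show "continuous_map (top_of_set ({a (Suc m)} \<times> Z)) X \<phi>"
      by (rule continuous_map_compose_eq_on[OF Suc.prems(6)[of "Suc m"], of _ snd])
        (auto simp: \<phi>_simps intro: continuous_intros)
    have "continuous_map (top_of_set ({a m..a (Suc m)} \<times> frontier Z)) X g"
      by (rule continuous_map_from_subtopology_mono[OF Suc.prems(4)]) (use le[of 0 m] in auto)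
    then show "continuous_map (top_of_set ({a m..a (Suc m)} \<times> frontier Z)) X \<phi>"
      by (rule continuous_map_eq_on) (auto simp: \<phi>_def)
  qed (use Suc.prems(1) in auto)
  moreover have "\<phi> x \<in> W m" if "x \<in> frontier ?C" for x
    using that Suc.prems(5)[of m] Suc.prems(8)[of m] unfolding fC by (auto simp: \<phi>_simps) (auto simp: \<phi>_def)
  ultimately have "continuous_map (top_of_set (frontier ?C)) (subtopology X (W m)) \<phi>"
    by (auto simp: continuous_map_in_subtopology)
  then obtain h where h: "continuous_map (top_of_set ?C) (subtopology X (V m)) h"
    "\<forall>x\<in>frontier ?C. h x = \<phi> x"
    using Suc.prems(3)[of m] unfolding extendable_def by blast
  have h_simps: "h (a m, z) = c m z" "h (a (Suc m), z) = c (Suc m) z" if "z \<in> Z" for z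
    using that h(2) \<phi>_simps unfolding fC by auto
  define K where "K = (\<lambda>x. if fst x \<le> a m then H x else h x)"
  have eq: "{a 0..a (Suc m)} \<times> Z = {a 0..a m} \<times> Z \<union> ?C"
    using le[of 0 m] am by auto
  have K1: "K (s, z) = H (s, z)" if "s \<le> a m" for s z
    using that by (simp add: K_def)
  have K2: "K (s, z) = h (s, z)" if "a m \<le> s" "z \<in> Z" for s z
    using that H(3) h_simps by (auto simp: K_def)
  have "continuous_map (top_of_set ({a 0..a (Suc m)} \<times> Z)) X K"
    unfolding eq
  proof (rule continuous_map_on_Un_closed)
    show "continuous_map (top_of_set ({a 0..a m} \<times> Z)) X K"
      by (rule continuous_map_eq_on[OF H(1)]) (auto simp: K1)
    show "continuous_map (top_of_set ?C) X K"
      by (rule continuous_map_eq_on[of _ _ h]) (use h(1) in \<open>auto simp: K2 continuous_map_in_subtopology\<close>)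
  qed (use Suc.prems(1) in \<open>auto intro: closed_Times\<close>)
  moreover have "K (s, z) = g (s, z)" if "s \<in> {a 0..a (Suc m)}" "z \<in> frontier Z" for s z
  proof (cases "s \<le> a m")
    case True
    then show ?thesis
      using that H(2) by (simp add: K1)
  next
    case False
    then show ?thesis
      using that sub h(2) fC by (auto simp: K2 \<phi>_def)
  qed
  moreover have "K (a i, z) = c i z" if "i \<le> Suc m" "z \<in> Z" for i z
    using that H(3) am h_simps le[of i m] by (cases "i = Suc m") (auto simp: K1 K2)
  moreover have "K (s, z) \<in> V i" if "i < Suc m" "s \<in> {a i..a (Suc i)}" "z \<in> Z" for i s z
  proof (cases "i = m")
    case True
    then show ?thesis
      using that h(1) by (auto simp: K2 continuous_map_in_subtopology Pi_iff)
  next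
    case False
    then have "s \<le> a m"
      using that le[of "Suc i" m] by auto
    then show ?thesis
      using that False H(4) by (simp add: K1)
  qed
  ultimately show ?case
    by (intro exI[of _ K]) blast
qed

section \<open>Partitions, chains and the filling of boxes over a chain\<close>

lemma chain_data_mono:
  assumes "chain_data X n a W" "i \<le> j" "j \<le> 2 * n + 1"
  shows "a i \<le> a j"
  using assms(2,3)
proof (induction j rule: dec_induct)
  case (step j)
  then show ?case
    using assms(1) by (auto simp: chain_data_def intro: order_trans less_imp_le)
qed auto

lemma chain_data_range:
  assumes "chain_data X n a W" "i \<le> 2 * n + 1"
  shows "0 \<le> a i" "a i \<le> 1"
  using chain_data_mono[OF assms(1), of 0 i] chain_data_mono[OF assms(1), of i "2 * n + 1"] assms
  by (auto simp: chain_data_def)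

lemma chain_data_interval:
  assumes "chain_data X n a W" "s \<in> {0..1}"
  obtains i where "i \<in> {1..2 * n + 1}" "s \<in> {a (i - 1)..a i}"
proof -
  have "\<exists>i. s \<le> a i"
    using assms by (intro exI[of _ "2 * n + 1"]) (auto simp: chain_data_def)
  then obtain i where i: "s \<le> a i" "\<And>j. j < i \<Longrightarrow> \<not> s \<le> a j"
    using exists_least_iff[of "\<lambda>i. s \<le> a i"] by auto
  have "i \<le> 2 * n + 1"
    using i(2)[of "2 * n + 1"] assms by (force simp: chain_data_def not_le[symmetric])
  show ?thesis
  proof (cases i)
    \<comment> \<open>The least index can be 0 only for \<open>s = 0\<close>, which belongs to strip
      1.\<close>
    case 0
    then have "s = a 0"
      using i assms by (auto simp: chain_data_def)
    then show ?thesis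
      using that[of 1] chain_data_mono[OF assms(1), of 0 1] by auto
  next
    case (Suc j)
    then show ?thesis
      using that[of i] i \<open>i \<le> 2 * n + 1\<close> by force
  qed
qed

text \<open>At each inner partition point one of the two adjoining strips has even index, and its
  member is contained in both members; \<open>col\<close> fills the slice there, inside that smaller
  set. Afterwards \<open>strip\<close> fills each box separately. Only slices have to stay in
  \<open>W\<close>, which is why \<open>strip\<close> may use another family \<open>V\<close>. The
  end faces \<open>b0\<close>, \<open>b1\<close> are inputs because the fillings along source and
  target must share them.\<close>

lemma chain_fill:
  fixes Z :: "'e::euclidean_space set"
  assumes chain: "chain_data X n a W" and "closed Z"
    and col: "\<And>i. i \<in> {1..n} \<Longrightarrow> extendable Z (subtopology X (W (2 * i))) (subtopology X (W (2 * i)))"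
    and strip: "\<And>p q i. \<lbrakk>i \<in> {1..2 * n + 1}; p < q\<rbrakk> \<Longrightarrow>
      extendable ({p..q::real} \<times> Z) (subtopology X (W i)) (subtopology X (V i))"
    and g: "continuous_map (top_of_set ({0..1} \<times> frontier Z)) X g"
    and gW: "\<And>i s z. \<lbrakk>i \<in> {1..2 * n + 1}; s \<in> {a (i - 1)..a i}; z \<in> frontier Z\<rbrakk> \<Longrightarrow> g (s, z) \<in> W i"
    and b0: "continuous_map (top_of_set Z) (subtopology X (W 1)) b0"
    and b1: "continuous_map (top_of_set Z) (subtopology X (W (2 * n + 1))) b1"
    and gb: "\<And>z. z \<in> frontier Z \<Longrightarrow> b0 z = g (0, z) \<and> b1 z = g (1, z)"
  shows "\<exists>H. continuous_map (top_of_set ({0..1} \<times> Z)) X H \<and>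
    (\<forall>s\<in>{0..1}. \<forall>z\<in>frontier Z. H (s, z) = g (s, z)) \<and>
    (\<forall>z\<in>Z. H (0, z) = b0 z \<and> H (1, z) = b1 z) \<and>
    (\<forall>i\<in>{1..2 * n + 1}. \<forall>s\<in>{a (i - 1)..a i}. \<forall>z\<in>Z. H (s, z) \<in> V i)"
proof -
  let ?m = "2 * n + 1"
  have a: "a 0 = 0" "a ?m = 1" "\<And>i. i < ?m \<Longrightarrow> a i < a (Suc i)"
    using chain by (auto simp: chain_data_def)
  have sub: "W (2 * k) \<subseteq> W (2 * k - 1)" "W (2 * k) \<subseteq> W (Suc (2 * k))" if "k \<in> {1..n}" for k
    using chain that by (auto simp: chain_data_def)
  have "\<exists>c. continuous_map (top_of_set Z) X c \<and> (\<forall>z\<in>frontier Z. c z = g (a i, z)) \<and>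
      (\<forall>z\<in>Z. c z \<in> W i \<and> c z \<in> W (Suc i))" if i: "i \<in> {1..2 * n}" for i
  proof -
    \<comment> \<open>Of the strips \<open>i\<close> and \<open>i + 1\<close> meeting at
      \<open>a i\<close>, the one with even index is \<open>2 * k\<close>.\<close>
    define k where "k = (i + 1) div 2"
    have k: "k \<in> {1..n}" "i = 2 * k - 1 \<or> i = 2 * k"
      using i unfolding k_def atLeastAtMost_iff by presburger+
    have "continuous_map (top_of_set (frontier Z)) X (\<lambda>z. g (a i, z))"
      by (rule continuous_map_compose_on[OF g])
        (use i chain_data_range[OF chain, of i] in \<open>auto intro!: continuous_intros\<close>)
    moreover have "a (2 * k - 1) \<le> a (2 * k)"
      using chain_data_mono[OF chain, of "2 * k - 1" "2 * k"] k(1) by auto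
    then have "g (a i, z) \<in> W (2 * k)" if "z \<in> frontier Z" for z
      using gW[of "2 * k" "a i" z] k that by auto
    ultimately have "continuous_map (top_of_set (frontier Z)) (subtopology X (W (2 * k))) (\<lambda>z. g (a i, z))"
      by (auto simp: continuous_map_in_subtopology)
    then obtain c where c: "continuous_map (top_of_set Z) (subtopology X (W (2 * k))) c"
      "\<forall>z\<in>frontier Z. c z = g (a i, z)"
      using col[OF k(1)] unfolding extendable_def by blast
    have "c z \<in> W i \<and> c z \<in> W (Suc i)" if "z \<in> Z" for z
    proof -
      have "c z \<in> W (2 * k)"
        using c(1) that by (auto simp: continuous_map_in_subtopology)
      moreover have "W (2 * k) \<subseteq> W i \<and> W (2 * k) \<subseteq> W (Suc i)"
        using k sub[OF k(1)] by auto
      ultimately show ?thesis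
        by blast
    qed
    with c show ?thesis
      by (auto simp: continuous_map_in_subtopology)
  qed
  then obtain c' where c': "\<And>i. i \<in> {1..2 * n} \<Longrightarrow> continuous_map (top_of_set Z) X (c' i) \<and>
      (\<forall>z\<in>frontier Z. c' i z = g (a i, z)) \<and> (\<forall>z\<in>Z. c' i z \<in> W i \<and> c' i z \<in> W (Suc i))"
    by metis
  define c where "c = (\<lambda>i. if i = 0 then b0 else if i = ?m then b1 else c' i)"
  have c_cases: "i = 0 \<or> i = ?m \<or> i \<in> {1..2 * n}" if "i \<le> ?m" for i
    using that by auto
  have "\<exists>H. continuous_map (top_of_set ({a 0..a ?m} \<times> Z)) X H \<and>
    (\<forall>s\<in>{a 0..a ?m}. \<forall>z\<in>frontier Z. H (s, z) = g (s, z)) \<and>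
    (\<forall>i\<le>?m. \<forall>z\<in>Z. H (a i, z) = c i z) \<and>
    (\<forall>i<?m. \<forall>s\<in>{a i..a (Suc i)}. \<forall>z\<in>Z. H (s, z) \<in> V (Suc i))"
  \<comment> \<open>Strips are numbered from 1 in a chain and from 0 in the general lemma, hence the
    shift by \<open>Suc\<close>.\<close>
  proof (rule extend_over_strips[where W = "\<lambda>i. W (Suc i)"])
    show "extendable ({a i..a (Suc i)} \<times> Z) (subtopology X (W (Suc i))) (subtopology X (V (Suc i)))"
      if "i < ?m" for i
      using that a(3) by (intro strip) auto
    show "g (s, z) \<in> W (Suc i)" if "i < ?m" "s \<in> {a i..a (Suc i)}" "z \<in> frontier Z" for i s z
      using that by (intro gW) auto
    show "continuous_map (top_of_set Z) X (c i)" if "i \<le> ?m" for i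
      using c_cases[OF that] b0 b1 c' by (auto simp: c_def continuous_map_in_subtopology)
    show "c i z = g (a i, z)" if "i \<le> ?m" "z \<in> frontier Z" for i z
      using c_cases[OF that(1)] gb[OF that(2)] a(1,2) c' that(2) by (auto simp: c_def)
    show "c i z \<in> W (Suc i) \<and> c (Suc i) z \<in> W (Suc i)" if "i < ?m" "z \<in> Z" for i z
    proof
      show "c i z \<in> W (Suc i)"
        using c_cases[of i] that b0 c' by (auto simp: c_def continuous_map_in_subtopology Pi_iff)
      show "c (Suc i) z \<in> W (Suc i)"
        using c_cases[of "Suc i"] that b1 c' by (auto simp: c_def continuous_map_in_subtopology Pi_iff)
    qed
  qed (use a g \<open>closed Z\<close> in auto)
  then obtain H where H: "continuous_map (top_of_set ({0..1} \<times> Z)) X H"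
    "\<forall>s\<in>{0..1}. \<forall>z\<in>frontier Z. H (s, z) = g (s, z)" "\<forall>i\<le>?m. \<forall>z\<in>Z. H (a i, z) = c i z"
    "\<forall>i<?m. \<forall>s\<in>{a i..a (Suc i)}. \<forall>z\<in>Z. H (s, z) \<in> V (Suc i)"
    unfolding a(1,2) by blast
  show ?thesis
  proof (intro exI[of _ H] conjI H(1,2))
    show "\<forall>z\<in>Z. H (0, z) = b0 z \<and> H (1, z) = b1 z"
      using H(3) a(1,2) by (force simp: c_def)
    show "\<forall>i\<in>{1..?m}. \<forall>s\<in>{a (i - 1)..a i}. \<forall>z\<in>Z. H (s, z) \<in> V i"
    proof
      fix i assume "i \<in> {1..?m}"
      then have "i - 1 < ?m" "Suc (i - 1) = i"
        by auto
      then show "\<forall>s\<in>{a (i - 1)..a i}. \<forall>z\<in>Z. H (s, z) \<in> V i"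
        using H(4) by metis
    qed
  qed
qed

section \<open>Deformations of bigons\<close>

lemma topspace_path_space:
  "topspace (path_space X) = {f \<in> extensional {0..1}. continuous_map unit_interval X f}"
proof -
  \<comment> \<open>With \<open>K\<close> empty the subbasic condition is void, so every path lies
    in a generating set.\<close>
  have "\<exists>K U. compactin unit_interval K \<and> openin X U \<and> f ` K \<subseteq> U" for f :: "real \<Rightarrow> 'a"
    by (rule exI[of _ "{}"]) auto
  then show ?thesis
    by (auto simp: path_space_def compact_open_topology_def)
qed

lemma path_nbhd_iff:
  "\<eta> \<in> path_nbhd X n a W \<longleftrightarrow> \<eta> \<in> topspace (path_space X) \<and>
    (\<forall>i\<in>{1..2 * n + 1}. \<forall>s\<in>{a (i - 1)..a i}. \<eta> s \<in> W i)"
  by (auto simp: path_nbhd_def)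

lemma path_nbhd_endpoints:
  assumes "chain_data X n a W" "\<eta> \<in> path_nbhd X n a W"
  shows "\<eta> 0 \<in> W 1" "\<eta> 1 \<in> W (2 * n + 1)"
proof -
  have "\<eta> s \<in> W i" if "i \<in> {1..2 * n + 1}" "s \<in> {a (i - 1)..a i}" for i s
    using assms(2) that by (auto simp: path_nbhd_iff)
  from this[of 1 0] this[of "2 * n + 1" 1] show "\<eta> 0 \<in> W 1" "\<eta> 1 \<in> W (2 * n + 1)"
    using chain_data_range[OF assms(1), of 1] chain_data_range[OF assms(1), of "2 * n"] assms(1)
    by (auto simp: chain_data_def)
qed

lemma slice_apply [simp]: "s \<in> {0..1} \<Longrightarrow> slice f t s = f (s, t)"
  by (simp add: slice_def)

lemma slice_in_path_space:
  assumes "continuous_map unit_square X f" "t \<in> {0..1}"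
  shows "slice f t \<in> topspace (path_space X)"
proof -
  have "continuous_map unit_interval X (\<lambda>s. f (s, t))"
    by (rule continuous_map_compose_on[OF assms(1)]) (use assms(2) in \<open>auto intro!: continuous_intros\<close>)
  then have "continuous_map unit_interval X (slice f t)"
    by (rule continuous_map_eq_on) simp
  then show ?thesis
    by (simp add: topspace_path_space slice_def)
qed

lemma chain_data_strip:
  assumes "chain_data X n a W" "i \<in> {1..2 * n + 1}" "s \<in> {a (i - 1)..a i}"
  shows "s \<in> {0..1}"
proof -
  have "i - 1 \<le> 2 * n + 1" "i \<le> 2 * n + 1"
    using assms(2) by auto
  from chain_data_range[OF assms(1) this(1)] chain_data_range[OF assms(1) this(2)] show ?thesis
    using assms(3) by auto
qed

lemma slice_in_path_nbhd_iff:
  assumes "chain_data X n a W" "continuous_map unit_square X f" "t \<in> {0..1}"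
  shows "slice f t \<in> path_nbhd X n a W \<longleftrightarrow> (\<forall>i\<in>{1..2 * n + 1}. \<forall>s\<in>{a (i - 1)..a i}. f (s, t) \<in> W i)"
  using slice_in_path_space[OF assms(2,3)] chain_data_strip[OF assms(1)] by (simp add: path_nbhd_iff)

lemma slice_eq_iff: "slice f t = slice g u \<longleftrightarrow> (\<forall>s\<in>{0..1}. f (s, t) = g (s, u))"
proof
  assume eq: "slice f t = slice g u"
  show "\<forall>s\<in>{0..1}. f (s, t) = g (s, u)"
    using fun_cong[OF eq] by (metis slice_apply)
next
  assume "\<forall>s\<in>{0..1}. f (s, t) = g (s, u)"
  then show "slice f t = slice g u"
    unfolding slice_def by (intro restrict_ext) simp
qed

text \<open>The relation below replaces the whiskered pasting in \<^const>\<open>track_nbhd\<close>: a 2-track lies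
  in such a neighbourhood of \<open>c\<close> if and only if it can be deformed to \<open>c\<close> through bigons with end
  points in \<open>A0\<close> and \<open>A1\<close> and with source and target in \<open>V0\<close> and \<open>V1\<close>.\<close>

definition bigon_in :: "'a set \<Rightarrow> 'a set \<Rightarrow> (real \<Rightarrow> 'a) set \<Rightarrow> (real \<Rightarrow> 'a) set \<Rightarrow> (real \<times> real \<Rightarrow> 'a) \<Rightarrow> bool" where
  "bigon_in A0 A1 V0 V1 k \<longleftrightarrow> (\<forall>t\<in>{0..1}. k (0, t) = k (0, 0) \<and> k (1, t) = k (1, 0)) \<and>
     k (0, 0) \<in> A0 \<and> k (1, 0) \<in> A1 \<and> slice k 0 \<in> V0 \<and> slice k 1 \<in> V1"

definition deformable_in :: "'a topology \<Rightarrow> 'a set \<Rightarrow> 'a set \<Rightarrow> (real \<Rightarrow> 'a) set \<Rightarrow> (real \<Rightarrow> 'a) set \<Rightarrow>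
    (real \<times> real \<Rightarrow> 'a) \<Rightarrow> (real \<times> real \<Rightarrow> 'a) \<Rightarrow> bool" where
  "deformable_in X A0 A1 V0 V1 = homotopic_with (bigon_in A0 A1 V0 V1) unit_square X"

lemma bigon_in_cong:
  assumes "\<And>x. x \<in> {0..1} \<times> {0..1} \<Longrightarrow> h x = k x"
  shows "bigon_in A0 A1 V0 V1 h = bigon_in A0 A1 V0 V1 k"
proof -
  have "slice h t = slice k t" if "t \<in> {0..1}" for t
    using that assms by (auto simp: slice_eq_iff)
  then show ?thesis
    using assms by (auto simp: bigon_in_def)
qed

lemma bigon_inD:
  assumes "bigon_in A0 A1 V0 V1 k"
  shows "t \<in> {0..1} \<Longrightarrow> k (0, t) = k (0, 0)" "t \<in> {0..1} \<Longrightarrow> k (1, t) = k (1, 0)"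
    "k (0, 0) \<in> A0" "k (1, 0) \<in> A1" "slice k 0 \<in> V0" "slice k 1 \<in> V1"
  using assms unfolding bigon_in_def by blast+

lemma deformable_inI:
  assumes "continuous_map (top_of_set unit_cube) X K"
    and "\<And>x. x \<in> {0..1} \<times> {0..1} \<Longrightarrow> K (0, x) = f x" "\<And>x. x \<in> {0..1} \<times> {0..1} \<Longrightarrow> K (1, x) = g x"
    and "\<And>r. 0 \<le> r \<Longrightarrow> r \<le> 1 \<Longrightarrow> bigon_in A0 A1 V0 V1 (\<lambda>x. K (r, x))"
  shows "deformable_in X A0 A1 V0 V1 f g"
  unfolding deformable_in_def
proof (rule homotopic_with_top_of_setI[OF assms(1)])
  show "bigon_in A0 A1 V0 V1 h = bigon_in A0 A1 V0 V1 k" if "\<And>x. x \<in> {0..1} \<times> {0..1} \<Longrightarrow> h x = k x" for h k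
    by (rule bigon_in_cong) (rule that)
qed (use assms(2-4) in auto)

lemma deformable_inD:
  assumes "deformable_in X A0 A1 V0 V1 f g"
  shows "\<exists>K. continuous_map (top_of_set unit_cube) X K \<and> (\<forall>x. K (0, x) = f x) \<and>
    (\<forall>x. K (1, x) = g x) \<and> (\<forall>r\<in>{0..1}. bigon_in A0 A1 V0 V1 (\<lambda>x. K (r, x)))"
  using assms unfolding deformable_in_def by (rule homotopic_with_top_of_setD)

text \<open>What remains of the side conditions in \<open>two_track_topology\<close> when the centre
  \<open>c\<close> is dropped, so that sheets with different centres can be compared over the same
  data.\<close>

definition nbhd_data :: "'a topology \<Rightarrow> 'a set \<Rightarrow> 'a set \<Rightarrow> nat \<Rightarrow> (nat \<Rightarrow> real) \<Rightarrow> (nat \<Rightarrow> 'a set) \<Rightarrow>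
    nat \<Rightarrow> (nat \<Rightarrow> real) \<Rightarrow> (nat \<Rightarrow> 'a set) \<Rightarrow> bool" where
  "nbhd_data X U0 U1 n0 a0 W0 n1 a1 W1 \<longleftrightarrow> chain_data X n0 a0 W0 \<and> chain_data X n1 a1 W1 \<and>
     basic_open X U0 \<and> basic_open X U1 \<and> U0 \<subseteq> W0 1 \<inter> W1 1 \<and> U1 \<subseteq> W0 (2 * n0 + 1) \<inter> W1 (2 * n1 + 1)"

text \<open>\<open>chain_fill\<close> for \<open>Z\<close> an interval and \<open>V\<close> equal to
  \<open>W\<close>: the two paths are the walls, and the prescribed motions \<open>b0\<close>,
  \<open>b1\<close> of the end points are the end faces.\<close>

lemma chain_homotopy:
  assumes chain: "chain_data X n a W" and "\<gamma> \<in> path_nbhd X n a W" "\<eta> \<in> path_nbhd X n a W"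
    and b0: "continuous_map unit_interval (subtopology X (W 1)) b0" "b0 0 = \<gamma> 0" "b0 1 = \<eta> 0"
    and b1: "continuous_map unit_interval (subtopology X (W (2 * n + 1))) b1" "b1 0 = \<gamma> 1" "b1 1 = \<eta> 1"
  obtains H where "continuous_map unit_square X H"
    "\<forall>s\<in>{0..1}. H (s, 0) = \<gamma> s \<and> H (s, 1) = \<eta> s" "\<forall>r\<in>{0..1}. H (0, r) = b0 r \<and> H (1, r) = b1 r"
    "\<forall>i\<in>{1..2 * n + 1}. \<forall>s\<in>{a (i - 1)..a i}. \<forall>r\<in>{0..1}. H (s, r) \<in> W i"
proof -
  have basic: "basic_open X (W i)" if "i \<in> {1..2 * n + 1}" for i
    using chain that by (simp add: chain_data_def)
  define g where "g = (\<lambda>(s, r::real). if r = 0 then \<gamma> s else \<eta> s)"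
  have paths: "continuous_map unit_interval X \<gamma>" "continuous_map unit_interval X \<eta>"
    using assms(2,3) by (auto simp: path_nbhd_iff topspace_path_space)
  have "continuous_map (top_of_set ({0..1} \<times> {0} \<union> {0..1} \<times> {1})) X g"
  proof (rule continuous_map_on_Un_closed)
    show "continuous_map (top_of_set ({0..1} \<times> {0})) X g"
      by (rule continuous_map_compose_eq_on[OF paths(1), of _ fst])
        (auto simp: g_def intro: continuous_intros)
    show "continuous_map (top_of_set ({0..1} \<times> {1})) X g"
      by (rule continuous_map_compose_eq_on[OF paths(2), of _ fst])
        (auto simp: g_def intro: continuous_intros)
  qed (auto intro: closed_Times)
  moreover have "{0..1} \<times> frontier {0..1::real} = {0..1::real} \<times> {0} \<union> {0..1} \<times> {1}"
    by (auto simp: frontier_unit_interval)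
  ultimately have g: "continuous_map (top_of_set ({0..1} \<times> frontier {0..1})) X g"
    by simp
  have "\<exists>H. continuous_map (top_of_set ({0..1} \<times> {0..1})) X H \<and>
    (\<forall>s\<in>{0..1}. \<forall>r\<in>frontier {0..1}. H (s, r) = g (s, r)) \<and>
    (\<forall>r\<in>{0..1}. H (0, r) = b0 r \<and> H (1, r) = b1 r) \<and>
    (\<forall>i\<in>{1..2 * n + 1}. \<forall>s\<in>{a (i - 1)..a i}. \<forall>r\<in>{0..1}. H (s, r) \<in> W i)"
  proof (rule chain_fill[OF chain _ _ _ g _ b0(1) b1(1)])
    show "extendable {0..1::real} (subtopology X (W (2 * i))) (subtopology X (W (2 * i)))"
      if "i \<in> {1..n}" for i
      using that by (intro basic_open_extendable_interval basic) auto
    show "extendable ({p..q::real} \<times> {0..1::real}) (subtopology X (W i)) (subtopology X (W i))"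
      if "i \<in> {1..2 * n + 1}" "p < q" for p q i
      using that by (intro basic_open_extendable_square basic) auto
    show "g (s, z) \<in> W i" if "i \<in> {1..2 * n + 1}" "s \<in> {a (i - 1)..a i}" "z \<in> frontier {0..1}" for i s z
      using that assms(2,3) by (auto simp: g_def path_nbhd_iff)
    show "b0 z = g (0, z) \<and> b1 z = g (1, z)" if "z \<in> frontier {0..1}" for z
      using that b0 b1 by (auto simp: g_def frontier_unit_interval)
  qed auto
  then obtain H where H: "continuous_map (top_of_set ({0..1} \<times> {0..1})) X H"
    "\<forall>s\<in>{0..1}. \<forall>r\<in>frontier {0..1}. H (s, r) = g (s, r)"
    "\<forall>r\<in>{0..1}. H (0, r) = b0 r \<and> H (1, r) = b1 r"
    "\<forall>i\<in>{1..2 * n + 1}. \<forall>s\<in>{a (i - 1)..a i}. \<forall>r\<in>{0..1}. H (s, r) \<in> W i"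
    by (elim exE conjE)
  have "\<forall>s\<in>{0..1}. H (s, 0) = \<gamma> s \<and> H (s, 1) = \<eta> s"
    using H(2) by (simp add: frontier_unit_interval g_def)
  then show ?thesis
    using that[OF H(1) _ H(3,4)] by blast
qed

lemma basic_open_path:
  assumes "basic_open X U" "x \<in> U" "y \<in> U"
  obtains b where "continuous_map unit_interval (subtopology X U) b" "b 0 = x" "b 1 = y"
proof -
  have "path_connectedin X U"
    using assms(1) unfolding basic_open_def simply_connected_in_def by (elim conjE)
  then have "U \<subseteq> topspace X" "path_connected_space (subtopology X U)"
    by (simp_all add: path_connectedin_def)
  moreover from this have "x \<in> topspace (subtopology X U)" "y \<in> topspace (subtopology X U)"
    using assms(2,3) by auto
  ultimately obtain b where "pathin (subtopology X U) b" "b 0 = x" "b 1 = y"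
    unfolding path_connected_space_def by blast
  then show ?thesis
    using that by (simp add: pathin_def)
qed

text \<open>All stages must be constant on the vertical sides, so the source and the target have to
  be moved with the same motions \<open>b0\<close>, \<open>b1\<close> of their end points. This is
  possible because \<open>U0\<close> and \<open>U1\<close> lie in the extreme members of both
  chains. The square \<open>h\<close> and the four walls then extend over the cube, and the lid is
  \<open>f\<close>.\<close>

lemma deformable_in_lift:
  assumes data: "nbhd_data X U0 U1 n0 a0 W0 n1 a1 W1"
    and h: "continuous_map unit_square X h"
      "bigon_in U0 U1 (path_nbhd X n0 a0 W0) (path_nbhd X n1 a1 W1) h"
    and \<eta>: "\<eta>0 \<in> path_nbhd X n0 a0 W0" "\<eta>1 \<in> path_nbhd X n1 a1 W1"
      "\<eta>0 0 = \<eta>1 0" "\<eta>0 1 = \<eta>1 1" "\<eta>0 0 \<in> U0" "\<eta>0 1 \<in> U1"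
  obtains f where "deformable_in X U0 U1 (path_nbhd X n0 a0 W0) (path_nbhd X n1 a1 W1) h f"
    "slice f 0 = \<eta>0" "slice f 1 = \<eta>1"
proof -
  have chain: "chain_data X n0 a0 W0" "chain_data X n1 a1 W1"
    using data by (auto simp: nbhd_data_def)
  note sides = bigon_inD(1,2)[OF h(2)]
  have h1: "h (0, 1) = h (0, 0)" "h (1, 1) = h (1, 0)"
    by (rule sides; simp)+
  obtain b0 where b0: "continuous_map unit_interval (subtopology X U0) b0" "b0 0 = h (0, 0)" "b0 1 = \<eta>0 0"
    using basic_open_path[of X U0 "h (0, 0)" "\<eta>0 0"] data bigon_inD(3,4)[OF h(2)] \<eta> by (auto simp: nbhd_data_def)
  obtain b1 where b1: "continuous_map unit_interval (subtopology X U1) b1" "b1 0 = h (1, 0)" "b1 1 = \<eta>0 1"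
    using basic_open_path[of X U1 "h (1, 0)" "\<eta>0 1"] data bigon_inD(3,4)[OF h(2)] \<eta> by (auto simp: nbhd_data_def)
  have mono: "continuous_map unit_interval (subtopology X W) b"
    if "continuous_map unit_interval (subtopology X U) b" "U \<subseteq> W" for U W b
    using that by (auto simp: continuous_map_in_subtopology)
  obtain H0 where H0: "continuous_map unit_square X H0"
    "\<forall>s\<in>{0..1}. H0 (s, 0) = slice h 0 s \<and> H0 (s, 1) = \<eta>0 s" "\<forall>r\<in>{0..1}. H0 (0, r) = b0 r \<and> H0 (1, r) = b1 r"
    "\<forall>i\<in>{1..2 * n0 + 1}. \<forall>s\<in>{a0 (i - 1)..a0 i}. \<forall>r\<in>{0..1}. H0 (s, r) \<in> W0 i"
    by (rule chain_homotopy[OF chain(1) _ \<eta>(1), of "slice h 0" b0 b1])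
      (use bigon_inD(5)[OF h(2)] b0 b1 data in \<open>auto simp: nbhd_data_def intro: mono\<close>)
  obtain H1 where H1: "continuous_map unit_square X H1"
    "\<forall>s\<in>{0..1}. H1 (s, 0) = slice h 1 s \<and> H1 (s, 1) = \<eta>1 s" "\<forall>r\<in>{0..1}. H1 (0, r) = b0 r \<and> H1 (1, r) = b1 r"
    "\<forall>i\<in>{1..2 * n1 + 1}. \<forall>s\<in>{a1 (i - 1)..a1 i}. \<forall>r\<in>{0..1}. H1 (s, r) \<in> W1 i"
    by (rule chain_homotopy[OF chain(2) _ \<eta>(2), of "slice h 1" b0 b1])
      (use bigon_inD(6)[OF h(2)] b0 b1 data \<eta>(3,4) h1 in \<open>auto simp: nbhd_data_def intro: mono\<close>)
  \<comment> \<open>\<open>r\<close> is the deformation parameter. The walls \<open>s = 0\<close>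
    and \<open>s = 1\<close> do not depend on \<open>t\<close>, which keeps every stage a
    bigon.\<close>
  define G where "G = (\<lambda>(r, s, t::real). if s = 0 then b0 r else if s = 1 then b1 r
    else if t = 0 then H0 (s, r) else H1 (s, r))"
  have "continuous_map (top_of_set ({0..1} \<times> (({0} \<times> {0..1} \<union> {1} \<times> {0..1}) \<union> ({0..1} \<times> {0} \<union> {0..1} \<times> {1})))) X G"
    unfolding Sigma_Un_distrib2
  proof (intro continuous_map_on_Un_closed)
    show "continuous_map (top_of_set ({0..1} \<times> {0} \<times> {0..1})) X G"
      by (rule continuous_map_eq_on[OF continuous_map_compose_on[of "{0..1}" X b0 _ fst]])
        (use b0(1) in \<open>auto simp: G_def continuous_map_in_subtopology intro: continuous_intros\<close>)
    show "continuous_map (top_of_set ({0..1} \<times> {1} \<times> {0..1})) X G"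
      by (rule continuous_map_eq_on[OF continuous_map_compose_on[of "{0..1}" X b1 _ fst]])
        (use b1(1) in \<open>auto simp: G_def continuous_map_in_subtopology intro: continuous_intros\<close>)
    show "continuous_map (top_of_set ({0..1} \<times> {0..1} \<times> {0})) X G"
      by (rule continuous_map_compose_eq_on[OF H0(1), of _ "\<lambda>(r, s, t). (s, r)"])
        (use H0(3) in \<open>auto simp: G_def case_prod_unfold intro!: continuous_intros\<close>)
    show "continuous_map (top_of_set ({0..1} \<times> {0..1} \<times> {1})) X G"
      by (rule continuous_map_compose_eq_on[OF H1(1), of _ "\<lambda>(r, s, t). (s, r)"])
        (use H1(3) in \<open>auto simp: G_def case_prod_unfold intro!: continuous_intros\<close>)
  qed (auto intro!: closed_Times closed_Un)
  moreover have bd: "frontier ({0..1::real} \<times> {0..1::real}) = ({0} \<times> {0..1} \<union> {1} \<times> {0..1}) \<union> ({0..1} \<times> {0} \<union> {0..1} \<times> {1})"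
    by (auto simp: frontier_unit_square square_boundary_def)
  ultimately have G: "continuous_map (top_of_set ({0..1} \<times> frontier ({0..1} \<times> {0..1}))) X G"
    by simp
  have G0: "G (0, x) = h x" if xin: "x \<in> frontier ({0..1} \<times> {0..1})" for x
  proof -
    obtain s t where x: "x = (s, t)" "s \<in> {0..1}" "t \<in> {0..1}"
      and cases: "s = 0 \<or> s = 1 \<or> t = 0 \<or> t = 1"
      using xin unfolding bd by (cases x) auto
    then show ?thesis
      using sides[of t] H0(2) H1(2) b0(2) b1(2) by (auto simp: G_def)
  qed
  obtain K where K: "continuous_map (top_of_set unit_cube) X K"
    "\<And>x. x \<in> {0..1} \<times> {0..1} \<Longrightarrow> K (0, x) = h x"
    "\<And>r x. 0 \<le> r \<Longrightarrow> r \<le> 1 \<Longrightarrow> x \<in> frontier ({0..1} \<times> {0..1}) \<Longrightarrow> K (r, x) = G (r, x)"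
    by (rule homotopy_extension_convex[OF _ _ interior_unit_square h(1) G G0])
      (auto simp: compact_Times convex_Times)
  have K_simps: "K (r, 0, t) = b0 r" "K (r, 1, t) = b1 r" "K (r, t, 0) = H0 (t, r)" "K (r, t, 1) = H1 (t, r)"
    if "r \<in> {0..1}" "t \<in> {0..1}" for r t
    using that K(3) H0(3) H1(3) unfolding bd by (auto simp: G_def)
  show ?thesis
  proof (rule that[of "\<lambda>x. K (1, x)"])
    show "deformable_in X U0 U1 (path_nbhd X n0 a0 W0) (path_nbhd X n1 a1 W1) h (\<lambda>x. K (1, x))"
    proof (rule deformable_inI[OF K(1,2)])
      fix r :: real assume r: "0 \<le> r" "r \<le> 1"
      have cont: "continuous_map unit_square X (\<lambda>x. K (r, x))"
        by (rule continuous_map_homotopy_at[OF K(1)]) (use r in auto)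
      have "b0 r \<in> U0" "b1 r \<in> U1"
        using b0(1) b1(1) r by (auto simp: continuous_map_in_subtopology)
      moreover have "slice (\<lambda>x. K (r, x)) 0 \<in> path_nbhd X n0 a0 W0"
        using slice_in_path_nbhd_iff[OF chain(1) cont, of 0] chain_data_strip[OF chain(1)] H0(4) K_simps r
        by simp
      moreover have "slice (\<lambda>x. K (r, x)) 1 \<in> path_nbhd X n1 a1 W1"
        using slice_in_path_nbhd_iff[OF chain(2) cont, of 1] chain_data_strip[OF chain(2)] H1(4) K_simps r
        by simp
      ultimately show "bigon_in U0 U1 (path_nbhd X n0 a0 W0) (path_nbhd X n1 a1 W1) (\<lambda>x. K (r, x))"
        using r H0(3) by (simp add: bigon_in_def K_simps)
    qed auto
    have ext: "\<eta>0 \<in> extensional {0..1}" "\<eta>1 \<in> extensional {0..1}"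
      using \<eta>(1,2) by (auto simp: path_nbhd_iff topspace_path_space)
    show "slice (\<lambda>x. K (1, x)) 0 = \<eta>0"
      by (rule extensionalityI[OF _ ext(1)]) (use H0(2) K_simps in \<open>auto simp: slice_def\<close>)
    show "slice (\<lambda>x. K (1, x)) 1 = \<eta>1"
      by (rule extensionalityI[OF _ ext(2)]) (use H1(2) K_simps in \<open>auto simp: slice_def\<close>)
  qed
qed

text \<open>A null-homotopy fixing the base point, as the filling of a square with the loop on one
  edge and the base point on the other three.\<close>

lemma basic_open_loop_null:
  assumes "basic_open X U" "continuous_map unit_interval (subtopology X U) l" "l 0 = l 1"
  obtains B where "continuous_map unit_square (subtopology X U) B" "\<forall>r\<in>{0..1}. B (r, 0) = l r"
    "\<forall>r\<in>{0..1}. B (r, 1) = l 0 \<and> B (0, r) = l 0 \<and> B (1, r) = l 0"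
proof -
  define \<phi> where "\<phi> = (\<lambda>(r, c::real). if c = 0 then l r else l 0)"
  note fr = frontier_unit_square_split
  have l0: "l 0 \<in> topspace (subtopology X U)"
    using assms(2) by (auto simp: continuous_map_def)
  have "continuous_map (top_of_set (frontier ({0..1} \<times> {0..1}))) (subtopology X U) \<phi>"
    unfolding fr
  proof (rule continuous_map_on_Un_closed)
    show "continuous_map (top_of_set ({0, 1} \<times> {0..1} \<union> {0..1} \<times> {1})) (subtopology X U) \<phi>"
      by (rule continuous_map_eq_on[of _ _ "\<lambda>_. l 0"]) (use l0 assms(3) in \<open>auto simp: \<phi>_def\<close>)
    show "continuous_map (top_of_set ({0..1} \<times> {0})) (subtopology X U) \<phi>"
      by (rule continuous_map_compose_eq_on[OF assms(2), of _ fst])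
        (auto simp: \<phi>_def intro: continuous_intros)
  qed (auto intro!: closed_Times closed_Un)
  then obtain B where B: "continuous_map unit_square (subtopology X U) B"
    "\<forall>x\<in>frontier ({0..1} \<times> {0..1}). B x = \<phi> x"
    using basic_open_extendable_square[OF assms(1), of 0 1] unfolding extendable_def by auto
  have "B (r, 0) = l r" "B (r, 1) = l 0" "B (0, r) = l 0" "B (1, r) = l 0" if "r \<in> {0..1}" for r
    using that B(2) assms(3) unfolding fr by (auto simp: \<phi>_def)
  then show ?thesis
    using that[OF B(1)] by blast
qed

text \<open>\<open>L\<close> is a loop of paths with loop parameter \<open>r\<close>, and
  \<open>M\<close> contracts it with parameter \<open>c\<close>. In \<open>chain_fill\<close> with
  \<open>Z\<close> the square of pairs \<open>(r, c)\<close>, slices over partition points are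
  filled in the even members by simple connectedness, and the boxes between them with values in
  \<open>X\<close> by the \<open>pi2\<close> condition.\<close>

lemma chain_loop_null:
  assumes chain: "chain_data X n a W"
    and L: "continuous_map unit_square X L"
    and L01: "\<And>s. s \<in> {0..1} \<Longrightarrow> L (s, 1) = L (s, 0)"
    and LW: "\<And>i s r. \<lbrakk>i \<in> {1..2 * n + 1}; s \<in> {a (i - 1)..a i}; r \<in> {0..1}\<rbrakk> \<Longrightarrow> L (s, r) \<in> W i"
    and B0: "continuous_map unit_square (subtopology X (W 1)) B0"
      "\<forall>r\<in>{0..1}. B0 (r, 0) = L (0, r)" "\<forall>r\<in>{0..1}. B0 (r, 1) = L (0, 0) \<and> B0 (0, r) = L (0, 0) \<and> B0 (1, r) = L (0, 0)"
    and B1: "continuous_map unit_square (subtopology X (W (2 * n + 1))) B1"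
      "\<forall>r\<in>{0..1}. B1 (r, 0) = L (1, r)" "\<forall>r\<in>{0..1}. B1 (r, 1) = L (1, 0) \<and> B1 (0, r) = L (1, 0) \<and> B1 (1, r) = L (1, 0)"
  shows "\<exists>M. continuous_map (top_of_set unit_cube) X M \<and>
    (\<forall>z\<in>{0..1} \<times> {0..1}. M (0, z) = B0 z \<and> M (1, z) = B1 z) \<and>
    (\<forall>s\<in>{0..1}. \<forall>r\<in>{0..1}. M (s, r, 0) = L (s, r) \<and> M (s, r, 1) = L (s, 0) \<and>
      M (s, 0, r) = L (s, 0) \<and> M (s, 1, r) = L (s, 0))"
proof -
  have basic: "basic_open X (W i)" if "i \<in> {1..2 * n + 1}" for i
    using chain that by (simp add: chain_data_def)
  \<comment> \<open>On the frontier of the \<open>(r, c)\<close>-square: the given loop for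
    \<open>c = 0\<close>, and its base path on the three other edges.\<close>
  define g where "g = (\<lambda>(s, r, c::real). if c = 0 then L (s, r) else L (s, 0::real))"
  note fr = frontier_unit_square_split
  have g: "continuous_map (top_of_set ({0..1} \<times> frontier ({0..1} \<times> {0..1}))) X g"
    unfolding fr Sigma_Un_distrib2[of "{0..1}" _ "\<lambda>_. {0..1} \<times> {0}"]
  proof (rule continuous_map_on_Un_closed)
    have "continuous_map (top_of_set ({0..1} \<times> ({0, 1} \<times> {0..1} \<union> {0..1} \<times> {1}))) X (\<lambda>x. L (fst x, 0))"
      by (rule continuous_map_compose_on[OF L]) (auto intro!: continuous_intros)
    then show "continuous_map (top_of_set ({0..1} \<times> ({0, 1} \<times> {0..1} \<union> {0..1} \<times> {1}))) X g"
      by (rule continuous_map_eq_on) (use L01 in \<open>auto simp: g_def\<close>)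
    show "continuous_map (top_of_set ({0..1} \<times> {0..1} \<times> {0})) X g"
      by (rule continuous_map_compose_eq_on[OF L, of _ "\<lambda>(s, r, c). (s, r)"])
        (auto simp: g_def case_prod_unfold intro!: continuous_intros)
  qed (auto intro!: closed_Times closed_Un)
  have "\<exists>M. continuous_map (top_of_set unit_cube) X M \<and>
    (\<forall>s\<in>{0..1}. \<forall>z\<in>frontier ({0..1} \<times> {0..1}). M (s, z) = g (s, z)) \<and>
    (\<forall>z\<in>{0..1} \<times> {0..1}. M (0, z) = B0 z \<and> M (1, z) = B1 z) \<and>
    (\<forall>i\<in>{1..2 * n + 1}. \<forall>s\<in>{a (i - 1)..a i}. \<forall>z\<in>{0..1} \<times> {0..1}. M (s, z) \<in> topspace X)"
  proof (rule chain_fill[OF chain _ _ _ g _ B0(1) B1(1)])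
    show "extendable ({0..1::real} \<times> {0..1::real}) (subtopology X (W (2 * i))) (subtopology X (W (2 * i)))"
      if "i \<in> {1..n}" for i
      using that by (intro basic_open_extendable_square basic) auto
    show "extendable ({p..q::real} \<times> ({0..1::real} \<times> {0..1::real})) (subtopology X (W i)) (subtopology X (topspace X))"
      if "i \<in> {1..2 * n + 1}" "p < q" for p q i
      using basic_open_extendable_cube[OF basic[OF that(1)] that(2)] by simp
    show "g (s, z) \<in> W i" if "i \<in> {1..2 * n + 1}" "s \<in> {a (i - 1)..a i}" "z \<in> frontier ({0..1} \<times> {0..1})" for i s z
      using that LW[OF that(1,2)] unfolding fr by (auto simp: g_def)
    show "B0 z = g (0, z) \<and> B1 z = g (1, z)" if "z \<in> frontier ({0..1} \<times> {0..1})" for z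
      using that B0(2,3) B1(2,3) L01 unfolding fr by (fastforce simp: g_def)
  qed (auto intro: closed_Times)
  then obtain M where M: "continuous_map (top_of_set unit_cube) X M"
    "\<forall>s\<in>{0..1}. \<forall>z\<in>frontier ({0..1} \<times> {0..1}). M (s, z) = g (s, z)"
    "\<forall>z\<in>{0..1} \<times> {0..1}. M (0, z) = B0 z \<and> M (1, z) = B1 z"
    by blast
  have "M (s, r, 0) = L (s, r)" "M (s, r, 1) = L (s, 0)" "M (s, 0, r) = L (s, 0)" "M (s, 1, r) = L (s, 0)"
    if "s \<in> {0..1}" "r \<in> {0..1}" for s r
    using that M(2) L01 unfolding fr by (auto simp: g_def)
  with M show ?thesis
    by blast
qed

text \<open>The deformation \<open>K\<close> fails to be relative to the boundary only on its four
  walls, which are loops because \<open>f\<close> and \<open>f'\<close> have equal boundary.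
  Contracting these loops compatibly gives a homotopy of \<open>K\<close> on the surface of the cube
  that leaves the faces \<open>f\<close> and \<open>f'\<close> alone. Extended over the cube, it
  ends in a map whose walls are constant in \<open>r\<close>, that is, in a relative
  homotopy.\<close>

lemma deformable_in_unique:
  assumes data: "nbhd_data X U0 U1 n0 a0 W0 n1 a1 W1"
    and def: "deformable_in X U0 U1 (path_nbhd X n0 a0 W0) (path_nbhd X n1 a1 W1) f f'"
    and slices: "slice f 0 = slice f' 0" "slice f 1 = slice f' 1"
  shows "homotopic_rel square_boundary unit_square X f f'"
proof -
  have chain: "chain_data X n0 a0 W0" "chain_data X n1 a1 W1" and basic: "basic_open X U0" "basic_open X U1"
    and U: "U0 \<subseteq> W0 1" "U0 \<subseteq> W1 1" "U1 \<subseteq> W0 (2 * n0 + 1)" "U1 \<subseteq> W1 (2 * n1 + 1)"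
    using data by (auto simp: nbhd_data_def)
  obtain K where K: "continuous_map (top_of_set unit_cube) X K"
    "\<forall>x. K (0, x) = f x" "\<forall>x. K (1, x) = f' x"
    "\<forall>r\<in>{0..1}. bigon_in U0 U1 (path_nbhd X n0 a0 W0) (path_nbhd X n1 a1 W1) (\<lambda>x. K (r, x))"
    using deformable_inD[OF def] by blast
  have Kr: "bigon_in U0 U1 (path_nbhd X n0 a0 W0) (path_nbhd X n1 a1 W1) (\<lambda>x. K (r, x))" if "r \<in> {0..1}" for r
    using K(4) that by blast
  note Kcont = continuous_map_homotopy_at[OF K(1)]
  note sides = bigon_inD(1,2)[OF Kr]
  have K01: "K (1, s, 0) = K (0, s, 0)" "K (1, s, 1) = K (0, s, 1)" if "s \<in> {0..1}" for s
    using slices that K(2,3) unfolding slice_eq_iff by auto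
  have l0: "continuous_map unit_interval (subtopology X U0) (\<lambda>r. K (r, 0, 0))"
    using bigon_inD(3)[OF Kr]
    by (auto simp: continuous_map_in_subtopology intro!: continuous_map_compose_on[OF K(1)] continuous_intros)
  have l1: "continuous_map unit_interval (subtopology X U1) (\<lambda>r. K (r, 1, 0))"
    using bigon_inD(4)[OF Kr]
    by (auto simp: continuous_map_in_subtopology intro!: continuous_map_compose_on[OF K(1)] continuous_intros)
  \<comment> \<open>One contraction for each end point loop serves both the source wall and the
    target wall, so that the contractions fit together along the edges of the cube.\<close>
  obtain B0 where B0: "continuous_map unit_square (subtopology X U0) B0" "\<forall>r\<in>{0..1}. B0 (r, 0) = K (r, 0, 0)"
    "\<forall>r\<in>{0..1}. B0 (r, 1) = K (0, 0, 0) \<and> B0 (0, r) = K (0, 0, 0) \<and> B0 (1, r) = K (0, 0, 0)"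
    by (rule basic_open_loop_null[OF basic(1) l0]) (simp_all add: K01)
  obtain B1 where B1: "continuous_map unit_square (subtopology X U1) B1" "\<forall>r\<in>{0..1}. B1 (r, 0) = K (r, 1, 0)"
    "\<forall>r\<in>{0..1}. B1 (r, 1) = K (0, 1, 0) \<and> B1 (0, r) = K (0, 1, 0) \<and> B1 (1, r) = K (0, 1, 0)"
    by (rule basic_open_loop_null[OF basic(2) l1]) (simp_all add: K01)
  have mono: "continuous_map unit_square (subtopology X W) b"
    if "continuous_map unit_square (subtopology X U) b" "U \<subseteq> W" for U W b
    using that by (auto simp: continuous_map_in_subtopology)
  have L: "continuous_map unit_square X (\<lambda>(s, r). K (r, s, t))" if "t \<in> {0..1}" for t
    unfolding case_prod_unfold
    by (rule continuous_map_compose_on[OF K(1)]) (use that in \<open>auto intro!: continuous_intros\<close>)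
  obtain M0 where M0: "continuous_map (top_of_set unit_cube) X M0"
    "\<forall>z\<in>{0..1} \<times> {0..1}. M0 (0, z) = B0 z \<and> M0 (1, z) = B1 z"
    "\<forall>s\<in>{0..1}. \<forall>r\<in>{0..1}. M0 (s, r, 0) = K (r, s, 0) \<and> M0 (s, r, 1) = K (0, s, 0) \<and>
      M0 (s, 0, r) = K (0, s, 0) \<and> M0 (s, 1, r) = K (0, s, 0)"
  proof (atomize_elim, rule chain_loop_null[OF chain(1) L[of 0] _ _ mono[OF B0(1) U(1)] _ _ mono[OF B1(1) U(3)], unfolded split])
    show "K (r, s, 0) \<in> W0 i" if "i \<in> {1..2 * n0 + 1}" "s \<in> {a0 (i - 1)..a0 i}" "r \<in> {0..1}" for i s r
      using slice_in_path_nbhd_iff[OF chain(1) Kcont[OF that(3)], of 0] bigon_inD(5)[OF Kr[OF that(3)]] that by simp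
  qed (use B0 B1 K01 in auto)
  have side_t: "K (r, 0, 1) = K (r, 0, 0)" "K (r, 1, 1) = K (r, 1, 0)" if "r \<in> {0..1}" for r
    by (rule sides; use that in simp)+
  obtain M1 where M1: "continuous_map (top_of_set unit_cube) X M1"
    "\<forall>z\<in>{0..1} \<times> {0..1}. M1 (0, z) = B0 z \<and> M1 (1, z) = B1 z"
    "\<forall>s\<in>{0..1}. \<forall>r\<in>{0..1}. M1 (s, r, 0) = K (r, s, 1) \<and> M1 (s, r, 1) = K (0, s, 1) \<and>
      M1 (s, 0, r) = K (0, s, 1) \<and> M1 (s, 1, r) = K (0, s, 1)"
  proof (atomize_elim, rule chain_loop_null[OF chain(2) L[of 1] _ _ mono[OF B0(1) U(2)] _ _ mono[OF B1(1) U(4)], unfolded split])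
    show "K (r, s, 1) \<in> W1 i" if "i \<in> {1..2 * n1 + 1}" "s \<in> {a1 (i - 1)..a1 i}" "r \<in> {0..1}" for i s r
      using slice_in_path_nbhd_iff[OF chain(2) Kcont[OF that(3)], of 1] bigon_inD(6)[OF Kr[OF that(3)]] that by simp
  qed (use B0 B1 K01 side_t in auto)
  \<comment> \<open>\<open>c\<close> is the contraction parameter and \<open>(r, s, t)\<close> runs
    through the surface of the cube. The faces \<open>r = 0\<close> and \<open>r = 1\<close> need no
    clause of their own, as \<open>B0\<close>, \<open>B1\<close>, \<open>M0\<close>,
    \<open>M1\<close> are stationary there.\<close>
  define G where "G = (\<lambda>(c::real, r::real, s::real, t::real). if s = 0 then B0 (r, c) else if s = 1 then B1 (r, c)
    else if t = 0 then M0 (s, r, c) else if t = 1 then M1 (s, r, c) else K (r, s, t))"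
  define Q where "Q = {0..1::real} \<times> {0..1::real}"
  have fr: "frontier ({0..1::real} \<times> Q) = {0, 1} \<times> Q \<union> {0..1} \<times> ({0} \<times> {0..1} \<union> {1} \<times> {0..1} \<union> {0..1} \<times> {0} \<union> {0..1} \<times> {1})"
    unfolding Q_def by (subst frontier_prism) (auto simp: frontier_unit_square square_boundary_def closed_Times)
  have "continuous_map (top_of_set ({0..1} \<times> frontier ({0..1} \<times> Q))) X G"
    unfolding fr Sigma_Un_distrib2
  proof (intro continuous_map_on_Un_closed)
    have sB0: "continuous_map unit_square X B0" and sB1: "continuous_map unit_square X B1"
      using B0(1) B1(1) by (auto simp: continuous_map_in_subtopology)
    show "continuous_map (top_of_set ({0..1} \<times> {0..1} \<times> {0} \<times> {0..1})) X G"
      by (rule continuous_map_compose_eq_on[OF sB0, of _ "\<lambda>(c, r, s, t). (r, c)"])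
        (auto simp: G_def case_prod_unfold intro!: continuous_intros)
    show "continuous_map (top_of_set ({0..1} \<times> {0..1} \<times> {1} \<times> {0..1})) X G"
      by (rule continuous_map_compose_eq_on[OF sB1, of _ "\<lambda>(c, r, s, t). (r, c)"])
        (auto simp: G_def case_prod_unfold intro!: continuous_intros)
    show "continuous_map (top_of_set ({0..1} \<times> {0..1} \<times> {0..1} \<times> {0})) X G"
      by (rule continuous_map_compose_eq_on[OF M0(1), of _ "\<lambda>(c, r, s, t). (s, r, c)"])
        (use M0(2) in \<open>auto simp: G_def case_prod_unfold intro!: continuous_intros\<close>)
    show "continuous_map (top_of_set ({0..1} \<times> {0..1} \<times> {0..1} \<times> {1})) X G"
      by (rule continuous_map_compose_eq_on[OF M1(1), of _ "\<lambda>(c, r, s, t). (s, r, c)"])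
        (use M1(2) in \<open>auto simp: G_def case_prod_unfold intro!: continuous_intros\<close>)
    have "continuous_map (top_of_set ({0..1::real} \<times> {0, 1} \<times> Q)) X (\<lambda>x. K (snd x))"
      by (rule continuous_map_compose_on[OF K(1)]) (auto simp: Q_def intro!: continuous_intros)
    then show "continuous_map (top_of_set ({0..1} \<times> {0, 1} \<times> Q)) X G"
    proof (rule continuous_map_eq_on)
      fix x :: "real \<times> real \<times> real \<times> real" assume "x \<in> {0..1} \<times> {0, 1} \<times> Q"
      then obtain c r s t where x: "x = (c, r, s, t)" "c \<in> {0..1}" "r = 0 \<or> r = 1" "s \<in> {0..1}" "t \<in> {0..1}"
        by (auto simp: Q_def)
      then show "K (snd x) = G x"
        using B0(3) B1(3) M0(3) M1(3) K01 sides[of r t] by (auto simp: G_def)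
    qed
  qed (auto simp: Q_def intro!: closed_Times closed_Un)
  moreover have "G (0, x) = K x" if xin: "x \<in> frontier ({0..1} \<times> Q)" for x
  proof -
    obtain r s t where x: "x = (r, s, t)" "r \<in> {0..1}" "s \<in> {0..1}" "t \<in> {0..1}"
      using xin unfolding fr by (cases x) (auto simp: Q_def)
    then show ?thesis
      using B0(2) B1(2) M0(3) M1(3) sides[of r t] by (auto simp: G_def)
  qed
  moreover have C: "compact ({0..1::real} \<times> Q)" "convex ({0..1::real} \<times> Q)" "interior ({0..1::real} \<times> Q) \<noteq> {}"
    by (auto simp: Q_def compact_Times convex_Times interior_Times)
  ultimately obtain E where E: "continuous_map (top_of_set ({0..1} \<times> ({0..1} \<times> Q))) X E"
    "\<And>c x. \<lbrakk>0 \<le> c; c \<le> 1; x \<in> frontier ({0..1} \<times> Q)\<rbrakk> \<Longrightarrow> E (c, x) = G (c, x)"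
    using homotopy_extension_convex[OF C, of X K G] K(1) unfolding Q_def by metis
  show ?thesis
  proof (rule homotopic_relI)
    show "continuous_map (top_of_set unit_cube) X (\<lambda>x. E (1, x))"
      by (rule continuous_map_compose_on[OF E(1)]) (auto simp: Q_def intro!: continuous_intros)
    show "square_boundary \<subseteq> {0..1} \<times> {0..1}"
      by (auto simp: square_boundary_def)
    have E1: "E (1, x) = G (1, x)" if "x \<in> frontier ({0..1} \<times> Q)" for x
      using E(2)[of 1 x] that by simp
    note simps = B0(3) B1(3) M0(3) M1(3) K(2,3) K01
    show "E (1, 0, x) = f x" if "x \<in> {0..1} \<times> {0..1}" for x
    proof (cases x)
      case (Pair s t)
      then have "E (1, 0, x) = G (1, 0, s, t)"
        using that E1[of "(0, s, t)"] unfolding fr by (simp add: Q_def)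
      then show ?thesis
        using Pair that simps sides[of 0 t] by (auto simp: G_def)
    qed
    show "E (1, 1, x) = f' x" if "x \<in> {0..1} \<times> {0..1}" for x
    proof (cases x)
      case (Pair s t)
      then have "E (1, 1, x) = G (1, 1, s, t)"
        using that E1[of "(1, s, t)"] unfolding fr by (simp add: Q_def)
      then show ?thesis
        using Pair that simps sides[of 1 t] by (auto simp: G_def)
    qed
    show "E (1, r, x) = f x" if "0 \<le> r" "r \<le> 1" "x \<in> square_boundary" for r x
    proof (cases x)
      case (Pair s t)
      then have "E (1, r, x) = G (1, r, s, t)"
        using that E1[of "(r, s, t)"] unfolding fr by (auto simp: square_boundary_def)
      moreover have "s \<in> {0..1}" "t \<in> {0..1}" "s = 0 \<or> s = 1 \<or> t = 0 \<or> t = 1"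
        using Pair that by (auto simp: square_boundary_def)
      then have "G (1, r, s, t) = K (0, s, t)"
        using that(1,2) B0(3) B1(3) M0(3) M1(3) sides[of 0 t] by (auto simp: G_def)
      ultimately show ?thesis
        using Pair K(2) by simp
    qed
  qed
qed

section \<open>Relative homotopy classes, 2-tracks and their boundary data\<close>

lemma homotopic_rel_eq_on:
  assumes "homotopic_rel A Z X f g" "z \<in> A"
  shows "f z = g z"
  using homotopic_with_imp_property[OF assms(1)[unfolded homotopic_rel_def]] assms(2) by simp

text \<open>The definition compares with the first map only; since both maps agree on
  \<open>A\<close>, the point of reference can be exchanged.\<close>

lemma homotopic_rel_sym:
  assumes "homotopic_rel A Z X f g"
  shows "homotopic_rel A Z X g f"
proof -
  have "homotopic_with (\<lambda>k. \<forall>z\<in>A. k z = f z) Z X g f"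
    using assms by (simp add: homotopic_rel_def homotopic_with_sym)
  then show ?thesis
    unfolding homotopic_rel_def
    by (rule homotopic_with_mono) (use homotopic_rel_eq_on[OF assms] in simp)
qed

lemma homotopic_rel_trans:
  assumes "homotopic_rel A Z X f g" "homotopic_rel A Z X g h"
  shows "homotopic_rel A Z X f h"
proof -
  have "homotopic_with (\<lambda>k. \<forall>z\<in>A. k z = f z) Z X g h"
    by (rule homotopic_with_mono[OF assms(2)[unfolded homotopic_rel_def]])
      (use homotopic_rel_eq_on[OF assms(1)] in simp)
  then show ?thesis
    using assms(1) unfolding homotopic_rel_def by (rule homotopic_with_trans[rotated])
qed

lemma homotopic_rel_refl: "continuous_map Z X f \<Longrightarrow> homotopic_rel A Z X f f"
  by (simp add: homotopic_rel_def)

lemma bigon_continuous: "bigon X f \<Longrightarrow> continuous_map unit_square X f"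
  unfolding bigon_def by blast

lemma bigon_sides:
  assumes "bigon X f" "t \<in> {0..1}"
  shows "f (0, t) = f (0, 0)" "f (1, t) = f (1, 0)"
  using assms unfolding bigon_def by blast+

lemma equiv_track_rel: "equiv (Collect (bigon X)) (track_rel X)"
proof (rule equivI)
  show "track_rel X \<subseteq> Collect (bigon X) \<times> Collect (bigon X)"
    by (auto simp: track_rel_def)
  show "refl_on (Collect (bigon X)) (track_rel X)"
    by (rule refl_onI) (simp add: track_rel_def bigon_continuous homotopic_rel_refl)
  show "sym (track_rel X)"
    by (rule symI) (auto simp: track_rel_def intro: homotopic_rel_sym)
  show "trans (track_rel X)"
    by (rule transI) (auto simp: track_rel_def intro: homotopic_rel_trans)
qed

lemma two_track_in_two_tracks: "bigon X f \<Longrightarrow> two_track X f \<in> two_tracks X"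
  by (simp add: two_track_def two_tracks_def quotientI)

lemma two_track_self: "bigon X f \<Longrightarrow> f \<in> two_track X f"
  by (simp add: two_track_def track_rel_def bigon_continuous homotopic_rel_refl)

lemma two_track_eq_iff:
  assumes "bigon X f" "bigon X g"
  shows "two_track X f = two_track X g \<longleftrightarrow> homotopic_rel square_boundary unit_square X f g"
  using eq_equiv_class_iff[OF equiv_track_rel, of f X g] assms by (simp add: two_track_def track_rel_def)

lemma two_tracksE:
  assumes "c \<in> two_tracks X"
  obtains f where "bigon X f" "c = two_track X f"
  using assms by (auto simp: two_tracks_def two_track_def quotient_def)

lemma two_tracks_mem:
  assumes "c \<in> two_tracks X" "f \<in> c"
  shows "bigon X f" "c = two_track X f"
proof -
  obtain g where g: "bigon X g" "c = two_track X g"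
    using assms(1) by (rule two_tracksE)
  then have "(g, f) \<in> track_rel X"
    using assms(2) by (simp add: two_track_def)
  then show "bigon X f" "c = two_track X f"
    using g(2) equiv_class_eq[OF equiv_track_rel] by (auto simp: two_track_def track_rel_def)
qed

lemma two_tracks_homotopic:
  assumes "c \<in> two_tracks X" "f \<in> c" "g \<in> c"
  shows "homotopic_rel square_boundary unit_square X f g"
  using two_tracks_mem[OF assms(1,2)] two_tracks_mem[OF assms(1,3)] two_track_eq_iff by metis

lemma the_elem_image_const:
  assumes "x \<in> A" "\<And>y. y \<in> A \<Longrightarrow> F y = F x"
  shows "the_elem (F ` A) = F x"
proof -
  have "F ` A = {F x}"
    using assms by blast
  then show ?thesis
    by simp
qed

text \<open>All four are values on the boundary of the square, where representatives coincide, so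
  any representative computes them.\<close>

lemma two_track_boundary:
  assumes "c \<in> two_tracks X" "f \<in> c"
  shows "source1 c = slice f 0" "target1 c = slice f 1" "source0 c = f (0, 0)" "target0 c = f (1, 0)"
proof -
  have eq: "g z = f z" if "g \<in> c" "z \<in> square_boundary" for g z
    using homotopic_rel_eq_on[OF two_tracks_homotopic[OF assms(1) that(1) assms(2)] that(2)] .
  have sl: "slice g t = slice f t" if "g \<in> c" "t = 0 \<or> t = 1" for g t
    using eq[OF that(1)] that(2) by (auto simp: slice_eq_iff square_boundary_def)
  show "source1 c = slice f 0"
    unfolding source1_def by (rule the_elem_image_const[OF assms(2)]) (simp add: sl)
  show "target1 c = slice f 1"
    unfolding target1_def by (rule the_elem_image_const[OF assms(2)]) (simp add: sl)
  show "source0 c = f (0, 0)"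
    unfolding source0_def by (rule the_elem_image_const[OF assms(2)]) (simp add: eq square_boundary_def)
  show "target0 c = f (1, 0)"
    unfolding target0_def by (rule the_elem_image_const[OF assms(2)]) (simp add: eq square_boundary_def)
qed

lemma deformable_in_sym: "deformable_in X A0 A1 V0 V1 f g \<Longrightarrow> deformable_in X A0 A1 V0 V1 g f"
  by (simp add: deformable_in_def homotopic_with_sym)

lemma deformable_in_trans:
  "deformable_in X A0 A1 V0 V1 f g \<Longrightarrow> deformable_in X A0 A1 V0 V1 g h \<Longrightarrow> deformable_in X A0 A1 V0 V1 f h"
  unfolding deformable_in_def by (rule homotopic_with_trans)

lemma deformable_in_mono:
  assumes "deformable_in X A0 A1 V0 V1 f g" "A0 \<subseteq> A0'" "A1 \<subseteq> A1'" "V0 \<subseteq> V0'" "V1 \<subseteq> V1'"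
  shows "deformable_in X A0' A1' V0' V1' f g"
  using assms(1) unfolding deformable_in_def
  by (rule homotopic_with_mono) (use assms(2-5) in \<open>unfold bigon_in_def, blast\<close>)

lemma deformable_in_imp:
  assumes "deformable_in X A0 A1 V0 V1 f g"
  shows "bigon X f" "bigon X g" "bigon_in A0 A1 V0 V1 f" "bigon_in A0 A1 V0 V1 g"
proof -
  show fg: "bigon_in A0 A1 V0 V1 f" "bigon_in A0 A1 V0 V1 g"
    using homotopic_with_imp_property assms unfolding deformable_in_def by blast+
  have "continuous_map unit_square X f" "continuous_map unit_square X g"
    using homotopic_with_imp_continuous_maps assms unfolding deformable_in_def by blast+
  then show "bigon X f" "bigon X g"
    using fg unfolding bigon_def bigon_in_def by blast+
qed

lemma bigon_in_boundary_cong: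
  assumes "bigon_in A0 A1 V0 V1 f" "\<And>z. z \<in> square_boundary \<Longrightarrow> k z = f z"
  shows "bigon_in A0 A1 V0 V1 k"
proof -
  have "slice k 0 = slice f 0" "slice k 1 = slice f 1"
    using assms(2) by (auto simp: slice_eq_iff square_boundary_def)
  moreover have "k (0, t) = f (0, t)" "k (1, t) = f (1, t)" if "t \<in> {0..1}" for t
    using that assms(2) by (auto simp: square_boundary_def)
  moreover from this[of 0] have "k (0, 0) = f (0, 0)" "k (1, 0) = f (1, 0)"
    by auto
  ultimately show ?thesis
    using assms(1) unfolding bigon_in_def by metis
qed

text \<open>\<open>bigon_in\<close> sees only the values on the boundary of the square, and these
  are fixed throughout a relative homotopy. Deformability therefore does not depend on
  representatives.\<close>

lemma homotopic_rel_imp_deformable_in: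
  assumes "homotopic_rel square_boundary unit_square X f g" "bigon_in A0 A1 V0 V1 f"
  shows "deformable_in X A0 A1 V0 V1 f g"
  unfolding deformable_in_def
  by (rule homotopic_with_mono[OF assms(1)[unfolded homotopic_rel_def]])
    (rule bigon_in_boundary_cong[OF assms(2)], simp)

section \<open>Reparametrised whiskers relative to the strips of a chain\<close>

lemma reparam_for_range:
  assumes "reparam_for n a \<rho>" "s \<in> {0..1}"
  shows "0 \<le> \<rho> s" "\<rho> s \<le> 1"
  using assms unfolding reparam_for_def mono_on_def by (metis atLeastAtMost_iff order_refl zero_le_one)+

lemma convex_comb_unit:
  fixes c x y :: real
  assumes "0 \<le> c" "c \<le> 1" "0 \<le> x" "x \<le> 1" "0 \<le> y" "y \<le> 1"
  shows "0 \<le> (1 - c) * x + c * y" "(1 - c) * x + c * y \<le> 1"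
  using assms convex_bound_le[of x 1 y "1 - c" c] by auto

lemma ex_reparam_for:
  assumes chain: "chain_data X n a W"
  shows "\<exists>\<rho>. reparam_for n a \<rho>"
proof (cases "n = 0")
  case True
  \<comment> \<open>The interval \<open>{a 1..a (2 * n)}\<close> is \<open>{1..0}\<close> here,
    hence empty.\<close>
  then have "reparam_for n a (\<lambda>s. s)"
    using chain by (auto simp: reparam_for_def chain_data_def mono_on_def)
  then show ?thesis
    by blast
next
  case False
  define p q where "p = a 1" and "q = a (2 * n)"
  have "\<And>i. i \<le> 2 * n \<Longrightarrow> a i < a (i + 1)" "a 0 = 0" "a (2 * n + 1) = 1"
    using chain by (auto simp: chain_data_def)
  from this(1)[of 0] this(1)[of "2 * n"] this(2,3) have "0 < p" "q < 1"
    by (auto simp: p_def q_def)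
  moreover have "p \<le> q"
    using chain_data_mono[OF chain, of 1 "2 * n"] False by (auto simp: p_def q_def)
  ultimately have pq: "0 < p" "p \<le> q" "q < 1" "p < 1" "0 < q"
    by auto
  \<comment> \<open>The piecewise linear function through \<open>(0, 0)\<close>,
    \<open>(p, (1 + p) / 4)\<close>, \<open>(q, (1 + q) / 4)\<close> and \<open>(1, 1)\<close>: the
    first summand is its middle piece, the other two are corrections vanishing to the right of
    \<open>p\<close> and to the left of \<open>q\<close>, with the slopes of the outer
    pieces.\<close>
  define \<rho> where "\<rho> s = (1 + max p (min q s)) / 4 + (min s p - p) * ((1 + p) / (4 * p))
    + (max s q - q) * ((3 - q) / (4 * (1 - q)))" for s
  have "continuous_on {0..1} \<rho>"
    unfolding \<rho>_def by (intro continuous_intros) (use pq in auto)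
  moreover have "mono_on {0..1} \<rho>"
    unfolding \<rho>_def by (intro mono_onI add_mono mult_right_mono divide_right_mono) (use pq in auto)
  moreover have "\<rho> 0 = 0" "\<rho> 1 = 1"
    using pq by (auto simp: \<rho>_def divide_simps) (simp_all add: algebra_simps)
  moreover have "\<forall>s\<in>{p..q}. \<rho> s = (1 + s) / 4"
    using pq by (auto simp: \<rho>_def)
  ultimately have "reparam_for n a \<rho>"
    by (simp add: reparam_for_def p_def q_def)
  then show ?thesis
    by blast
qed

text \<open>At time \<open>u\<close> with these bounds, the whiskered path is in its first (last) whisker only if
  the strip \<open>i\<close> is the first (last) one.\<close>

definition strip_time :: "nat \<Rightarrow> (nat \<Rightarrow> real) \<Rightarrow> nat \<Rightarrow> real \<Rightarrow> bool" where
  "strip_time n a i u \<longleftrightarrow> 0 \<le> u \<and> u \<le> 1 \<and> (i = 1 \<or> (1 + a (i - 1)) / 4 \<le> u) \<and> (i = 2 * n + 1 \<or> u \<le> (1 + a i) / 4)"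

text \<open>\<open>\<rho>\<close> is pinned to \<open>(1 + a j) / 4\<close> at the inner partition
  points, and monotonicity traps it between these values. At 0 and 1 it is inside the whiskers,
  whence the exceptions for the first and the last strip.\<close>

lemma strip_time_reparam:
  assumes chain: "chain_data X n a W" and \<rho>: "reparam_for n a \<rho>"
    and i: "i \<in> {1..2 * n + 1}" and s: "s \<in> {a (i - 1)..a i}"
  shows "strip_time n a i (\<rho> s)"
proof -
  have s01: "s \<in> {0..1}"
    by (rule chain_data_strip[OF chain i s])
  have mono: "\<rho> x \<le> \<rho> y" if "x \<in> {0..1}" "y \<in> {0..1}" "x \<le> y" for x y
    using \<rho> that by (auto simp: reparam_for_def mono_on_def)
  have mid: "\<rho> (a j) = (1 + a j) / 4" if "1 \<le> j" "j \<le> 2 * n" for j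
    using \<rho> that chain_data_mono[OF chain, of 1 j] chain_data_mono[OF chain, of j "2 * n"]
    by (auto simp: reparam_for_def)
  have "0 \<le> \<rho> s" "\<rho> s \<le> 1"
    using mono[of 0 s] mono[of s 1] s01 \<rho> by (auto simp: reparam_for_def)
  moreover have "(1 + a (i - 1)) / 4 \<le> \<rho> s" if "i \<noteq> 1"
  proof -
    have j: "1 \<le> i - 1" "i - 1 \<le> 2 * n" "i - 1 \<le> 2 * n + 1"
      using i that by auto
    have "a (i - 1) \<in> {0..1}"
      using chain_data_range[OF chain j(3)] by auto
    then have "\<rho> (a (i - 1)) \<le> \<rho> s"
      using s s01 by (intro mono) auto
    then show ?thesis
      using mid[OF j(1,2)] by simp
  qed
  moreover have "\<rho> s \<le> (1 + a i) / 4" if "i \<noteq> 2 * n + 1"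
  proof -
    have j: "1 \<le> i" "i \<le> 2 * n" "i \<le> 2 * n + 1"
      using i that by auto
    have "a i \<in> {0..1}"
      using chain_data_range[OF chain j(3)] by auto
    then have "\<rho> s \<le> \<rho> (a i)"
      using s s01 by (intro mono) auto
    then show ?thesis
      using mid[OF j(1,2)] by simp
  qed
  ultimately show ?thesis
    by (auto simp: strip_time_def)
qed

lemma strip_time_middle:
  assumes chain: "chain_data X n a W" and i: "i \<in> {1..2 * n + 1}" and s: "s \<in> {a (i - 1)..a i}"
  shows "strip_time n a i ((1 + s) / 4)"
  using chain_data_strip[OF chain i s] s by (auto simp: strip_time_def)

text \<open>The admissible times form an interval, so a linear homotopy between two admissible
  parametrisations stays admissible.\<close>

lemma strip_time_convex:
  assumes "strip_time n a i u" "strip_time n a i v" "0 \<le> c" "c \<le> 1"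
  shows "strip_time n a i ((1 - c) * u + c * v)"
proof -
  have lower: "x \<le> (1 - c) * u + c * v" if "x \<le> u" "x \<le> v" for x
    using convex_bound_le[of "-u" "-x" "-v" "1 - c" c] that assms(3,4) by simp
  have upper: "(1 - c) * u + c * v \<le> x" if "u \<le> x" "v \<le> x" for x
    using convex_bound_le[of u x v "1 - c" c] that assms(3,4) by simp
  show ?thesis
    using assms(1,2) lower upper unfolding strip_time_def by blast
qed

text \<open>Inner partition points lie strictly between 0 and 1, so a whisker can be met only in an
  extreme strip. The clipped value is the time of \<open>h\<close> belonging to \<open>u\<close>,
  frozen at 0 or 1 during the whiskers; frozen values still lie in the strip, as it is then
  extreme.\<close>

lemma strip_time_cases:
  assumes chain: "chain_data X n a W" and i: "i \<in> {1..2 * n + 1}" and u: "strip_time n a i u"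
  shows "u \<le> 1 / 4 \<Longrightarrow> i = 1" "1 / 2 < u \<Longrightarrow> i = 2 * n + 1"
    "max 0 (min 1 (4 * u - 1)) \<in> {a (i - 1)..a i}"
proof -
  have a: "a 0 = 0" "a (2 * n + 1) = 1"
    using chain by (auto simp: chain_data_def)
  have range: "0 \<le> a i" "a i \<le> 1" "0 \<le> a (i - 1)" "a (i - 1) \<le> 1"
    using i by (auto intro!: chain_data_range[OF chain])
  have "a (i - 1) \<le> a i"
    using i by (intro chain_data_mono[OF chain]) auto
  show "i = 1" if "u \<le> 1 / 4"
  proof (rule ccontr)
    assume "i \<noteq> 1"
    then have "0 < a 1" "a 1 \<le> a (i - 1)"
      using i chain chain_data_mono[OF chain, of 1 "i - 1"] by (auto simp: chain_data_def)
    then show False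
      using u that \<open>i \<noteq> 1\<close> by (auto simp: strip_time_def)
  qed
  show "i = 2 * n + 1" if "1 / 2 < u"
    using u that range by (auto simp: strip_time_def)
  have "i = 1 \<or> a (i - 1) \<le> 4 * u - 1" "i = 2 * n + 1 \<or> 4 * u - 1 \<le> a i"
    using u by (auto simp: strip_time_def)
  then show "max 0 (min 1 (4 * u - 1)) \<in> {a (i - 1)..a i}"
    using range a \<open>a (i - 1) \<le> a i\<close> by auto
qed

section \<open>Neighbourhoods of 2-tracks as deformation classes\<close>

lemma bigon_inI:
  assumes "\<And>t. t \<in> {0..1} \<Longrightarrow> k (0, t) = x" "\<And>t. t \<in> {0..1} \<Longrightarrow> k (1, t) = y"
    and "x \<in> A0" "y \<in> A1" "slice k 0 \<in> V0" "slice k 1 \<in> V1"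
  shows "bigon_in A0 A1 V0 V1 k"
  using assms by (simp add: bigon_in_def)

text \<open>At 1/4 and 1/2 both adjoining formulas hold, by the conditions on the ends of
  \<open>h\<close>. Pasting over closed pieces requires exactly this overlap.\<close>

lemma whisker_simps:
  assumes "t \<in> {0..1}" "\<And>t. t \<in> {0..1} \<Longrightarrow> h (0, t) = b0 1" "\<And>t. t \<in> {0..1} \<Longrightarrow> h (1, t) = b1 0"
  shows "u \<le> 1 / 4 \<Longrightarrow> hcomp (id_bigon b1) (hcomp h (id_bigon b0)) (u, t) = b0 (4 * u)"
    "1 / 4 \<le> u \<Longrightarrow> u \<le> 1 / 2 \<Longrightarrow> hcomp (id_bigon b1) (hcomp h (id_bigon b0)) (u, t) = h (4 * u - 1, t)"
    "1 / 2 \<le> u \<Longrightarrow> hcomp (id_bigon b1) (hcomp h (id_bigon b0)) (u, t) = b1 (2 * u - 1)"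
proof -
  show "hcomp (id_bigon b1) (hcomp h (id_bigon b0)) (u, t) = b0 (4 * u)" if "u \<le> 1 / 4"
    using that by (simp add: hcomp_def id_bigon_def)
  show "hcomp (id_bigon b1) (hcomp h (id_bigon b0)) (u, t) = h (4 * u - 1, t)" if "1 / 4 \<le> u" "u \<le> 1 / 2"
  proof (cases "u = 1 / 4")
    case True
    show ?thesis
      unfolding True using assms(2)[OF assms(1)] by (simp add: hcomp_def id_bigon_def)
  next
    case False
    then show ?thesis
      using that by (simp add: hcomp_def id_bigon_def)
  qed
  show "hcomp (id_bigon b1) (hcomp h (id_bigon b0)) (u, t) = b1 (2 * u - 1)" if "1 / 2 \<le> u"
  proof (cases "u = 1 / 2")
    case True
    show ?thesis
      unfolding True using assms(3)[OF assms(1)] by (simp add: hcomp_def id_bigon_def)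
  next
    case False
    then show ?thesis
      using that by (simp add: hcomp_def id_bigon_def)
  qed
qed

lemma continuous_map_whisker:
  assumes h: "continuous_map unit_square X h"
    and ends: "\<And>t. t \<in> {0..1} \<Longrightarrow> h (0, t) = b0 1" "\<And>t. t \<in> {0..1} \<Longrightarrow> h (1, t) = b1 0"
    and b: "continuous_map unit_interval X b0" "continuous_map unit_interval X b1"
  shows "continuous_map unit_square X (hcomp (id_bigon b1) (hcomp h (id_bigon b0)))"
proof -
  let ?w = "hcomp (id_bigon b1) (hcomp h (id_bigon b0))"
  note w = whisker_simps[of _ h b0 b1, OF _ ends]
  have eq: "{0..1::real} \<times> {0..1::real} = {0..1/4} \<times> {0..1} \<union> ({1/4..1/2} \<times> {0..1} \<union> {1/2..1} \<times> {0..1})"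
    by auto
  show ?thesis
    unfolding eq
  proof (intro continuous_map_on_Un_closed)
    show "continuous_map (top_of_set ({0..1/4} \<times> {0..1})) X ?w"
      by (rule continuous_map_compose_eq_on[OF b(1), of _ "\<lambda>x. 4 * fst x"])
        (auto intro!: continuous_intros w(1)[symmetric])
    show "continuous_map (top_of_set ({1/4..1/2} \<times> {0..1})) X ?w"
      by (rule continuous_map_compose_eq_on[OF h, of _ "\<lambda>x. (4 * fst x - 1, snd x)"])
        (auto intro!: continuous_intros w(2)[symmetric])
    show "continuous_map (top_of_set ({1/2..1} \<times> {0..1})) X ?w"
      by (rule continuous_map_compose_eq_on[OF b(2), of _ "\<lambda>x. 2 * fst x - 1"])
        (auto intro!: continuous_intros w(3)[symmetric])
  qed (auto intro!: closed_Times closed_Un)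
qed

lemma vcomp_simps:
  assumes "\<mu>0 (s, 1) = m (s, 0)" "m (s, 1) = \<mu>1 (s, 0)"
  shows "t \<le> 1 / 4 \<Longrightarrow> vcomp \<mu>1 (vcomp m \<mu>0) (s, t) = \<mu>0 (s, 4 * t)"
    "1 / 4 \<le> t \<Longrightarrow> t \<le> 1 / 2 \<Longrightarrow> vcomp \<mu>1 (vcomp m \<mu>0) (s, t) = m (s, 4 * t - 1)"
    "1 / 2 \<le> t \<Longrightarrow> vcomp \<mu>1 (vcomp m \<mu>0) (s, t) = \<mu>1 (s, 2 * t - 1)"
proof -
  show "vcomp \<mu>1 (vcomp m \<mu>0) (s, t) = \<mu>0 (s, 4 * t)" if "t \<le> 1 / 4"
    using that by (simp add: vcomp_def)
  show "vcomp \<mu>1 (vcomp m \<mu>0) (s, t) = m (s, 4 * t - 1)" if "1 / 4 \<le> t" "t \<le> 1 / 2"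
  proof (cases "t = 1 / 4")
    case True
    show ?thesis
      unfolding True using assms(1) by (simp add: vcomp_def)
  next
    case False
    then show ?thesis
      using that by (simp add: vcomp_def)
  qed
  show "vcomp \<mu>1 (vcomp m \<mu>0) (s, t) = \<mu>1 (s, 2 * t - 1)" if "1 / 2 \<le> t"
  proof (cases "t = 1 / 2")
    case True
    show ?thesis
      unfolding True using assms(2) by (simp add: vcomp_def)
  next
    case False
    then show ?thesis
      using that by (simp add: vcomp_def)
  qed
qed

lemma continuous_map_vcomp:
  assumes cont: "continuous_map unit_square X \<mu>0" "continuous_map unit_square X m" "continuous_map unit_square X \<mu>1"
    and ends: "\<And>s. s \<in> {0..1} \<Longrightarrow> \<mu>0 (s, 1) = m (s, 0)" "\<And>s. s \<in> {0..1} \<Longrightarrow> m (s, 1) = \<mu>1 (s, 0)"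
  shows "continuous_map unit_square X (vcomp \<mu>1 (vcomp m \<mu>0))"
proof -
  let ?w = "vcomp \<mu>1 (vcomp m \<mu>0)"
  note v = vcomp_simps[of \<mu>0 _ m \<mu>1, OF ends]
  have eq: "{0..1::real} \<times> {0..1::real} = {0..1} \<times> {0..1/4} \<union> ({0..1} \<times> {1/4..1/2} \<union> {0..1} \<times> {1/2..1})"
    by auto
  show ?thesis
    unfolding eq
  proof (intro continuous_map_on_Un_closed)
    show "continuous_map (top_of_set ({0..1} \<times> {0..1/4})) X ?w"
      by (rule continuous_map_compose_eq_on[OF cont(1), of _ "\<lambda>x. (fst x, 4 * snd x)"])
        (auto intro!: continuous_intros v(1)[symmetric])
    show "continuous_map (top_of_set ({0..1} \<times> {1/4..1/2})) X ?w"
      by (rule continuous_map_compose_eq_on[OF cont(2), of _ "\<lambda>x. (fst x, 4 * snd x - 1)"])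
        (auto intro!: continuous_intros v(2)[symmetric])
    show "continuous_map (top_of_set ({0..1} \<times> {1/2..1})) X ?w"
      by (rule continuous_map_compose_eq_on[OF cont(3), of _ "\<lambda>x. (fst x, 2 * snd x - 1)"])
        (auto intro!: continuous_intros v(3)[symmetric])
  qed (auto intro!: closed_Times closed_Un)
qed

text \<open>In an extreme strip a whisker has values in the member of that strip; otherwise the
  point is a value of \<open>h\<close> at a time in strip \<open>i\<close>.\<close>

lemma whisker_strip:
  assumes chain: "chain_data X n a W" and i: "i \<in> {1..2 * n + 1}" and u: "strip_time n a i u"
    and t: "t \<in> {0..1}"
    and ends: "\<And>t. t \<in> {0..1} \<Longrightarrow> h (0, t) = b0 1" "\<And>t. t \<in> {0..1} \<Longrightarrow> h (1, t) = b1 0"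
    and W: "\<And>r. r \<in> {0..1} \<Longrightarrow> b0 r \<in> W 1" "\<And>r. r \<in> {0..1} \<Longrightarrow> b1 r \<in> W (2 * n + 1)"
      "\<And>s. s \<in> {a (i - 1)..a i} \<Longrightarrow> h (s, t) \<in> W i"
  shows "hcomp (id_bigon b1) (hcomp h (id_bigon b0)) (u, t) \<in> W i"
proof -
  have u01: "0 \<le> u" "u \<le> 1"
    using u by (auto simp: strip_time_def)
  consider "u \<le> 1 / 4" | "1 / 4 \<le> u" "u \<le> 1 / 2" | "1 / 2 < u"
    by linarith
  then show ?thesis
  proof cases
    case 1
    then show ?thesis
      using strip_time_cases(1)[OF chain i u] whisker_simps(1)[of t h b0 b1, OF t ends] W(1)[of "4 * u"] u01 by auto
  next
    case 2
    then have "max 0 (min 1 (4 * u - 1)) = 4 * u - 1"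
      by auto
    then show ?thesis
      using 2 strip_time_cases(3)[OF chain i u] whisker_simps(2)[of t h b0 b1, OF t ends] W(3)[of "4 * u - 1"] by auto
  next
    case 3
    then show ?thesis
      using strip_time_cases(2)[OF chain i u] whisker_simps(3)[of t h b0 b1, OF t ends] W(2)[of "2 * u - 1"] u01 by auto
  qed
qed

text \<open>Two deformations are composed. The first zooms in on the middle piece \<open>m\<close>
  in the \<open>t\<close>-direction, so that source and target run along the slices of
  \<open>\<mu>0\<close> and \<open>\<mu>1\<close>. The second zooms in on \<open>h\<close> in the
  \<open>s\<close>-direction, so that the end points run along the whiskers.\<close>

lemma track_nbhd_imp_deformable_in:
  assumes data: "nbhd_data X U0 U1 n0 a0 W0 n1 a1 W1"
    and c: "c \<in> two_tracks X" and d: "d \<in> track_nbhd X c U0 U1 n0 a0 W0 n1 a1 W1"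
    and V: "source1 c \<in> path_nbhd X n0 a0 W0" "target1 c \<in> path_nbhd X n1 a1 W1"
  shows "\<exists>f\<in>d. \<exists>h\<in>c. deformable_in X U0 U1 (path_nbhd X n0 a0 W0) (path_nbhd X n1 a1 W1) f h"
proof -
  let ?V0 = "path_nbhd X n0 a0 W0" and ?V1 = "path_nbhd X n1 a1 W1"
  have chain: "chain_data X n0 a0 W0" "chain_data X n1 a1 W1"
    and U: "U0 \<subseteq> W0 1" "U0 \<subseteq> W1 1" "U1 \<subseteq> W0 (2 * n0 + 1)" "U1 \<subseteq> W1 (2 * n1 + 1)"
    using data by (auto simp: nbhd_data_def)
  obtain h \<beta>0 \<beta>1 \<mu>0 \<mu>1 \<rho>0 \<rho>1 m where h: "h \<in> c"
    and \<beta>: "pathin (subtopology X U0) \<beta>0" "pathin (subtopology X U1) \<beta>1"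
    and \<mu>0: "bigon X \<mu>0" "\<forall>t\<in>{0..1}. slice \<mu>0 t \<in> ?V0"
    and \<mu>1: "bigon X \<mu>1" "\<forall>t\<in>{0..1}. slice \<mu>1 t \<in> ?V1"
    and \<beta>_ends: "\<beta>0 1 = source0 c" "\<beta>1 0 = target0 c"
    and \<rho>: "reparam_for n0 a0 \<rho>0" "reparam_for n1 a1 \<rho>1"
    and m: "m = reparam \<rho>0 \<rho>1 (hcomp (id_bigon \<beta>1) (hcomp h (id_bigon \<beta>0)))"
    and sl: "slice \<mu>0 1 = slice m 0" "slice m 1 = slice \<mu>1 0"
    and d: "d = two_track X (vcomp \<mu>1 (vcomp m \<mu>0))"
    using d unfolding track_nbhd_def by blast
  have hb: "bigon X h"
    using two_tracks_mem[OF c h] by simp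
  have ends: "h (0, t) = \<beta>0 1" "h (1, t) = \<beta>1 0" if "t \<in> {0..1}" for t
    using bigon_sides[OF hb that] \<beta>_ends two_track_boundary[OF c h] by simp_all
  have \<beta>_cont: "continuous_map unit_interval X \<beta>0" "continuous_map unit_interval X \<beta>1"
    and \<beta>_in: "\<And>r. r \<in> {0..1} \<Longrightarrow> \<beta>0 r \<in> U0" "\<And>r. r \<in> {0..1} \<Longrightarrow> \<beta>1 r \<in> U1"
    using \<beta> by (auto simp: pathin_def continuous_map_in_subtopology)
  let ?w = "hcomp (id_bigon \<beta>1) (hcomp h (id_bigon \<beta>0))"
  have w_cont: "continuous_map unit_square X ?w"
    by (rule continuous_map_whisker[OF bigon_continuous[OF hb] ends \<beta>_cont])
  note w_simps = whisker_simps[of _ h \<beta>0 \<beta>1, OF _ ends]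
  have w0: "?w (0, t) = \<beta>0 0" and w1: "?w (1, t) = \<beta>1 1" if "t \<in> {0..1}" for t
    using w_simps(1)[OF that, of 0] w_simps(3)[OF that, of 1] by simp_all
  have \<rho>_cont: "continuous_on {0..1} \<rho>0" "continuous_on {0..1} \<rho>1"
    and \<rho>_ends: "\<rho>0 0 = 0" "\<rho>0 1 = 1" "\<rho>1 0 = 0" "\<rho>1 1 = 1"
    using \<rho> by (auto simp: reparam_for_def)
  note \<rho>_in = reparam_for_range[OF \<rho>(1)] reparam_for_range[OF \<rho>(2)]
  \<comment> \<open>Linear in time from the reparametrisation of \<open>m\<close> at
    \<open>r = 0\<close> to \<open>(1 + s) / 4\<close> at \<open>r = 1\<close>, where the whiskered
    bigon is just \<open>h\<close>.\<close>
  have shrink: "continuous_map (top_of_set unit_cube) X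
      (\<lambda>(r, s, t). ?w ((1 - r) * ((1 - t) * \<rho>0 s + t * \<rho>1 s) + r * ((1 + s) / 4), t))"
    unfolding case_prod_unfold
  proof (rule continuous_map_compose_on[OF w_cont])
    show "continuous_on unit_cube (\<lambda>x. ((1 - fst x) *
        ((1 - snd (snd x)) * \<rho>0 (fst (snd x)) + snd (snd x) * \<rho>1 (fst (snd x))) + fst x * ((1 + fst (snd x)) / 4), snd (snd x)))"
      by (intro continuous_intros continuous_on_compose2[OF \<rho>_cont(1)] continuous_on_compose2[OF \<rho>_cont(2)]) auto
  qed (use \<rho>_in in \<open>auto intro!: convex_comb_unit simp del: times_divide_eq_right\<close>)
  have m_eq: "m (s, t) = ?w ((1 - t) * \<rho>0 s + t * \<rho>1 s, t)" for s t
    by (simp add: m reparam_def)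
  have m_cont: "continuous_map unit_square X m"
    by (rule continuous_map_compose_eq_on[OF shrink, of _ "\<lambda>x. (0, x)"])
      (auto simp: m_eq intro!: continuous_intros)
  have sl': "\<mu>0 (s, 1) = m (s, 0)" "m (s, 1) = \<mu>1 (s, 0)" if "s \<in> {0..1}" for s
    using sl that by (auto simp: slice_eq_iff)
  let ?f = "vcomp \<mu>1 (vcomp m \<mu>0)"
  have f_cont: "continuous_map unit_square X ?f"
    by (rule continuous_map_vcomp[OF bigon_continuous[OF \<mu>0(1)] m_cont bigon_continuous[OF \<mu>1(1)] sl'])
  note f_simps = vcomp_simps[of \<mu>0 _ m \<mu>1, OF sl']
  have m_sides: "m (0, t) = \<beta>0 0" "m (1, t) = \<beta>1 1" if "t \<in> {0..1}" for t
    using w0[OF that] w1[OF that] \<rho>_ends by (auto simp: m_eq)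
  have \<mu>_sides: "\<mu>0 (0, t) = \<beta>0 0" "\<mu>0 (1, t) = \<beta>1 1" "\<mu>1 (0, t) = \<beta>0 0" "\<mu>1 (1, t) = \<beta>1 1"
    if "t \<in> {0..1}" for t
    using bigon_sides[OF \<mu>0(1) that] bigon_sides[OF \<mu>0(1), of 1] bigon_sides[OF \<mu>1(1) that]
      sl'[of 0] sl'[of 1] m_sides[of 0] m_sides[of 1] by auto
  have f_sides: "?f (0, t) = \<beta>0 0" "?f (1, t) = \<beta>1 1" if "t \<in> {0..1}" for t
  proof -
    consider "t \<le> 1 / 4" | "1 / 4 \<le> t" "t \<le> 1 / 2" | "1 / 2 \<le> t"
      by linarith
    then have "?f (0, t) = \<beta>0 0 \<and> ?f (1, t) = \<beta>1 1"
      using that by cases (auto simp: f_simps m_sides \<mu>_sides)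
    then show "?f (0, t) = \<beta>0 0" "?f (1, t) = \<beta>1 1"
      by auto
  qed
  have \<beta>_U: "\<beta>0 0 \<in> U0" "\<beta>1 1 \<in> U1"
    using \<beta>_in by auto
  have f_m: "deformable_in X U0 U1 ?V0 ?V1 ?f m"
  proof (rule deformable_inI)
    \<comment> \<open>At stage \<open>r\<close> the vertical range is from \<open>r / 4\<close> to
      \<open>1 - r / 2\<close>: the source is slice \<open>r\<close> of \<open>\<mu>0\<close>, the
      target slice \<open>1 - r\<close> of \<open>\<mu>1\<close>.\<close>
    let ?K = "\<lambda>(r, s, t). ?f (s, (1 - r) * t + r * ((1 + t) / 4))"
    show "continuous_map (top_of_set unit_cube) X ?K"
      unfolding case_prod_unfold
      by (rule continuous_map_compose_on[OF f_cont]) (auto intro!: continuous_intros convex_comb_unit simp del: times_divide_eq_right)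
    show "?K (1, x) = m x" if "x \<in> {0..1} \<times> {0..1}" for x
      using that by (auto simp: f_simps(2) add_divide_distrib)
    fix r :: real assume r: "0 \<le> r" "r \<le> 1"
    have "slice (\<lambda>x. ?K (r, x)) 0 = slice \<mu>0 r"
      using r by (auto simp: slice_eq_iff f_simps(1))
    then have s0: "slice (\<lambda>x. ?K (r, x)) 0 \<in> ?V0"
      using r \<mu>0(2) by simp
    have "slice (\<lambda>x. ?K (r, x)) 1 = slice \<mu>1 (1 - r)"
      using r by (auto simp: slice_eq_iff f_simps(3))
    then have s1: "slice (\<lambda>x. ?K (r, x)) 1 \<in> ?V1"
      using r \<mu>1(2) by simp
    have sides: "?K (r, 0, t) = \<beta>0 0" "?K (r, 1, t) = \<beta>1 1" if "t \<in> {0..1}" for t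
      using r that by (auto intro!: f_sides convex_comb_unit simp del: times_divide_eq_right)
    show "bigon_in U0 U1 ?V0 ?V1 (\<lambda>x. ?K (r, x))"
      by (rule bigon_inI[where x = "\<beta>0 0" and y = "\<beta>1 1"]) (fact sides \<beta>_U s0 s1)+
  qed auto
  have m_h: "deformable_in X U0 U1 ?V0 ?V1 m h"
  proof (rule deformable_inI[OF shrink])
    let ?K = "\<lambda>(r, s, t). ?w ((1 - r) * ((1 - t) * \<rho>0 s + t * \<rho>1 s) + r * ((1 + s) / 4), t)"
    show "?K (0, x) = m x" for x
      by (auto simp: m_eq split: prod.split)
    show "?K (1, x) = h x" if "x \<in> {0..1} \<times> {0..1}" for x
    proof (cases x)
      case (Pair s t)
      then have st: "s \<in> {0..1}" "t \<in> {0..1}"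
        using that by auto
      have "?w ((1 + s) / 4, t) = h (4 * ((1 + s) / 4) - 1, t)"
        by (rule w_simps(2)) (use st in auto)
      also have "4 * ((1 + s) / 4) - 1 = s"
        by (simp add: field_simps)
      finally show ?thesis
        by (simp add: Pair)
    qed
    fix r :: real assume r: "0 \<le> r" "r \<le> 1"
    have Kr: "continuous_map unit_square X (\<lambda>x. ?K (r, x))"
      by (rule continuous_map_compose_on[OF shrink]) (use r in \<open>auto intro!: continuous_intros\<close>)
    \<comment> \<open>The end points are read at the times \<open>r / 4\<close> and
      \<open>1 - r / 2\<close>, which lie in the two whiskers.\<close>
    have sides: "?K (r, 0, t) = \<beta>0 r" "?K (r, 1, t) = \<beta>1 (1 - r)" if "t \<in> {0..1}" for t
      using r that w_simps(1)[OF that, of "r / 4"] w_simps(3)[OF that, of "1 - r / 2"]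
      by (auto simp: \<rho>_ends algebra_simps)
    have "slice h 0 \<in> ?V0" "slice h 1 \<in> ?V1"
      using V two_track_boundary[OF c h] by simp_all
    then have hW: "\<And>i s. \<lbrakk>i \<in> {1..2 * n0 + 1}; s \<in> {a0 (i - 1)..a0 i}\<rbrakk> \<Longrightarrow> h (s, 0) \<in> W0 i"
      "\<And>i s. \<lbrakk>i \<in> {1..2 * n1 + 1}; s \<in> {a1 (i - 1)..a1 i}\<rbrakk> \<Longrightarrow> h (s, 1) \<in> W1 i"
      using slice_in_path_nbhd_iff[OF chain(1) bigon_continuous[OF hb], of 0]
        slice_in_path_nbhd_iff[OF chain(2) bigon_continuous[OF hb], of 1] by auto
    have "slice (\<lambda>x. ?K (r, x)) 0 \<in> ?V0"
    proof (subst slice_in_path_nbhd_iff[OF chain(1) Kr]; (intro ballI)?)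
      fix i s assume i: "i \<in> {1..2 * n0 + 1}" and s: "s \<in> {a0 (i - 1)..a0 i}"
      have "?w ((1 - r) * \<rho>0 s + r * ((1 + s) / 4), 0) \<in> W0 i"
      proof (rule whisker_strip[OF chain(1) i])
        show "strip_time n0 a0 i ((1 - r) * \<rho>0 s + r * ((1 + s) / 4))"
          by (rule strip_time_convex[OF strip_time_reparam[OF chain(1) \<rho>(1) i s]
            strip_time_middle[OF chain(1) i s] r])
        show "h (x, 0) \<in> W0 i" if "x \<in> {a0 (i - 1)..a0 i}" for x
          by (rule hW(1)[OF i that])
      qed (use U \<beta>_in ends in auto)
      then show "?K (r, s, 0) \<in> W0 i"
        by simp
    qed auto
    moreover have "slice (\<lambda>x. ?K (r, x)) 1 \<in> ?V1"
    proof (subst slice_in_path_nbhd_iff[OF chain(2) Kr]; (intro ballI)?)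
      fix i s assume i: "i \<in> {1..2 * n1 + 1}" and s: "s \<in> {a1 (i - 1)..a1 i}"
      have "?w ((1 - r) * \<rho>1 s + r * ((1 + s) / 4), 1) \<in> W1 i"
      proof (rule whisker_strip[OF chain(2) i])
        show "strip_time n1 a1 i ((1 - r) * \<rho>1 s + r * ((1 + s) / 4))"
          by (rule strip_time_convex[OF strip_time_reparam[OF chain(2) \<rho>(2) i s]
            strip_time_middle[OF chain(2) i s] r])
        show "h (x, 1) \<in> W1 i" if "x \<in> {a1 (i - 1)..a1 i}" for x
          by (rule hW(2)[OF i that])
      qed (use U \<beta>_in ends in auto)
      then show "?K (r, s, 1) \<in> W1 i"
        by simp
    qed auto
    ultimately show "bigon_in U0 U1 ?V0 ?V1 (\<lambda>x. ?K (r, x))"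
      using sides \<beta>_in[of r] \<beta>_in[of "1 - r"] r by (intro bigon_inI[where x = "\<beta>0 r" and y = "\<beta>1 (1 - r)"]) auto
  qed
  have "?f \<in> d"
    using deformable_in_imp(1)[OF f_m] d by (simp add: two_track_self)
  with h deformable_in_trans[OF f_m m_h] show ?thesis
    by blast
qed

text \<open>The whiskers are the motions of the end points under \<open>K\<close>. Letting the
  deformation lag behind near the ends turns \<open>K\<close> into a deformation \<open>Q\<close>
  from \<open>f\<close> to the whiskered bigon \<open>m\<close> with fixed end points. The source
  and target traced out by \<open>Q\<close> are \<open>\<mu>0\<close> and \<open>\<mu>1\<close>, and
  \<open>Q\<close> itself shows that \<open>f\<close> is homotopic to the pasting.\<close>

lemma deformable_in_imp_track_nbhd:
  assumes data: "nbhd_data X U0 U1 n0 a0 W0 n1 a1 W1"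
    and c: "c \<in> two_tracks X" "h \<in> c" and d: "d \<in> two_tracks X" "f \<in> d"
    and def: "deformable_in X U0 U1 (path_nbhd X n0 a0 W0) (path_nbhd X n1 a1 W1) f h"
  shows "d \<in> track_nbhd X c U0 U1 n0 a0 W0 n1 a1 W1"
proof -
  let ?V0 = "path_nbhd X n0 a0 W0" and ?V1 = "path_nbhd X n1 a1 W1"
  have chain: "chain_data X n0 a0 W0" "chain_data X n1 a1 W1"
    using data by (auto simp: nbhd_data_def)
  obtain \<rho>0 \<rho>1 where \<rho>: "reparam_for n0 a0 \<rho>0" "reparam_for n1 a1 \<rho>1"
    using ex_reparam_for[OF chain(1)] ex_reparam_for[OF chain(2)] by blast
  have \<rho>_cont: "continuous_on {0..1} \<rho>0" "continuous_on {0..1} \<rho>1"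
    and \<rho>_ends: "\<rho>0 0 = 0" "\<rho>0 1 = 1" "\<rho>1 0 = 0" "\<rho>1 1 = 1"
    using \<rho> by (auto simp: reparam_for_def)
  note \<rho>_in = reparam_for_range[OF \<rho>(1)] reparam_for_range[OF \<rho>(2)]
  obtain K where K: "continuous_map (top_of_set unit_cube) X K"
    "\<forall>x. K (0, x) = f x" "\<forall>x. K (1, x) = h x" "\<forall>r\<in>{0..1}. bigon_in U0 U1 ?V0 ?V1 (\<lambda>x. K (r, x))"
    using deformable_inD[OF def] by blast
  have Kr: "bigon_in U0 U1 ?V0 ?V1 (\<lambda>x. K (r, x))" if "r \<in> {0..1}" for r
    using K(4) that by blast
  note Kcont = continuous_map_homotopy_at[OF K(1)]
  have KW: "r \<in> {0..1} \<Longrightarrow> i \<in> {1..2 * n0 + 1} \<Longrightarrow> s \<in> {a0 (i - 1)..a0 i} \<Longrightarrow> K (r, s, 0) \<in> W0 i"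
    "r \<in> {0..1} \<Longrightarrow> i \<in> {1..2 * n1 + 1} \<Longrightarrow> s \<in> {a1 (i - 1)..a1 i} \<Longrightarrow> K (r, s, 1) \<in> W1 i" for r i s
    using bigon_inD(5,6)[OF Kr] slice_in_path_nbhd_iff[OF chain(1) Kcont, of r 0]
      slice_in_path_nbhd_iff[OF chain(2) Kcont, of r 1] by auto
  note sides = bigon_inD(1,2)[OF Kr]
  define \<beta>0 where "\<beta>0 r = K (r, 0, 0)" for r
  \<comment> \<open>Reversed, because this whisker starts at the end point of
    \<open>h\<close>.\<close>
  define \<beta>1 where "\<beta>1 r = K (1 - r, 1, 0)" for r
  have \<beta>0: "pathin (subtopology X U0) \<beta>0"
    using bigon_inD(3)[OF Kr] unfolding pathin_def \<beta>0_def
    by (auto simp: continuous_map_in_subtopology intro!: continuous_map_compose_on[OF K(1)] continuous_intros)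
  have \<beta>1: "pathin (subtopology X U1) \<beta>1"
    using bigon_inD(4)[OF Kr] unfolding pathin_def \<beta>1_def
    by (auto simp: continuous_map_in_subtopology intro!: continuous_map_compose_on[OF K(1)] continuous_intros)
  \<comment> \<open>For \<open>r \<le> 1/2\<close> the parametrisation moves from
    \<open>(1 + s) / 4\<close>, which shows all of \<open>h\<close> and no whisker, to the one used
    in \<open>m\<close>; afterwards it rests.\<close>
  define u where "u r s t = (1 - min 1 (2 * r)) * ((1 + s) / 4) + min 1 (2 * r) * ((1 - t) * \<rho>0 s + t * \<rho>1 s)" for r s t :: real
  \<comment> \<open>The deformation time, 0 up to \<open>r = 1/2\<close>. Its second factor is a
    trapezoid in the horizontal time \<open>v\<close>: it vanishes at both ends, which keeps the end
    points those of \<open>f\<close>, and equals 1 on \<open>{1/4..1/2}\<close>. Its slopes 4 and -2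
    reproduce the speeds of the two whiskers.\<close>
  define R where "R r v = max 0 (2 * r - 1) * min 1 (min (4 * v) (2 - 2 * v))" for r v :: real
  define Q where "Q = (\<lambda>(r, s, t). K (R r (u r s t), max 0 (min 1 (4 * u r s t - 1)), t))"
  have u_in: "0 \<le> u r s t" "u r s t \<le> 1" if "r \<in> {0..1}" "s \<in> {0..1}" "t \<in> {0..1}" for r s t
    unfolding u_def using that \<rho>_in[OF that(2)] by (intro convex_comb_unit; simp add: min_def convex_comb_unit)+
  have R_in: "R r v \<in> {0..1}" if "r \<in> {0..1}" "0 \<le> v" "v \<le> 1" for r v
    using that by (auto simp: R_def intro!: mult_nonneg_nonneg mult_le_one)
  have Q_cont: "continuous_map (top_of_set unit_cube) X Q"
    unfolding Q_def case_prod_unfold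
  proof (rule continuous_map_compose_on[OF K(1)])
    have "continuous_on unit_cube (\<lambda>x. u (fst x) (fst (snd x)) (snd (snd x)))"
      unfolding u_def
      by (intro continuous_intros continuous_on_compose2[OF \<rho>_cont(1)] continuous_on_compose2[OF \<rho>_cont(2)]) auto
    then show "continuous_on unit_cube (\<lambda>x. (R (fst x) (u (fst x) (fst (snd x)) (snd (snd x))),
        max 0 (min 1 (4 * u (fst x) (fst (snd x)) (snd (snd x)) - 1)), snd (snd x)))"
      unfolding R_def by (intro continuous_intros)
  next
    fix x :: "real \<times> real \<times> real" assume "x \<in> unit_cube"
    then show "(R (fst x) (u (fst x) (fst (snd x)) (snd (snd x))),
        max 0 (min 1 (4 * u (fst x) (fst (snd x)) (snd (snd x)) - 1)), snd (snd x)) \<in> unit_cube"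
      using R_in[of "fst x" "u (fst x) (fst (snd x)) (snd (snd x))"] u_in[of "fst x" "fst (snd x)" "snd (snd x)"]
      by (auto simp: mem_Times_iff)
  qed
  have Q0: "Q (0, s, t) = f (s, t)" if "s \<in> {0..1}" for s t
  proof -
    have "u 0 s t = (1 + s) / 4"
      by (simp add: u_def)
    then have "max 0 (min 1 (4 * u 0 s t - 1)) = s"
      using that by (auto simp: field_simps)
    then show ?thesis
      using K(2) by (simp add: Q_def R_def)
  qed
  have Q_side0: "Q (r, 0, t) = f (0, 0)" if "r \<in> {0..1}" "t \<in> {0..1}" for r t
  proof -
    have u: "u r 0 t = (1 - min 1 (2 * r)) / 4"
      by (simp add: u_def \<rho>_ends)
    have "max 0 (min 1 (4 * u r 0 t - 1)) = 0"
      using that by (auto simp: u)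
    moreover have "R r (u r 0 t) = 0"
      using that by (cases "r \<le> 1 / 2") (auto simp: u R_def)
    ultimately show ?thesis
      using K(2) sides(1)[of 0 t] that by (simp add: Q_def)
  qed
  have Q_side1: "Q (r, 1, t) = f (1, 0)" if "r \<in> {0..1}" "t \<in> {0..1}" for r t
  proof -
    have u: "u r 1 t = (1 + min 1 (2 * r)) / 2"
      by (simp add: u_def \<rho>_ends field_simps)
    have "max 0 (min 1 (4 * u r 1 t - 1)) = 1"
      using that by (auto simp: u field_simps min_def)
    moreover have "R r (u r 1 t) = 0"
      using that by (cases "r \<le> 1 / 2") (auto simp: u R_def)
    ultimately show ?thesis
      using K(2) sides(2)[of 0 t] that by (simp add: Q_def)
  qed
  define m where "m = reparam \<rho>0 \<rho>1 (hcomp (id_bigon \<beta>1) (hcomp h (id_bigon \<beta>0)))"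
  have hb: "bigon X h" and fb: "bigon X f"
    using two_tracks_mem[OF c] two_tracks_mem[OF d] by auto
  have \<beta>_ends: "\<beta>0 1 = h (0, 0)" "\<beta>1 0 = h (1, 0)"
    using K(3) by (auto simp: \<beta>0_def \<beta>1_def)
  have ends: "h (0, t) = \<beta>0 1" "h (1, t) = \<beta>1 0" if "t \<in> {0..1}" for t
    using bigon_sides[OF hb that] \<beta>_ends by simp_all
  note w_simps = whisker_simps[of _ h \<beta>0 \<beta>1, OF _ ends]
  have Q1: "Q (1, s, t) = m (s, t)" if s: "s \<in> {0..1}" and t: "t \<in> {0..1}" for s t
  proof -
    define v where "v = (1 - t) * \<rho>0 s + t * \<rho>1 s"
    have v01: "0 \<le> v" "v \<le> 1"
      unfolding v_def using t \<rho>_in[OF s] by (intro convex_comb_unit; simp)+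
    have "u 1 s t = v"
      by (simp add: u_def v_def)
    then have Q: "Q (1, s, t) = K (min 1 (min (4 * v) (2 - 2 * v)), max 0 (min 1 (4 * v - 1)), t)"
      by (simp add: Q_def R_def)
    have m: "m (s, t) = hcomp (id_bigon \<beta>1) (hcomp h (id_bigon \<beta>0)) (v, t)"
      by (simp add: m_def reparam_def v_def)
    consider "v \<le> 1 / 4" | "1 / 4 \<le> v" "v \<le> 1 / 2" | "1 / 2 \<le> v"
      by linarith
    then show ?thesis
    proof cases
      case 1
      then have "min 1 (min (4 * v) (2 - 2 * v)) = 4 * v" "max 0 (min 1 (4 * v - 1)) = 0"
        using v01 by auto
      then show ?thesis
        using w_simps(1)[of t v] sides(1)[of "4 * v" t] 1 v01 t by (simp add: Q m \<beta>0_def)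
    next
      case 2
      then have "min 1 (min (4 * v) (2 - 2 * v)) = 1" "max 0 (min 1 (4 * v - 1)) = 4 * v - 1"
        by auto
      then show ?thesis
        using w_simps(2)[of t v] 2 t K(3) by (simp add: Q m)
    next
      case 3
      then have "min 1 (min (4 * v) (2 - 2 * v)) = 2 - 2 * v" "max 0 (min 1 (4 * v - 1)) = 1"
        using v01 by auto
      then show ?thesis
        using w_simps(3)[of t v] sides(2)[of "2 - 2 * v" t] 3 v01 t by (simp add: Q m \<beta>1_def)
    qed
  qed
  define \<mu>0 where "\<mu>0 = (\<lambda>(s, t). Q (t, s, 0))"
  \<comment> \<open>Backwards in the deformation, since the pasting passes from the target of
    \<open>m\<close> to that of \<open>f\<close>.\<close>
  define \<mu>1 where "\<mu>1 = (\<lambda>(s, t). Q (1 - t, s, 1))"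
  have \<mu>0_cont: "continuous_map unit_square X \<mu>0"
    unfolding \<mu>0_def case_prod_unfold
    by (rule continuous_map_compose_on[OF Q_cont]) (auto intro!: continuous_intros)
  have \<mu>1_cont: "continuous_map unit_square X \<mu>1"
    unfolding \<mu>1_def case_prod_unfold
    by (rule continuous_map_compose_on[OF Q_cont]) (auto intro!: continuous_intros)
  have bigons: "bigon X \<mu>0" "bigon X \<mu>1"
    using \<mu>0_cont \<mu>1_cont Q_side0 Q_side1 by (auto simp: bigon_def \<mu>0_def \<mu>1_def)
  have slices0: "slice \<mu>0 r \<in> ?V0" if r: "r \<in> {0..1}" for r
  proof (subst slice_in_path_nbhd_iff[OF chain(1) \<mu>0_cont r]; intro ballI)
    fix i s assume i: "i \<in> {1..2 * n0 + 1}" and s: "s \<in> {a0 (i - 1)..a0 i}"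
    have "strip_time n0 a0 i (u r s 0)"
      using strip_time_convex[OF strip_time_middle[OF chain(1) i s] strip_time_reparam[OF chain(1) \<rho>(1) i s],
          of "min 1 (2 * r)"] r by (simp add: u_def)
    then have "max 0 (min 1 (4 * u r s 0 - 1)) \<in> {a0 (i - 1)..a0 i}"
      by (rule strip_time_cases(3)[OF chain(1) i])
    moreover have "R r (u r s 0) \<in> {0..1}"
      using chain_data_strip[OF chain(1) i s] r by (intro R_in u_in) auto
    ultimately show "\<mu>0 (s, r) \<in> W0 i"
      using KW(1)[OF _ i] by (simp add: \<mu>0_def Q_def)
  qed
  have slices1: "slice \<mu>1 r \<in> ?V1" if r: "r \<in> {0..1}" for r
  proof (subst slice_in_path_nbhd_iff[OF chain(2) \<mu>1_cont r]; intro ballI)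
    fix i s assume i: "i \<in> {1..2 * n1 + 1}" and s: "s \<in> {a1 (i - 1)..a1 i}"
    have "strip_time n1 a1 i (u (1 - r) s 1)"
      using strip_time_convex[OF strip_time_middle[OF chain(2) i s] strip_time_reparam[OF chain(2) \<rho>(2) i s],
          of "min 1 (2 * (1 - r))"] r by (simp add: u_def)
    then have "max 0 (min 1 (4 * u (1 - r) s 1 - 1)) \<in> {a1 (i - 1)..a1 i}"
      by (rule strip_time_cases(3)[OF chain(2) i])
    moreover have "R (1 - r) (u (1 - r) s 1) \<in> {0..1}"
      using chain_data_strip[OF chain(2) i s] r by (intro R_in u_in) auto
    ultimately show "\<mu>1 (s, r) \<in> W1 i"
      using KW(2)[OF _ i] by (simp add: \<mu>1_def Q_def)
  qed
  have sl: "\<mu>0 (s, 1) = m (s, 0)" "m (s, 1) = \<mu>1 (s, 0)" if "s \<in> {0..1}" for s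
    using Q1[OF that, of 0] Q1[OF that, of 1] by (auto simp: \<mu>0_def \<mu>1_def)
  let ?g = "vcomp \<mu>1 (vcomp m \<mu>0)"
  note g_simps = vcomp_simps[of \<mu>0 _ m \<mu>1, OF sl]
  \<comment> \<open>Again a trapezoid, now in \<open>t\<close>: at \<open>r = 1\<close> the first
    quarter runs along \<open>\<mu>0\<close> at height 0, the second along \<open>m\<close>, and the
    last half along \<open>\<mu>1\<close> at height 1. The height is \<open>\<kappa>\<close>, which
    moves from \<open>t\<close> to the clipped value of \<open>4 * t - 1\<close>.\<close>
  define \<theta> where "\<theta> r t = r * min 1 (min (4 * t) (2 - 2 * t))" for r t :: real
  define \<kappa> where "\<kappa> r t = max 0 (min 1 ((1 - r) * t + r * (4 * t - 1)))" for r t :: real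
  have \<theta>_in: "\<theta> r t \<in> {0..1}" if "r \<in> {0..1}" "t \<in> {0..1}" for r t
    using that by (auto simp: \<theta>_def intro!: mult_nonneg_nonneg mult_le_one)
  have "homotopic_rel square_boundary unit_square X f ?g"
  proof (rule homotopic_relI)
    let ?E = "\<lambda>(r, s, t). Q (\<theta> r t, s, \<kappa> r t)"
    show "continuous_map (top_of_set unit_cube) X ?E"
      unfolding case_prod_unfold
    proof (rule continuous_map_compose_on[OF Q_cont])
      show "continuous_on unit_cube
          (\<lambda>x. (\<theta> (fst x) (snd (snd x)), fst (snd x), \<kappa> (fst x) (snd (snd x))))"
        unfolding \<theta>_def \<kappa>_def by (intro continuous_intros)
      show "(\<theta> (fst x) (snd (snd x)), fst (snd x), \<kappa> (fst x) (snd (snd x))) \<in> unit_cube"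
        if "x \<in> unit_cube" for x
        using that \<theta>_in[of "fst x" "snd (snd x)"] by (auto simp: \<kappa>_def)
    qed
    show "square_boundary \<subseteq> {0..1} \<times> {0..1}"
      by (auto simp: square_boundary_def)
    show "?E (0, x) = f x" if "x \<in> {0..1} \<times> {0..1}" for x
      using that Q0 by (auto simp: \<theta>_def \<kappa>_def)
    show "?E (1, x) = ?g x" if xin: "x \<in> {0..1} \<times> {0..1}" for x
    proof -
      obtain s t where x: "x = (s, t)" "s \<in> {0..1}" "t \<in> {0..1}"
        using xin by auto
      consider "t \<le> 1 / 4" | "1 / 4 \<le> t" "t \<le> 1 / 2" | "1 / 2 \<le> t"
        by linarith
      then show ?thesis
      proof cases
        case 1
        then have "\<theta> 1 t = 4 * t" "\<kappa> 1 t = 0"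
          using x by (auto simp: \<theta>_def \<kappa>_def)
        then show ?thesis
          using g_simps(1)[of s t] x(2) 1 by (simp add: x \<mu>0_def)
      next
        case 2
        then have "\<theta> 1 t = 1" "\<kappa> 1 t = 4 * t - 1"
          using x by (auto simp: \<theta>_def \<kappa>_def)
        then show ?thesis
          using g_simps(2)[of s t] x(2) 2 Q1[OF x(2), of "4 * t - 1"] 2 by (simp add: x)
      next
        case 3
        then have "\<theta> 1 t = 2 - 2 * t" "\<kappa> 1 t = 1"
          using x by (auto simp: \<theta>_def \<kappa>_def)
        then show ?thesis
          using g_simps(3)[of s t] x(2) 3 by (simp add: x \<mu>1_def)
      qed
    qed
    show "?E (r, x) = f x" if r: "0 \<le> r" "r \<le> 1" and xin: "x \<in> square_boundary" for r x
    proof -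
      obtain s t where x: "x = (s, t)" "s \<in> {0..1}" "t \<in> {0..1}" and cases: "s = 0 \<or> s = 1 \<or> t = 0 \<or> t = 1"
        using xin by (auto simp: square_boundary_def)
      have \<kappa>: "\<kappa> r t \<in> {0..1}"
        by (auto simp: \<kappa>_def)
      have "\<theta> r 0 = 0" "\<theta> r 1 = 0" "\<kappa> r 0 = 0" "\<kappa> r 1 = 1"
        using r by (auto simp: \<theta>_def \<kappa>_def)
      then have "Q (\<theta> r t, s, \<kappa> r t) = f (s, t)"
        using cases Q0 Q_side0[OF \<theta>_in \<kappa>] Q_side1[OF \<theta>_in \<kappa>] bigon_sides[OF fb x(3)] x(2,3) r by auto
      then show ?thesis
        by (simp add: x)
    qed
  qed
  then have "deformable_in X U0 U1 ?V0 ?V1 f ?g"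
    using deformable_in_imp(3)[OF def] by (rule homotopic_rel_imp_deformable_in)
  then have gb: "bigon X ?g"
    by (rule deformable_in_imp)
  have "d = two_track X ?g"
    using two_tracks_mem(2)[OF d] two_track_eq_iff[OF fb gb]
      \<open>homotopic_rel square_boundary unit_square X f ?g\<close> by simp
  moreover have "slice \<mu>0 1 = slice m 0" "slice m 1 = slice \<mu>1 0"
    using sl by (auto simp: slice_eq_iff)
  moreover have "\<beta>0 1 = source0 c" "\<beta>1 0 = target0 c"
    using \<beta>_ends two_track_boundary[OF c] by simp_all
  moreover have "\<forall>t\<in>{0..1}. slice \<mu>0 t \<in> ?V0" "\<forall>t\<in>{0..1}. slice \<mu>1 t \<in> ?V1"
    using slices0 slices1 by blast+
  moreover note c(2) \<beta>0 \<beta>1 bigons \<rho> m_def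
  ultimately show ?thesis
    unfolding track_nbhd_def mem_Collect_eq
    by - (rule conjI[OF d(1)], rule exI[of _ h], rule exI[of _ \<beta>0], rule exI[of _ \<beta>1],
      rule exI[of _ \<mu>0], rule exI[of _ \<mu>1], rule exI[of _ \<rho>0], rule exI[of _ \<rho>1],
      rule exI[of _ m], intro conjI; assumption)
qed

section \<open>The topology of the path space\<close>

lemma openin_path_nbhd:
  assumes chain: "chain_data X n a W"
  shows "openin (path_space X) (path_nbhd X n a W)"
proof -
  let ?B = "\<lambda>i. {f \<in> extensional (topspace unit_interval). continuous_map unit_interval X f \<and> f ` {a (i - 1)..a i} \<subseteq> W i}"
  have "path_nbhd X n a W = (\<Inter>i\<in>{1..2 * n + 1}. ?B i)"
  proof (rule set_eqI)
    fix f
    \<comment> \<open>The index set is nonempty, so that membership in the intersection includes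
      being a path.\<close>
    have "1 \<in> {1..2 * n + 1}"
      by simp
    then show "f \<in> path_nbhd X n a W \<longleftrightarrow> f \<in> (\<Inter>i\<in>{1..2 * n + 1}. ?B i)"
      unfolding path_nbhd_iff topspace_path_space image_subset_iff topspace_euclidean_subtopology INT_iff mem_Collect_eq
      by blast
  qed
  moreover have B: "openin (path_space X) (?B i)" if i: "i \<in> {1..2 * n + 1}" for i
  proof -
    have "compactin unit_interval {a (i - 1)..a i}"
      using chain_data_strip[OF chain i] by (auto simp: compactin_subtopology)
    moreover have "openin X (W i)"
      using chain i by (simp add: chain_data_def basic_open_def)
    ultimately show ?thesis
      unfolding path_space_def compact_open_topology_def
      by (intro topology_generated_by_Basis CollectI exI[of _ "{a (i - 1)..a i}"] exI[of _ "W i"]) simp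
  qed
  moreover have "openin (path_space X) (\<Inter>i\<in>{1..2 * n + 1}. ?B i)"
    by (rule openin_INT2[OF _ _ B]) auto
  ultimately show ?thesis
    by (simp only:)
qed

text \<open>The family \<open>G\<close> describes a neighbourhood of \<open>\<gamma>\<close> pointwise, locally uniformly in the
  parameter. In contrast to the sets \<^const>\<open>path_nbhd\<close>, such descriptions are easily intersected.\<close>

lemma openin_path_space_pointwise:
  assumes "openin (path_space X) N" "\<gamma> \<in> N"
  shows "\<exists>G. (\<forall>s\<in>{0..1}. \<exists>e>0. \<exists>B. openin X B \<and> \<gamma> s \<in> B \<and> (\<forall>t\<in>{0..1}. \<bar>t - s\<bar> < e \<longrightarrow> B \<subseteq> G t)) \<and>
    (\<forall>\<eta>\<in>topspace (path_space X). (\<forall>s\<in>{0..1}. \<eta> s \<in> G s) \<longrightarrow> \<eta> \<in> N)"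
proof -
  let ?small = "\<lambda>G. \<forall>s\<in>{0..1}. \<exists>e>0. \<exists>B. openin X B \<and> \<gamma> s \<in> B \<and> (\<forall>t\<in>{0..1}. \<bar>t - s\<bar> < e \<longrightarrow> B \<subseteq> G t)"
  have \<gamma>: "\<gamma> \<in> topspace (path_space X)"
    using assms openin_subset by blast
  have "generate_topology_on {{f \<in> extensional (topspace unit_interval). continuous_map unit_interval X f \<and> f ` K \<subseteq> U} | K U.
        compactin unit_interval K \<and> openin X U} N"
    using assms(1) unfolding path_space_def compact_open_topology_def by (rule openin_topology_generated_by)
  then show "\<exists>G. ?small G \<and> (\<forall>\<eta>\<in>topspace (path_space X). (\<forall>s\<in>{0..1}. \<eta> s \<in> G s) \<longrightarrow> \<eta> \<in> N)"
    using assms(2)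
  proof (induction rule: generate_topology_on.induct)
    case Empty
    then show ?case
      by simp
  next
    case (Int A B)
    then obtain G H where G: "?small G" "\<forall>\<eta>\<in>topspace (path_space X). (\<forall>s\<in>{0..1}. \<eta> s \<in> G s) \<longrightarrow> \<eta> \<in> A"
      and H: "?small H" "\<forall>\<eta>\<in>topspace (path_space X). (\<forall>s\<in>{0..1}. \<eta> s \<in> H s) \<longrightarrow> \<eta> \<in> B"
      by blast
    have "?small (\<lambda>t. G t \<inter> H t)"
    proof
      fix s :: real assume s: "s \<in> {0..1}"
      obtain e C where 1: "e > 0" "openin X C" "\<gamma> s \<in> C" "\<forall>t\<in>{0..1}. \<bar>t - s\<bar> < e \<longrightarrow> C \<subseteq> G t"
        using G(1) s by blast
      obtain e' C' where 2: "e' > 0" "openin X C'" "\<gamma> s \<in> C'" "\<forall>t\<in>{0..1}. \<bar>t - s\<bar> < e' \<longrightarrow> C' \<subseteq> H t"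
        using H(1) s by blast
      have "C \<inter> C' \<subseteq> G t \<inter> H t" if "t \<in> {0..1}" "\<bar>t - s\<bar> < min e e'" for t
        using that 1(4) 2(4) by (metis Int_mono min_less_iff_conj)
      then show "\<exists>e>0. \<exists>B. openin X B \<and> \<gamma> s \<in> B \<and> (\<forall>t\<in>{0..1}. \<bar>t - s\<bar> < e \<longrightarrow> B \<subseteq> G t \<inter> H t)"
        using 1 2 by (intro exI[of _ "min e e'"] exI[of _ "C \<inter> C'"] conjI openin_Int) auto
    qed
    moreover have "\<forall>\<eta>\<in>topspace (path_space X). (\<forall>s\<in>{0..1}. \<eta> s \<in> G s \<inter> H s) \<longrightarrow> \<eta> \<in> A \<inter> B"
      using G(2) H(2) by blast
    ultimately show ?case
      by (intro exI[of _ "\<lambda>t. G t \<inter> H t"] conjI)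
  next
    case (UN K)
    then obtain A where A: "A \<in> K" "\<gamma> \<in> A"
      by blast
    from UN.IH[OF A] obtain G where "?small G" "\<forall>\<eta>\<in>topspace (path_space X). (\<forall>s\<in>{0..1}. \<eta> s \<in> G s) \<longrightarrow> \<eta> \<in> A"
      by (elim exE conjE)
    with A(1) show ?case
      by (intro exI[of _ G] conjI) blast+
  next
    case (Basis T)
    then obtain K U where T: "T = {f \<in> extensional (topspace unit_interval). continuous_map unit_interval X f \<and> f ` K \<subseteq> U}"
      and K: "compactin unit_interval K" and U: "openin X U"
      by blast
    have "closed K" "K \<subseteq> {0..1}"
      using K by (auto simp: compactin_subtopology compact_imp_closed)
    \<comment> \<open>At points of \<open>K\<close> the set \<open>U\<close> serves as
      \<open>B\<close>, being contained in both values of \<open>G\<close>; away from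
      \<open>K\<close> there is no constraint nearby, as \<open>K\<close> is closed.\<close>
    define G where "G t = (if t \<in> K then U else topspace X)" for t
    have "?small G"
    proof
      fix s :: real assume s: "s \<in> {0..1}"
      show "\<exists>e>0. \<exists>B. openin X B \<and> \<gamma> s \<in> B \<and> (\<forall>t\<in>{0..1}. \<bar>t - s\<bar> < e \<longrightarrow> B \<subseteq> G t)"
      proof (cases "s \<in> K")
        case True
        then have "\<gamma> s \<in> U"
          using Basis(2) T by auto
        then show ?thesis
          using U openin_subset[OF U] by (intro exI[of _ 1] exI[of _ U] conjI) (auto simp: G_def)
      next
        case False
        then obtain e where e: "e > 0" "ball s e \<subseteq> - K"
          using \<open>closed K\<close> by (meson ComplI open_Compl open_contains_ball)
        have "\<gamma> s \<in> topspace X"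
          using \<gamma> s by (auto simp: topspace_path_space continuous_map_def)
        moreover have "t \<notin> K" if "\<bar>t - s\<bar> < e" for t
          using e(2) that by (auto simp: dist_real_def abs_minus_commute)
        ultimately show ?thesis
          using e(1) by (intro exI[of _ e] exI[of _ "topspace X"]) (auto simp: G_def)
      qed
    qed
    moreover have "\<forall>\<eta>\<in>topspace (path_space X). (\<forall>s\<in>{0..1}. \<eta> s \<in> G s) \<longrightarrow> \<eta> \<in> T"
      using \<open>K \<subseteq> {0..1}\<close> by (auto simp: T topspace_path_space G_def subset_iff)
    ultimately show ?case
      by (intro exI[of _ G] conjI)
  qed
qed

section \<open>Neighbourhood bases of the path space and continuity of curried maps\<close>

lemma semilocally_2_connectedE:
  assumes "semilocally_2_connected X" "openin X B" "x \<in> B"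
  obtains C where "basic_open X C" "x \<in> C" "C \<subseteq> B"
  using assms unfolding semilocally_2_connected_def neighbourhood_base_of by (metis subsetD subset_trans)

lemma path_preimage_nbhd:
  assumes "continuous_map unit_interval X \<gamma>" "openin X C" "s \<in> {0..1}" "\<gamma> s \<in> C"
  obtains e where "e > 0" "\<And>t. \<lbrakk>t \<in> {0..1}; \<bar>t - s\<bar> < e\<rbrakk> \<Longrightarrow> \<gamma> t \<in> C"
proof -
  have "openin unit_interval {t \<in> {0..1}. \<gamma> t \<in> C}"
    using openin_continuous_map_preimage[OF assms(1,2)] by simp
  then obtain e where "e > 0" "\<forall>t\<in>{0..1}. dist t s < e \<longrightarrow> t \<in> {t \<in> {0..1}. \<gamma> t \<in> C}"
    using assms(3,4) unfolding openin_euclidean_subtopology_iff by blast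
  then show ?thesis
    by (intro that[of e]) (auto simp: dist_real_def)
qed

text \<open>A Lebesgue number gives a subdivision into pieces that \<open>\<gamma>\<close> maps into
  basic open sets \<open>A j\<close>. Just after each inner division point a short interval is
  inserted, on which \<open>\<gamma>\<close> stays in a basic open \<open>D j\<close> inside both
  adjacent sets. The inserted intervals become the even strips.\<close>

lemma path_nbhd_basis:
  assumes X: "semilocally_2_connected X" and N: "openin (path_space X) N" "\<gamma> \<in> N"
  obtains n a W where "chain_data X n a W" "\<gamma> \<in> path_nbhd X n a W" "path_nbhd X n a W \<subseteq> N"
proof -
  have \<gamma>: "\<gamma> \<in> topspace (path_space X)"
    using N openin_subset by blast
  moreover from this have "continuous_map unit_interval X \<gamma>"
    by (simp add: topspace_path_space)
  ultimately have \<gamma>: "\<gamma> \<in> topspace (path_space X)" "continuous_map unit_interval X \<gamma>" .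
  obtain G where
    G: "\<forall>s\<in>{0..1}. \<exists>e>0. \<exists>B. openin X B \<and> \<gamma> s \<in> B \<and> (\<forall>t\<in>{0..1}. \<bar>t - s\<bar> < e \<longrightarrow> B \<subseteq> G t)"
      "\<forall>\<eta>\<in>topspace (path_space X). (\<forall>s\<in>{0..1}. \<eta> s \<in> G s) \<longrightarrow> \<eta> \<in> N"
    using openin_path_space_pointwise[OF N] by (elim exE conjE)
  have "\<exists>e>0. \<exists>C. basic_open X C \<and> (\<forall>t\<in>{0..1}. \<bar>t - s\<bar> < e \<longrightarrow> \<gamma> t \<in> C \<and> C \<subseteq> G t)" if s: "s \<in> {0..1}" for s
  proof -
    obtain e B where 1: "e > 0" "openin X B" "\<gamma> s \<in> B" "\<forall>t\<in>{0..1}. \<bar>t - s\<bar> < e \<longrightarrow> B \<subseteq> G t"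
      using bspec[OF G(1) s] by blast
    obtain C where 2: "basic_open X C" "\<gamma> s \<in> C" "C \<subseteq> B"
      using semilocally_2_connectedE[OF X 1(2,3)] .
    then obtain e' where 3: "e' > 0" "\<And>t. \<lbrakk>t \<in> {0..1}; \<bar>t - s\<bar> < e'\<rbrakk> \<Longrightarrow> \<gamma> t \<in> C"
      using path_preimage_nbhd[OF \<gamma>(2) _ s] unfolding basic_open_def by metis
    have "\<gamma> t \<in> C \<and> C \<subseteq> G t" if "t \<in> {0..1}" "\<bar>t - s\<bar> < min e e'" for t
      using that 1(4) 2(3) 3(2)[of t] by (metis min_less_iff_conj subset_trans)
    then show ?thesis
      using 1(1) 2(1) 3(1) by (intro exI[of _ "min e e'"] exI[of _ C] conjI) auto
  qed
  then obtain e C where eC: "\<And>s. s \<in> {0..1} \<Longrightarrow> e s > 0" "\<And>s. s \<in> {0..1} \<Longrightarrow> basic_open X (C s)"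
    "\<And>s t. \<lbrakk>s \<in> {0..1}; t \<in> {0..1}; \<bar>t - s\<bar> < e s\<rbrakk> \<Longrightarrow> \<gamma> t \<in> C s \<and> C s \<subseteq> G t"
    by metis
  let ?\<C> = "(\<lambda>s. ball s (e s)) ` {0..1}"
  have cover: "?\<C> \<noteq> {}" "{0..1} \<subseteq> \<Union>?\<C>" "\<And>B. B \<in> ?\<C> \<Longrightarrow> open B"
    using eC(1) by auto
  obtain \<delta> where \<delta>: "\<delta> > 0" "\<And>T. \<lbrakk>T \<subseteq> {0..1}; diameter T < \<delta>\<rbrakk> \<Longrightarrow> \<exists>B\<in>?\<C>. T \<subseteq> B"
    using Lebesgue_number_lemma[OF compact_Icc cover] by metis
  obtain n where n: "inverse (real (Suc n)) < \<delta>"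
    using reals_Archimedean[OF \<delta>(1)] by blast
  define p where "p j = real j / real (Suc n)" for j
  have p_mono: "p j \<le> p k" if "j \<le> k" for j k
    using that by (simp add: p_def divide_right_mono)
  have p_less: "p j < p (Suc j)" for j
    by (simp add: p_def divide_strict_right_mono)
  have p_ends: "p 0 = 0" "p (Suc n) = 1"
    by (simp_all add: p_def)
  have p_in: "{p j..p (Suc j)} \<subseteq> {0..1}" if "j \<le> n" for j
    using p_mono[of 0 j] p_mono[of "Suc j" "Suc n"] that p_ends by auto
  have "\<exists>A. basic_open X A \<and> (\<forall>t\<in>{p j..p (Suc j)}. \<gamma> t \<in> A \<and> A \<subseteq> G t)" if j: "j \<le> n" for j
  proof -
    have "diameter {p j..p (Suc j)} = p (Suc j) - p j"
      using p_less[of j] by (simp add: diameter_closed_interval)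
    also have "\<dots> = inverse (real (Suc n))"
      by (simp add: p_def field_simps)
    finally obtain s where s: "s \<in> {0..1}" "{p j..p (Suc j)} \<subseteq> ball s (e s)"
      using \<delta>(2)[OF p_in[OF j]] n by auto
    have "\<gamma> t \<in> C s \<and> C s \<subseteq> G t" if "t \<in> {p j..p (Suc j)}" for t
    proof (rule eC(3)[OF s(1)])
      show "t \<in> {0..1}" "\<bar>t - s\<bar> < e s"
        using that s(2) p_in[OF j] by (auto simp: dist_real_def abs_minus_commute subset_iff)
    qed
    then show ?thesis
      using eC(2)[OF s(1)] by blast
  qed
  then obtain A where A: "\<And>j. j \<le> n \<Longrightarrow> basic_open X (A j)"
    "\<And>j t. \<lbrakk>j \<le> n; t \<in> {p j..p (Suc j)}\<rbrakk> \<Longrightarrow> \<gamma> t \<in> A j \<and> A j \<subseteq> G t"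
    by metis
  have "\<exists>D \<epsilon>. basic_open X D \<and> D \<subseteq> A (j - 1) \<inter> A j \<and> p j < \<epsilon> \<and> \<epsilon> < p (Suc j) \<and> (\<forall>t\<in>{p j..\<epsilon>}. \<gamma> t \<in> D)"
    if j: "j \<in> {1..n}" for j
  proof -
    have "p j \<in> {p (j - 1)..p (Suc (j - 1))}" "p j \<in> {p j..p (Suc j)}"
      using j p_mono[of "j - 1" j] p_less[of j] by auto
    then have "\<gamma> (p j) \<in> A (j - 1) \<inter> A j"
      using A(2)[of "j - 1" "p j"] A(2)[of j "p j"] j by auto
    moreover have "openin X (A (j - 1) \<inter> A j)"
      using A(1)[of "j - 1"] A(1)[of j] j by (auto simp: basic_open_def)
    ultimately obtain D where D: "basic_open X D" "\<gamma> (p j) \<in> D" "D \<subseteq> A (j - 1) \<inter> A j"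
      using semilocally_2_connectedE[OF X] by metis
    have pj: "p j \<in> {0..1}"
      using p_in[of j] p_less[of j] j by auto
    obtain d where d: "d > 0" "\<And>t. \<lbrakk>t \<in> {0..1}; \<bar>t - p j\<bar> < d\<rbrakk> \<Longrightarrow> \<gamma> t \<in> D"
      using path_preimage_nbhd[OF \<gamma>(2) _ pj D(2)] D(1) unfolding basic_open_def by metis
    \<comment> \<open>Half the distance allowed by the continuity radius \<open>d\<close> and by the
      next division point, so that an odd strip remains to the right.\<close>
    define \<epsilon> where "\<epsilon> = p j + min d (p (Suc j) - p j) / 2"
    have \<epsilon>: "p j < \<epsilon>" "\<epsilon> < p (Suc j)" "\<epsilon> < p j + d"
      using d(1) p_less[of j] by (auto simp: \<epsilon>_def min_def field_simps)
    have "\<gamma> t \<in> D" if "t \<in> {p j..\<epsilon>}" for t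
      using that \<epsilon> p_in[of j] j by (intro d(2)) auto
    then show ?thesis
      using D \<epsilon> by blast
  qed
  then obtain D \<epsilon> where D: "\<And>j. j \<in> {1..n} \<Longrightarrow> basic_open X (D j) \<and> D j \<subseteq> A (j - 1) \<inter> A j \<and>
      p j < \<epsilon> j \<and> \<epsilon> j < p (Suc j) \<and> (\<forall>t\<in>{p j..\<epsilon> j}. \<gamma> t \<in> D j)"
    by metis
  \<comment> \<open>The order of points is
    \<open>0, p 1, \<epsilon> 1, p 2, \<epsilon> 2, ...\<close>: even strips are
    \<open>{p j..\<epsilon> j}\<close> with member \<open>D j\<close>, odd ones run from
    \<open>\<epsilon> j\<close> (or 0) to \<open>p (Suc j)\<close> with member
    \<open>A j\<close>.\<close>
  define a where "a i = (if i = 0 then 0 else if odd i then p (Suc (i div 2)) else \<epsilon> (i div 2))" for i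
  define W where "W i = (if odd i then A (i div 2) else D (i div 2))" for i
  have strip: "(\<exists>j\<in>{1..n}. i = 2 * j \<and> {a (i - 1)..a i} = {p j..\<epsilon> j} \<and> W i = D j \<and> a (i - 1) < a i) \<or>
      (\<exists>j\<le>n. i = 2 * j + 1 \<and> {a (i - 1)..a i} \<subseteq> {p j..p (Suc j)} \<and> W i = A j \<and> a (i - 1) < a i)"
    if i: "i \<in> {1..2 * n + 1}" for i
  proof (cases "even i")
    case True
    then obtain j where j: "i = 2 * j"
      by blast
    then have "j \<in> {1..n}" "i - 1 = 2 * (j - 1) + 1"
      using i by auto
    then show ?thesis
      using j D[of j] by (intro disjI1 bexI[of _ j]) (auto simp: a_def W_def)
  next
    case False
    then obtain j where j: "i = 2 * j + 1"
      by (meson oddE)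
    then have "j \<le> n"
      using i by auto
    moreover have "p j \<le> a (i - 1)" "a (i - 1) < p (Suc j)"
      using D[of j] j \<open>j \<le> n\<close> p_ends p_less[of j] by (auto simp: a_def)
    ultimately show ?thesis
      using j by (intro disjI2 exI[of _ j]) (auto simp: a_def W_def)
  qed
  have chain: "chain_data X n a W"
    unfolding chain_data_def
  proof (intro conjI ballI allI impI)
    show "a 0 = 0" "a (2 * n + 1) = 1"
      using p_ends by (simp_all add: a_def)
    show "a i < a (i + 1)" if "i \<le> 2 * n" for i
      using strip[of "i + 1"] that by auto
    show "basic_open X (W i)" if "i \<in> {1..2 * n + 1}" for i
      using strip[OF that] A(1) D by auto
    show "W (2 * i) \<subseteq> W (2 * i - 1) \<inter> W (2 * i + 1)" if i: "i \<in> {1..n}" for i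
    proof -
      have "2 * i - 1 = 2 * (i - 1) + 1"
        using i by auto
      then have "W (2 * i - 1) = A (i - 1)"
        by (simp add: W_def)
      then show ?thesis
        using D[OF i] by (simp add: W_def)
    qed
  qed
  have W: "\<gamma> s \<in> W i \<and> W i \<subseteq> G s" if i: "i \<in> {1..2 * n + 1}" and s: "s \<in> {a (i - 1)..a i}" for i s
    using strip[OF i]
  proof (elim disjE bexE exE conjE)
    fix j assume j: "j \<in> {1..n}" and "i = 2 * j" "{a (i - 1)..a i} = {p j..\<epsilon> j}" "W i = D j"
    then show ?thesis
      using s D[OF j] A(2)[of j s] by auto
  next
    fix j assume "j \<le> n" "i = 2 * j + 1" "{a (i - 1)..a i} \<subseteq> {p j..p (Suc j)}" "W i = A j"
    then show ?thesis
      using s A(2)[of j s] by auto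
  qed
  show ?thesis
  proof (rule that[OF chain])
    show "\<gamma> \<in> path_nbhd X n a W"
      using \<gamma>(1) W by (simp add: path_nbhd_iff)
    show "path_nbhd X n a W \<subseteq> N"
    proof
      fix \<eta> assume \<eta>: "\<eta> \<in> path_nbhd X n a W"
      have "\<eta> s \<in> G s" if s: "s \<in> {0..1}" for s
      proof -
        obtain i where i: "i \<in> {1..2 * n + 1}" "s \<in> {a (i - 1)..a i}"
          using chain_data_interval[OF chain s] .
        then show ?thesis
          using \<eta> W[OF i] unfolding path_nbhd_iff by blast
      qed
      then show "\<eta> \<in> N"
        using \<eta> G(2) by (simp add: path_nbhd_iff)
    qed
  qed
qed

text \<open>The bounds \<open>O0\<close>, \<open>O1\<close>, \<open>P0\<close>, \<open>P1\<close>
  allow all four sets to be shrunk at once, as intersecting two neighbourhoods of a 2-track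
  demands.\<close>

lemma ex_nbhd_data:
  assumes X: "semilocally_2_connected X"
    and N: "openin (path_space X) O0" "\<gamma>0 \<in> O0" "openin (path_space X) O1" "\<gamma>1 \<in> O1"
    and eq: "\<gamma>0 0 = \<gamma>1 0" "\<gamma>0 1 = \<gamma>1 1"
    and P: "openin X P0" "\<gamma>0 0 \<in> P0" "openin X P1" "\<gamma>0 1 \<in> P1"
  obtains U0 U1 n0 a0 W0 n1 a1 W1 where "nbhd_data X U0 U1 n0 a0 W0 n1 a1 W1"
    "\<gamma>0 \<in> path_nbhd X n0 a0 W0" "path_nbhd X n0 a0 W0 \<subseteq> O0" "\<gamma>1 \<in> path_nbhd X n1 a1 W1" "path_nbhd X n1 a1 W1 \<subseteq> O1"
    "\<gamma>0 0 \<in> U0" "U0 \<subseteq> P0" "\<gamma>0 1 \<in> U1" "U1 \<subseteq> P1"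
proof -
  obtain n0 a0 W0 where 0: "chain_data X n0 a0 W0" "\<gamma>0 \<in> path_nbhd X n0 a0 W0" "path_nbhd X n0 a0 W0 \<subseteq> O0"
    using path_nbhd_basis[OF X N(1,2)] .
  obtain n1 a1 W1 where 1: "chain_data X n1 a1 W1" "\<gamma>1 \<in> path_nbhd X n1 a1 W1" "path_nbhd X n1 a1 W1 \<subseteq> O1"
    using path_nbhd_basis[OF X N(3,4)] .
  have W: "openin X (W0 i)" if "i \<in> {1..2 * n0 + 1}" for i
    using 0(1) that by (simp add: chain_data_def basic_open_def)
  have W': "openin X (W1 i)" if "i \<in> {1..2 * n1 + 1}" for i
    using 1(1) that by (simp add: chain_data_def basic_open_def)
  have "openin X (W0 1 \<inter> W1 1 \<inter> P0)" "\<gamma>0 0 \<in> W0 1 \<inter> W1 1 \<inter> P0"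
    using W W' P path_nbhd_endpoints[OF 0(1,2)] path_nbhd_endpoints[OF 1(1,2)] eq by (auto intro!: openin_Int)
  then obtain U0 where U0: "basic_open X U0" "\<gamma>0 0 \<in> U0" "U0 \<subseteq> W0 1 \<inter> W1 1 \<inter> P0"
    using semilocally_2_connectedE[OF X] by metis
  have "openin X (W0 (2 * n0 + 1) \<inter> W1 (2 * n1 + 1) \<inter> P1)" "\<gamma>0 1 \<in> W0 (2 * n0 + 1) \<inter> W1 (2 * n1 + 1) \<inter> P1"
    using W W' P path_nbhd_endpoints[OF 0(1,2)] path_nbhd_endpoints[OF 1(1,2)] eq by (auto intro!: openin_Int)
  then obtain U1 where U1: "basic_open X U1" "\<gamma>0 1 \<in> U1" "U1 \<subseteq> W0 (2 * n0 + 1) \<inter> W1 (2 * n1 + 1) \<inter> P1"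
    using semilocally_2_connectedE[OF X] by metis
  show ?thesis
    by (rule that[of U0 U1 n0 a0 W0 n1 a1 W1]) (use 0 1 U0 U1 in \<open>auto simp: nbhd_data_def\<close>)
qed

text \<open>One half of the exponential law. If \<open>F\<close> maps \<open>{y} \<times> K\<close>
  into \<open>U\<close> with \<open>K\<close> compact, the tube lemma gives a neighbourhood
  \<open>A\<close> of \<open>y\<close> such that \<open>A \<times> K\<close> is mapped into
  \<open>U\<close> too.\<close>

lemma continuous_map_curry_path_space:
  assumes F: "continuous_map (prod_topology Y unit_interval) X F"
  shows "continuous_map Y (path_space X) (\<lambda>y. restrict (\<lambda>t. F (y, t)) {0..1})"
  unfolding path_space_def compact_open_topology_def
proof (rule continuous_on_generated_topo)
  let ?\<sigma> = "\<lambda>y. restrict (\<lambda>t. F (y, t)) {0..1::real}"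
  have path: "continuous_map unit_interval X (?\<sigma> y)" if "y \<in> topspace Y" for y
  proof -
    have "continuous_map unit_interval X (\<lambda>t. F (y, t))"
      by (rule continuous_map_compose[OF _ F, unfolded o_def]) (use that in \<open>auto intro: continuous_map_pairedI\<close>)
    then show ?thesis
      by (rule continuous_map_eq_on) simp
  qed
  then show "?\<sigma> ` topspace Y \<subseteq> \<Union> {{f \<in> extensional (topspace unit_interval). continuous_map unit_interval X f \<and> f ` K \<subseteq> U} | K U.
      compactin unit_interval K \<and> openin X U}"
    by (intro image_subsetI UnionI CollectI exI[of _ "{}"] exI[of _ "{} :: real set"]) auto
  fix S assume "S \<in> {{f \<in> extensional (topspace unit_interval). continuous_map unit_interval X f \<and> f ` K \<subseteq> U} | K U.
      compactin unit_interval K \<and> openin X U}"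
  then obtain K U where S: "S = {f \<in> extensional (topspace unit_interval). continuous_map unit_interval X f \<and> f ` K \<subseteq> U}"
    and K: "compactin unit_interval K" and U: "openin X U"
    by blast
  have KI: "K \<subseteq> {0..1}"
    using K by (auto simp: compactin_subtopology)
  have eq: "?\<sigma> -` S \<inter> topspace Y = {y \<in> topspace Y. \<forall>t\<in>K. F (y, t) \<in> U}"
    using path KI by (auto simp: S subset_iff)
  show "openin Y (?\<sigma> -` S \<inter> topspace Y)"
    unfolding eq
  proof (subst openin_subopen, intro ballI)
    fix y assume y: "y \<in> {y \<in> topspace Y. \<forall>t\<in>K. F (y, t) \<in> U}"
    let ?P = "{z \<in> topspace (prod_topology Y unit_interval). F z \<in> U}"
    have "openin (prod_topology Y unit_interval) ?P"
      using openin_continuous_map_preimage[OF F U] .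
    moreover have "{y} \<times> K \<subseteq> ?P"
      using y KI by auto
    ultimately obtain A B where AB: "openin Y A" "y \<in> A" "K \<subseteq> B" "A \<times> B \<subseteq> ?P"
      using tube_lemma_right[of Y unit_interval ?P K y] K y by blast
    then have "A \<subseteq> {y \<in> topspace Y. \<forall>t\<in>K. F (y, t) \<in> U}"
      using openin_subset[OF AB(1)] by blast
    then show "\<exists>T. openin Y T \<and> y \<in> T \<and> T \<subseteq> {y \<in> topspace Y. \<forall>t\<in>K. F (y, t) \<in> U}"
      using AB by blast
  qed
qed

section \<open>Sheets\<close>

definition sheet :: "'a topology \<Rightarrow> 'a set \<Rightarrow> 'a set \<Rightarrow> (real \<Rightarrow> 'a) set \<Rightarrow> (real \<Rightarrow> 'a) set \<Rightarrow>
    (real \<times> real \<Rightarrow> 'a) set \<Rightarrow> (real \<times> real \<Rightarrow> 'a) set set" where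
  "sheet X A0 A1 V0 V1 c = {d \<in> two_tracks X. \<exists>f\<in>d. \<exists>h\<in>c. deformable_in X A0 A1 V0 V1 f h}"

text \<open>A sheet depends only on the four sets, so the chains presenting two of them are
  quantified away.\<close>

definition nbhd_box :: "'a topology \<Rightarrow> 'a set \<Rightarrow> 'a set \<Rightarrow> (real \<Rightarrow> 'a) set \<Rightarrow> (real \<Rightarrow> 'a) set \<Rightarrow> bool" where
  "nbhd_box X A0 A1 V0 V1 \<longleftrightarrow> (\<exists>n0 a0 W0 n1 a1 W1. nbhd_data X A0 A1 n0 a0 W0 n1 a1 W1 \<and>
     V0 = path_nbhd X n0 a0 W0 \<and> V1 = path_nbhd X n1 a1 W1)"

definition box_pairs :: "'a set \<Rightarrow> 'a set \<Rightarrow> (real \<Rightarrow> 'a) set \<Rightarrow> (real \<Rightarrow> 'a) set \<Rightarrow>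
    ((real \<Rightarrow> 'a) \<times> (real \<Rightarrow> 'a)) set" where
  "box_pairs A0 A1 V0 V1 = {(\<eta>, \<theta>). \<eta> \<in> V0 \<and> \<theta> \<in> V1 \<and> \<eta> 0 = \<theta> 0 \<and> \<eta> 1 = \<theta> 1 \<and> \<eta> 0 \<in> A0 \<and> \<eta> 1 \<in> A1}"

definition boundary_pair :: "(real \<times> real \<Rightarrow> 'a) set \<Rightarrow> (real \<Rightarrow> 'a) \<times> (real \<Rightarrow> 'a)" where
  "boundary_pair c = (source1 c, target1 c)"

lemma two_track_ends:
  assumes "c \<in> two_tracks X"
  shows "source1 c 0 = source0 c" "target1 c 0 = source0 c" "source1 c 1 = target0 c" "target1 c 1 = target0 c"
    "source1 c \<in> topspace (path_space X)" "target1 c \<in> topspace (path_space X)"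
proof -
  obtain h where h: "bigon X h" "c = two_track X h"
    using assms by (rule two_tracksE)
  then have "h \<in> c"
    by (simp add: two_track_self)
  note b = two_track_boundary[OF assms this]
  have "h (0, 1) = h (0, 0)" "h (1, 1) = h (1, 0)"
    using bigon_sides[OF h(1), of 1] by auto
  then show "source1 c 0 = source0 c" "target1 c 0 = source0 c" "source1 c 1 = target0 c" "target1 c 1 = target0 c"
    by (simp_all add: b)
  show "source1 c \<in> topspace (path_space X)" "target1 c \<in> topspace (path_space X)"
    unfolding b by (intro slice_in_path_space bigon_continuous h(1); simp)+
qed

lemma bigon_in_iff_boundary_pair:
  assumes "c \<in> two_tracks X" "h \<in> c"
  shows "bigon_in A0 A1 V0 V1 h \<longleftrightarrow> boundary_pair c \<in> box_pairs A0 A1 V0 V1"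
proof -
  have h: "bigon X h"
    using two_tracks_mem(1)[OF assms] .
  note b = two_track_boundary[OF assms, symmetric]
  have iff: "boundary_pair c \<in> box_pairs A0 A1 V0 V1 \<longleftrightarrow>
      source1 c \<in> V0 \<and> target1 c \<in> V1 \<and> source0 c \<in> A0 \<and> target0 c \<in> A1"
    using two_track_ends[OF assms(1)] by (simp add: boundary_pair_def box_pairs_def)
  show ?thesis
    unfolding iff
  proof
    assume "bigon_in A0 A1 V0 V1 h"
    from bigon_inD(3-6)[OF this] show "source1 c \<in> V0 \<and> target1 c \<in> V1 \<and> source0 c \<in> A0 \<and> target0 c \<in> A1"
      by (simp add: b)
  next
    assume "source1 c \<in> V0 \<and> target1 c \<in> V1 \<and> source0 c \<in> A0 \<and> target0 c \<in> A1"
    then show "bigon_in A0 A1 V0 V1 h"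
      by (intro bigon_inI[OF bigon_sides[OF h]]) (simp_all add: b)
  qed
qed

lemma track_nbhd_eq_sheet:
  assumes "nbhd_data X U0 U1 n0 a0 W0 n1 a1 W1" "c \<in> two_tracks X"
    and "source1 c \<in> path_nbhd X n0 a0 W0" "target1 c \<in> path_nbhd X n1 a1 W1"
  shows "track_nbhd X c U0 U1 n0 a0 W0 n1 a1 W1 = sheet X U0 U1 (path_nbhd X n0 a0 W0) (path_nbhd X n1 a1 W1) c"
proof (intro subset_antisym subsetI)
  fix d assume d: "d \<in> track_nbhd X c U0 U1 n0 a0 W0 n1 a1 W1"
  then have "d \<in> two_tracks X"
    by (simp add: track_nbhd_def)
  then show "d \<in> sheet X U0 U1 (path_nbhd X n0 a0 W0) (path_nbhd X n1 a1 W1) c"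
    using track_nbhd_imp_deformable_in[OF assms(1,2) d assms(3,4)] by (simp add: sheet_def)
next
  fix d assume "d \<in> sheet X U0 U1 (path_nbhd X n0 a0 W0) (path_nbhd X n1 a1 W1) c"
  then show "d \<in> track_nbhd X c U0 U1 n0 a0 W0 n1 a1 W1"
    using deformable_in_imp_track_nbhd[OF assms(1,2)] by (auto simp: sheet_def)
qed

text \<open>The generating families coincide. From here on the topology is handled through
  deformations alone, and the whiskered form does not return.\<close>

lemma two_track_topology_sheets:
  "two_track_topology X = topology_generated_by {sheet X A0 A1 V0 V1 c | A0 A1 V0 V1 c.
     c \<in> two_tracks X \<and> nbhd_box X A0 A1 V0 V1 \<and> boundary_pair c \<in> box_pairs A0 A1 V0 V1}"
proof -
  let ?valid = "\<lambda>c U0 U1 n0 a0 W0 n1 a1 W1. chain_data X n0 a0 W0 \<and> source1 c \<in> path_nbhd X n0 a0 W0 \<and>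
        chain_data X n1 a1 W1 \<and> target1 c \<in> path_nbhd X n1 a1 W1 \<and>
        basic_open X U0 \<and> source0 c \<in> U0 \<and> U0 \<subseteq> W0 1 \<inter> W1 1 \<and>
        basic_open X U1 \<and> target0 c \<in> U1 \<and> U1 \<subseteq> W0 (2 * n0 + 1) \<inter> W1 (2 * n1 + 1)"
  have eq: "?valid c U0 U1 n0 a0 W0 n1 a1 W1 \<longleftrightarrow>
      nbhd_data X U0 U1 n0 a0 W0 n1 a1 W1 \<and>
        boundary_pair c \<in> box_pairs U0 U1 (path_nbhd X n0 a0 W0) (path_nbhd X n1 a1 W1)"
    if "c \<in> two_tracks X" for c U0 U1 n0 a0 W0 n1 a1 W1
    using two_track_ends[OF that] by (auto simp: nbhd_data_def boundary_pair_def box_pairs_def)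
  have sheet: "track_nbhd X c U0 U1 n0 a0 W0 n1 a1 W1 = sheet X U0 U1 (path_nbhd X n0 a0 W0) (path_nbhd X n1 a1 W1) c"
    if "c \<in> two_tracks X" "nbhd_data X U0 U1 n0 a0 W0 n1 a1 W1"
      "boundary_pair c \<in> box_pairs U0 U1 (path_nbhd X n0 a0 W0) (path_nbhd X n1 a1 W1)" for c U0 U1 n0 a0 W0 n1 a1 W1
    using track_nbhd_eq_sheet[OF that(2,1)] that(3) by (simp add: boundary_pair_def box_pairs_def)
  have "{track_nbhd X c U0 U1 n0 a0 W0 n1 a1 W1 | c U0 U1 n0 a0 W0 n1 a1 W1.
        c \<in> two_tracks X \<and> ?valid c U0 U1 n0 a0 W0 n1 a1 W1} =
    {sheet X A0 A1 V0 V1 c | A0 A1 V0 V1 c.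
     c \<in> two_tracks X \<and> nbhd_box X A0 A1 V0 V1 \<and> boundary_pair c \<in> box_pairs A0 A1 V0 V1}" (is "?L = ?R")
  proof (intro subset_antisym subsetI)
    fix S assume "S \<in> ?L"
    then obtain c U0 U1 n0 a0 W0 n1 a1 W1 where S: "S = track_nbhd X c U0 U1 n0 a0 W0 n1 a1 W1" and c: "c \<in> two_tracks X"
      and "?valid c U0 U1 n0 a0 W0 n1 a1 W1"
      unfolding mem_Collect_eq by (elim exE conjE) (rule that, assumption+, intro conjI)
    then have D: "nbhd_data X U0 U1 n0 a0 W0 n1 a1 W1"
      "boundary_pair c \<in> box_pairs U0 U1 (path_nbhd X n0 a0 W0) (path_nbhd X n1 a1 W1)"
      unfolding eq[OF c] by auto
    then have "S = sheet X U0 U1 (path_nbhd X n0 a0 W0) (path_nbhd X n1 a1 W1) c"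
      using sheet[OF c] S by simp
    then show "S \<in> ?R"
      using c D unfolding nbhd_box_def by blast
  next
    fix S assume "S \<in> ?R"
    then obtain U0 U1 V0 V1 c where S: "S = sheet X U0 U1 V0 V1 c" and c: "c \<in> two_tracks X"
      and "nbhd_box X U0 U1 V0 V1" "boundary_pair c \<in> box_pairs U0 U1 V0 V1"
      by blast
    then obtain n0 a0 W0 n1 a1 W1 where D: "nbhd_data X U0 U1 n0 a0 W0 n1 a1 W1"
      "boundary_pair c \<in> box_pairs U0 U1 (path_nbhd X n0 a0 W0) (path_nbhd X n1 a1 W1)"
      "V0 = path_nbhd X n0 a0 W0" "V1 = path_nbhd X n1 a1 W1"
      unfolding nbhd_box_def by blast
    have "S = track_nbhd X c U0 U1 n0 a0 W0 n1 a1 W1"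
      using sheet[OF c D(1,2)] S D(3,4) by simp
    moreover note conjI[OF c eq[OF c, THEN iffD2, OF conjI[OF D(1,2)]]]
    ultimately show "S \<in> ?L"
      unfolding mem_Collect_eq by blast
  qed
  then show ?thesis
    unfolding two_track_topology_def by (simp only:)
qed

section \<open>Sheets as deformation classes lying bijectively over boxes of parallel paths\<close>

lemma sheet_boundary:
  assumes "d \<in> sheet X A0 A1 V0 V1 c" "c \<in> two_tracks X"
  shows "d \<in> two_tracks X" "boundary_pair d \<in> box_pairs A0 A1 V0 V1" "boundary_pair c \<in> box_pairs A0 A1 V0 V1"
proof -
  obtain f h where fh: "d \<in> two_tracks X" "f \<in> d" "h \<in> c" "deformable_in X A0 A1 V0 V1 f h"
    using assms(1) unfolding sheet_def by blast
  then show "d \<in> two_tracks X" "boundary_pair d \<in> box_pairs A0 A1 V0 V1" "boundary_pair c \<in> box_pairs A0 A1 V0 V1"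
    using deformable_in_imp(3,4)[OF fh(4)] bigon_in_iff_boundary_pair assms(2) by blast+
qed

text \<open>One pair of representatives suffices in the definition, because representatives of a
  2-track are deformable into each other; hence every pair works.\<close>

lemma sheet_deformable:
  assumes "d \<in> sheet X A0 A1 V0 V1 c" "c \<in> two_tracks X" "f \<in> d" "h \<in> c"
  shows "deformable_in X A0 A1 V0 V1 f h"
proof -
  obtain f' h' where d: "d \<in> two_tracks X" "f' \<in> d" "h' \<in> c" and def: "deformable_in X A0 A1 V0 V1 f' h'"
    using assms(1) unfolding sheet_def by blast
  have "deformable_in X A0 A1 V0 V1 f' f"
    by (rule homotopic_rel_imp_deformable_in[OF two_tracks_homotopic[OF d(1,2) assms(3)] deformable_in_imp(3)[OF def]])
  moreover have "deformable_in X A0 A1 V0 V1 h' h"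
    by (rule homotopic_rel_imp_deformable_in[OF two_tracks_homotopic[OF assms(2) d(3) assms(4)] deformable_in_imp(4)[OF def]])
  ultimately show ?thesis
    using def deformable_in_trans deformable_in_sym by metis
qed

lemma two_tracks_nonempty: "c \<in> two_tracks X \<Longrightarrow> \<exists>f. f \<in> c"
  by (metis two_tracksE two_track_self)

lemma sheet_self:
  assumes "c \<in> two_tracks X" "boundary_pair c \<in> box_pairs A0 A1 V0 V1"
  shows "c \<in> sheet X A0 A1 V0 V1 c"
proof -
  obtain h where h: "h \<in> c"
    using two_tracks_nonempty[OF assms(1)] by blast
  have "deformable_in X A0 A1 V0 V1 h h"
    using homotopic_rel_imp_deformable_in[OF two_tracks_homotopic[OF assms(1) h h]]
      bigon_in_iff_boundary_pair[OF assms(1) h] assms(2) by blast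
  then show ?thesis
    using assms(1) h unfolding sheet_def by blast
qed

lemma sheet_eq:
  assumes "d \<in> sheet X A0 A1 V0 V1 c" "c \<in> two_tracks X"
  shows "sheet X A0 A1 V0 V1 d = sheet X A0 A1 V0 V1 c"
proof -
  have d: "d \<in> two_tracks X"
    using sheet_boundary(1)[OF assms] .
  obtain f h where f: "f \<in> d" "h \<in> c"
    using two_tracks_nonempty d assms(2) by metis
  have fh: "deformable_in X A0 A1 V0 V1 f h"
    by (rule sheet_deformable[OF assms f])
  have "e \<in> sheet X A0 A1 V0 V1 c" if e: "e \<in> sheet X A0 A1 V0 V1 d" for e
  proof -
    obtain g where g: "g \<in> e"
      using two_tracks_nonempty sheet_boundary(1)[OF e d] by blast
    have "deformable_in X A0 A1 V0 V1 g h"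
      using deformable_in_trans[OF sheet_deformable[OF e d g f(1)] fh] .
    then show ?thesis
      using sheet_boundary(1)[OF e d] g f(2) unfolding sheet_def by blast
  qed
  moreover have "e \<in> sheet X A0 A1 V0 V1 d" if e: "e \<in> sheet X A0 A1 V0 V1 c" for e
  proof -
    obtain g where g: "g \<in> e"
      using two_tracks_nonempty sheet_boundary(1)[OF e assms(2)] by blast
    have "deformable_in X A0 A1 V0 V1 g f"
      using deformable_in_trans[OF sheet_deformable[OF e assms(2) g f(2)] deformable_in_sym[OF fh]] .
    then show ?thesis
      using sheet_boundary(1)[OF e assms(2)] g f(1) unfolding sheet_def by blast
  qed
  ultimately show ?thesis
    by blast
qed

lemma sheet_mono:
  assumes "A0 \<subseteq> A0'" "A1 \<subseteq> A1'" "V0 \<subseteq> V0'" "V1 \<subseteq> V1'"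
  shows "sheet X A0 A1 V0 V1 c \<subseteq> sheet X A0' A1' V0' V1' c"
  using deformable_in_mono[OF _ assms] unfolding sheet_def by blast

lemma sheet_lift:
  assumes "nbhd_box X A0 A1 V0 V1" "c \<in> two_tracks X" "boundary_pair c \<in> box_pairs A0 A1 V0 V1" "y \<in> box_pairs A0 A1 V0 V1"
  shows "\<exists>d\<in>sheet X A0 A1 V0 V1 c. boundary_pair d = y"
proof -
  obtain n0 a0 W0 n1 a1 W1 where D: "nbhd_data X A0 A1 n0 a0 W0 n1 a1 W1"
    "V0 = path_nbhd X n0 a0 W0" "V1 = path_nbhd X n1 a1 W1"
    using assms(1) unfolding nbhd_box_def by blast
  obtain \<eta>0 \<eta>1 where y: "y = (\<eta>0, \<eta>1)" "\<eta>0 \<in> V0" "\<eta>1 \<in> V1" "\<eta>0 0 = \<eta>1 0" "\<eta>0 1 = \<eta>1 1" "\<eta>0 0 \<in> A0" "\<eta>0 1 \<in> A1"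
    using assms(4) unfolding box_pairs_def by blast
  obtain h where h: "h \<in> c"
    using two_tracks_nonempty[OF assms(2)] by blast
  have "bigon_in A0 A1 V0 V1 h"
    using bigon_in_iff_boundary_pair[OF assms(2) h] assms(3) by blast
  then obtain f where f: "deformable_in X A0 A1 V0 V1 h f" "slice f 0 = \<eta>0" "slice f 1 = \<eta>1"
    using deformable_in_lift[OF D(1) bigon_continuous[OF two_tracks_mem(1)[OF assms(2) h]]] y unfolding D(2,3) by metis
  then have fb: "bigon X f"
    by (intro deformable_in_imp(2))
  have "two_track X f \<in> sheet X A0 A1 V0 V1 c"
    using two_track_in_two_tracks[OF fb] two_track_self[OF fb] h deformable_in_sym[OF f(1)] unfolding sheet_def by blast
  moreover have "boundary_pair (two_track X f) = y"
    using two_track_boundary(1,2)[OF two_track_in_two_tracks[OF fb] two_track_self[OF fb]] f(2,3) y(1)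
    by (simp add: boundary_pair_def)
  ultimately show ?thesis
    by blast
qed

text \<open>Recentre the sheet at \<open>d\<close>: then \<open>e\<close> deforms to
  \<open>d\<close>, and a deformation between 2-tracks with the same boundary can be made relative
  to it.\<close>

lemma sheet_inj:
  assumes "nbhd_box X A0 A1 V0 V1" "c \<in> two_tracks X" "d \<in> sheet X A0 A1 V0 V1 c" "e \<in> sheet X A0 A1 V0 V1 c"
    and "boundary_pair d = boundary_pair e"
  shows "d = e"
proof -
  obtain n0 a0 W0 n1 a1 W1 where D: "nbhd_data X A0 A1 n0 a0 W0 n1 a1 W1"
    "V0 = path_nbhd X n0 a0 W0" "V1 = path_nbhd X n1 a1 W1"
    using assms(1) unfolding nbhd_box_def by blast
  have de: "d \<in> two_tracks X" "e \<in> two_tracks X"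
    using sheet_boundary(1) assms(2-4) by blast+
  have "e \<in> sheet X A0 A1 V0 V1 d"
    using sheet_eq[OF assms(3,2)] assms(4) by simp
  moreover obtain f g where f: "f \<in> d" "g \<in> e"
    using two_tracks_nonempty de by metis
  ultimately have "deformable_in X A0 A1 V0 V1 g f"
    by (intro sheet_deformable[OF _ de(1)])
  moreover have "slice g 0 = slice f 0" "slice g 1 = slice f 1"
    using two_track_boundary(1,2)[OF de(1) f(1)] two_track_boundary(1,2)[OF de(2) f(2)] assms(5)
    by (simp_all add: boundary_pair_def)
  ultimately have "homotopic_rel square_boundary unit_square X g f"
    using deformable_in_unique[OF D(1)] unfolding D(2,3) by blast
  then show ?thesis
    using two_tracks_mem[OF de(1) f(1)] two_tracks_mem[OF de(2) f(2)] two_track_eq_iff by metis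
qed

section \<open>The boundary map is a covering\<close>

abbreviation parallel_paths :: "'a topology \<Rightarrow> ((real \<Rightarrow> 'a) \<times> (real \<Rightarrow> 'a)) topology" where
  "parallel_paths X \<equiv> parallel_arrows (fundamental_bigroupoid X)"

lemma fundamental_bigroupoid_simps:
  "objects (fundamental_bigroupoid X) = X" "arrows1 (fundamental_bigroupoid X) = path_space X"
  "arrows2 (fundamental_bigroupoid X) = two_track_topology X" "boundary_map (fundamental_bigroupoid X) = boundary_pair"
  "src (fundamental_bigroupoid X) \<gamma> = \<gamma> 0" "tgt (fundamental_bigroupoid X) \<gamma> = \<gamma> 1"
  by (auto simp: fundamental_bigroupoid_def boundary_map_def boundary_pair_def)

lemma parallel_paths_eq:
  "parallel_paths X = subtopology (prod_topology (path_space X) (path_space X)) {(f, g). f 0 = g 0 \<and> f 1 = g 1}"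
  by (simp add: parallel_arrows_def fundamental_bigroupoid_simps)

section \<open>Boxes as a basis of the space of parallel paths\<close>

lemma openin_path_space_eval:
  assumes "openin X P" "t \<in> {0..1}"
  shows "openin (path_space X) {\<eta> \<in> topspace (path_space X). \<eta> t \<in> P}"
proof -
  have "{\<eta> \<in> topspace (path_space X). \<eta> t \<in> P} =
      {f \<in> extensional (topspace unit_interval). continuous_map unit_interval X f \<and> f ` {t} \<subseteq> P}"
    by (auto simp: topspace_path_space)
  moreover have "compactin unit_interval {t}"
    using assms(2) by (simp add: compactin_subtopology)
  ultimately show ?thesis
    using assms(1) unfolding path_space_def compact_open_topology_def
    by (intro topology_generated_by_Basis CollectI exI[of _ "{t}"] exI[of _ P]) simp
qed

lemma openin_box_pairs:
  assumes "nbhd_box X A0 A1 V0 V1"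
  shows "openin (parallel_paths X) (box_pairs A0 A1 V0 V1)"
proof -
  have A: "openin X A0" "openin X A1" and V: "openin (path_space X) V0" "openin (path_space X) V1"
    using assms openin_path_nbhd by (auto simp: nbhd_box_def nbhd_data_def basic_open_def)
  let ?T = "topspace (path_space X)"
  have "openin (path_space X) (V0 \<inter> ({\<eta> \<in> ?T. \<eta> 0 \<in> A0} \<inter> {\<eta> \<in> ?T. \<eta> 1 \<in> A1}))"
    by (intro openin_Int V openin_path_space_eval A) auto
  then have "openin (prod_topology (path_space X) (path_space X)) ((V0 \<inter> ({\<eta> \<in> ?T. \<eta> 0 \<in> A0} \<inter> {\<eta> \<in> ?T. \<eta> 1 \<in> A1})) \<times> V1)"
    using V(2) by (simp add: openin_prod_Times_iff)
  moreover have "box_pairs A0 A1 V0 V1 = ((V0 \<inter> ({\<eta> \<in> ?T. \<eta> 0 \<in> A0} \<inter> {\<eta> \<in> ?T. \<eta> 1 \<in> A1})) \<times> V1) \<inter> {(f, g). f 0 = g 0 \<and> f 1 = g 1}"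
    using openin_subset[OF V(1)] by (auto simp: box_pairs_def)
  ultimately show ?thesis
    unfolding parallel_paths_eq openin_subtopology by blast
qed

lemma ex_box:
  assumes X: "semilocally_2_connected X" and y: "(\<gamma>0, \<gamma>1) \<in> topspace (parallel_paths X)"
    and O: "openin (path_space X) O0" "\<gamma>0 \<in> O0" "openin (path_space X) O1" "\<gamma>1 \<in> O1"
    and P: "openin X P0" "\<gamma>0 0 \<in> P0" "openin X P1" "\<gamma>0 1 \<in> P1"
  obtains A0 A1 V0 V1 where "nbhd_box X A0 A1 V0 V1" "(\<gamma>0, \<gamma>1) \<in> box_pairs A0 A1 V0 V1"
    "A0 \<subseteq> P0" "A1 \<subseteq> P1" "V0 \<subseteq> O0" "V1 \<subseteq> O1"
proof -
  have eq: "\<gamma>0 0 = \<gamma>1 0" "\<gamma>0 1 = \<gamma>1 1"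
    using y by (auto simp: parallel_paths_eq)
  obtain U0 U1 n0 a0 W0 n1 a1 W1 where D: "nbhd_data X U0 U1 n0 a0 W0 n1 a1 W1"
    "\<gamma>0 \<in> path_nbhd X n0 a0 W0" "path_nbhd X n0 a0 W0 \<subseteq> O0" "\<gamma>1 \<in> path_nbhd X n1 a1 W1" "path_nbhd X n1 a1 W1 \<subseteq> O1"
    "\<gamma>0 0 \<in> U0" "U0 \<subseteq> P0" "\<gamma>0 1 \<in> U1" "U1 \<subseteq> P1"
    using ex_nbhd_data[OF X O eq P] .
  have "nbhd_box X U0 U1 (path_nbhd X n0 a0 W0) (path_nbhd X n1 a1 W1)"
    unfolding nbhd_box_def using D(1) by blast
  then show ?thesis
    by (rule that) (use eq D in \<open>auto simp: box_pairs_def\<close>)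
qed

lemma box_pairs_basis:
  assumes X: "semilocally_2_connected X" and N: "openin (parallel_paths X) N" "y \<in> N"
  obtains A0 A1 V0 V1 where "nbhd_box X A0 A1 V0 V1" "y \<in> box_pairs A0 A1 V0 V1" "box_pairs A0 A1 V0 V1 \<subseteq> N"
proof -
  obtain M where M: "openin (prod_topology (path_space X) (path_space X)) M" "N = M \<inter> {(f, g). f 0 = g 0 \<and> f 1 = g 1}"
    using N(1) unfolding parallel_paths_eq openin_subtopology by blast
  obtain \<gamma>0 \<gamma>1 where y: "y = (\<gamma>0, \<gamma>1)"
    by fastforce
  then have "(\<gamma>0, \<gamma>1) \<in> M"
    using N(2) M(2) by auto
  then obtain O0 O1 where O: "openin (path_space X) O0" "openin (path_space X) O1" "\<gamma>0 \<in> O0" "\<gamma>1 \<in> O1" "O0 \<times> O1 \<subseteq> M"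
    using M(1) unfolding openin_prod_topology_alt by metis
  have yt: "(\<gamma>0, \<gamma>1) \<in> topspace (parallel_paths X)"
    using openin_subset[OF N(1)] N(2) y by blast
  have "\<gamma>0 \<in> topspace (path_space X)"
    using openin_subset[OF O(1)] O(3) by blast
  then have "\<gamma>0 0 \<in> topspace X" "\<gamma>0 1 \<in> topspace X"
    by (auto simp: topspace_path_space continuous_map_def)
  then obtain A0 A1 V0 V1 where B: "nbhd_box X A0 A1 V0 V1" "(\<gamma>0, \<gamma>1) \<in> box_pairs A0 A1 V0 V1" "V0 \<subseteq> O0" "V1 \<subseteq> O1"
    using ex_box[OF X yt O(1,3,2,4) openin_topspace _ openin_topspace] by metis
  have "box_pairs A0 A1 V0 V1 \<subseteq> N"
    using B(3,4) O(5) M(2) unfolding box_pairs_def by blast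
  then show ?thesis
    using that[OF B(1)] B(2) y by blast
qed

lemma boundary_pair_in_parallel_paths:
  "c \<in> two_tracks X \<Longrightarrow> boundary_pair c \<in> topspace (parallel_paths X)"
  using two_track_ends[of c X] by (simp add: parallel_paths_eq boundary_pair_def)

lemma ex_box_at:
  assumes "semilocally_2_connected X" "y \<in> topspace (parallel_paths X)"
  obtains A0 A1 V0 V1 where "nbhd_box X A0 A1 V0 V1" "y \<in> box_pairs A0 A1 V0 V1"
  using box_pairs_basis[OF assms(1) openin_topspace assms(2)] by metis

section \<open>The topology on 2-tracks in terms of sheets\<close>

lemma topspace_two_track_topology:
  assumes "semilocally_2_connected X"
  shows "topspace (two_track_topology X) = two_tracks X"
proof -
  have "c \<in> topspace (two_track_topology X)" if c: "c \<in> two_tracks X" for c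
  proof -
    obtain A0 A1 V0 V1 where "nbhd_box X A0 A1 V0 V1" "boundary_pair c \<in> box_pairs A0 A1 V0 V1"
      using ex_box_at[OF assms boundary_pair_in_parallel_paths[OF c]] .
    then show ?thesis
      using sheet_self[OF c] c unfolding two_track_topology_sheets topology_generated_by_topspace by blast
  qed
  moreover have "topspace (two_track_topology X) \<subseteq> two_tracks X"
    unfolding two_track_topology_sheets topology_generated_by_topspace sheet_def by blast
  ultimately show ?thesis
    by blast
qed

lemma openin_sheet:
  assumes "nbhd_box X A0 A1 V0 V1" "c \<in> two_tracks X" "boundary_pair c \<in> box_pairs A0 A1 V0 V1"
  shows "openin (two_track_topology X) (sheet X A0 A1 V0 V1 c)"
  using assms unfolding two_track_topology_sheets by (intro topology_generated_by_Basis) blast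

text \<open>By definition the sheets are only a subbasis. They are a basis at \<open>c\<close>
  because a sheet containing \<open>c\<close> can be recentred at \<open>c\<close>, and two sheets
  centred at \<open>c\<close> contain the one over a smaller box.\<close>

lemma sheet_basis:
  assumes X: "semilocally_2_connected X" and N: "openin (two_track_topology X) N" "c \<in> N"
  shows "\<exists>A0 A1 V0 V1. nbhd_box X A0 A1 V0 V1 \<and> boundary_pair c \<in> box_pairs A0 A1 V0 V1 \<and> sheet X A0 A1 V0 V1 c \<subseteq> N"
proof -
  have c: "c \<in> two_tracks X"
    using openin_subset[OF N(1)] N(2) topspace_two_track_topology[OF X] by blast
  have "generate_topology_on {sheet X A0 A1 V0 V1 c | A0 A1 V0 V1 c.
     c \<in> two_tracks X \<and> nbhd_box X A0 A1 V0 V1 \<and> boundary_pair c \<in> box_pairs A0 A1 V0 V1} N"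
    using N(1) unfolding two_track_topology_sheets by (rule openin_topology_generated_by)
  then show ?thesis
    using N(2)
  proof (induction rule: generate_topology_on.induct)
    case Empty
    then show ?case
      by simp
  next
    case (Int M M')
    obtain A0 A1 V0 V1 where 1: "nbhd_box X A0 A1 V0 V1" "boundary_pair c \<in> box_pairs A0 A1 V0 V1" "sheet X A0 A1 V0 V1 c \<subseteq> M"
      using Int by blast
    obtain A0' A1' V0' V1' where 2: "nbhd_box X A0' A1' V0' V1'" "boundary_pair c \<in> box_pairs A0' A1' V0' V1'" "sheet X A0' A1' V0' V1' c \<subseteq> M'"
      using Int by blast
    obtain \<gamma>0 \<gamma>1 where y: "boundary_pair c = (\<gamma>0, \<gamma>1)"
      by fastforce
    have op: "openin X A0 \<and> openin X A1 \<and> openin (path_space X) V0 \<and> openin (path_space X) V1"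
      if "nbhd_box X A0 A1 V0 V1" for A0 A1 V0 V1
      using that openin_path_nbhd by (auto simp: nbhd_box_def nbhd_data_def basic_open_def)
    have yt: "(\<gamma>0, \<gamma>1) \<in> topspace (parallel_paths X)"
      using boundary_pair_in_parallel_paths[OF c] y by simp
    obtain B0 B1 S0 S1 where 3: "nbhd_box X B0 B1 S0 S1" "(\<gamma>0, \<gamma>1) \<in> box_pairs B0 B1 S0 S1"
      "B0 \<subseteq> A0 \<inter> A0'" "B1 \<subseteq> A1 \<inter> A1'" "S0 \<subseteq> V0 \<inter> V0'" "S1 \<subseteq> V1 \<inter> V1'"
      by (rule ex_box[OF X yt, of "V0 \<inter> V0'" "V1 \<inter> V1'" "A0 \<inter> A0'" "A1 \<inter> A1'"])
        (use op[OF 1(1)] op[OF 2(1)] 1(2) 2(2) y in \<open>auto simp: box_pairs_def\<close>)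
    have "sheet X B0 B1 S0 S1 c \<subseteq> sheet X A0 A1 V0 V1 c" "sheet X B0 B1 S0 S1 c \<subseteq> sheet X A0' A1' V0' V1' c"
      by (rule sheet_mono; use 3(3-6) in blast)+
    then have "sheet X B0 B1 S0 S1 c \<subseteq> M \<inter> M'"
      using 1(3) 2(3) by blast
    then show ?case
      using 3(1,2) y by metis
  next
    case (UN K)
    then obtain M where M: "M \<in> K" "c \<in> M"
      by blast
    from UN.IH[OF this] show ?case
      using M(1) by blast
  next
    case (Basis S)
    then obtain A0 A1 V0 V1 c' where S: "S = sheet X A0 A1 V0 V1 c'" "c' \<in> two_tracks X" "nbhd_box X A0 A1 V0 V1"
      by blast
    then have "boundary_pair c \<in> box_pairs A0 A1 V0 V1" "sheet X A0 A1 V0 V1 c = S"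
      using sheet_boundary(2)[of c X A0 A1 V0 V1 c'] sheet_eq[of c X A0 A1 V0 V1 c'] Basis.prems by auto
    then show ?case
      using S(3) by blast
  qed
qed

lemma continuous_map_boundary_pair:
  assumes X: "semilocally_2_connected X"
  shows "continuous_map (two_track_topology X) (parallel_paths X) boundary_pair"
  unfolding continuous_map_def topspace_two_track_topology[OF X]
proof (intro conjI allI impI)
  show "boundary_pair \<in> two_tracks X \<rightarrow> topspace (parallel_paths X)"
    using boundary_pair_in_parallel_paths by blast
  fix N assume N: "openin (parallel_paths X) N"
  show "openin (two_track_topology X) {c \<in> two_tracks X. boundary_pair c \<in> N}"
  proof (subst openin_subopen, intro ballI)
    fix c assume "c \<in> {c \<in> two_tracks X. boundary_pair c \<in> N}"
    then have c: "c \<in> two_tracks X" "boundary_pair c \<in> N"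
      by auto
    obtain A0 A1 V0 V1 where B: "nbhd_box X A0 A1 V0 V1" "boundary_pair c \<in> box_pairs A0 A1 V0 V1" "box_pairs A0 A1 V0 V1 \<subseteq> N"
      using box_pairs_basis[OF X N c(2)] .
    show "\<exists>T. openin (two_track_topology X) T \<and> c \<in> T \<and> T \<subseteq> {c \<in> two_tracks X. boundary_pair c \<in> N}"
      using openin_sheet[OF B(1) c(1) B(2)] sheet_self[OF c(1) B(2)] sheet_boundary(1,2)[OF _ c(1)] B(3)
      by (intro exI[of _ "sheet X A0 A1 V0 V1 c"]) blast
  qed
qed

text \<open>Every 2-track over the box lies in the sheet of exactly one 2-track over
  \<open>y\<close>. The sheets are thus labelled by the fibre over \<open>y\<close>, and the pair of
  boundary and label is the trivialisation.\<close>

lemma trivial_discrete_over_box: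
  assumes X: "semilocally_2_connected X" and B: "nbhd_box X A0 A1 V0 V1"
    and y: "y \<in> box_pairs A0 A1 V0 V1"
  shows "trivial_discrete_over (two_track_topology X) (parallel_paths X) boundary_pair (box_pairs A0 A1 V0 V1)"
proof -
  let ?N = "box_pairs A0 A1 V0 V1" and ?S = "sheet X A0 A1 V0 V1" and ?E = "two_track_topology X"
  \<comment> \<open>If this fibre is empty, lifting shows that there is no 2-track over the box at
    all.\<close>
  define F where "F = {c \<in> two_tracks X. boundary_pair c = y}"
  let ?E' = "subtopology ?E {e. boundary_pair e \<in> ?N}"
  let ?P = "prod_topology (subtopology (parallel_paths X) ?N) (discrete_topology F)"
  have F: "c \<in> two_tracks X" "boundary_pair c \<in> ?N" if "c \<in> F" for c
    using that y by (auto simp: F_def)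
  have tE': "topspace ?E' = {e \<in> two_tracks X. boundary_pair e \<in> ?N}"
    using topspace_two_track_topology[OF X] by auto
  have Nop: "openin (parallel_paths X) ?N"
    by (rule openin_box_pairs[OF B])
  then have tP: "topspace ?P = ?N \<times> F"
    using openin_subset by fastforce
  have ex1: "\<exists>!c. c \<in> F \<and> e \<in> ?S c" if e: "e \<in> two_tracks X" "boundary_pair e \<in> ?N" for e
  proof -
    obtain c where c: "c \<in> ?S e" "boundary_pair c = y"
      using sheet_lift[OF B e y] by blast
    have c2: "c \<in> two_tracks X"
      using sheet_boundary(1)[OF c(1) e(1)] .
    have "e \<in> ?S c"
      using sheet_eq[OF c(1) e(1)] sheet_self[OF e] by simp
    moreover have "c' = c" if "c' \<in> F" "e \<in> ?S c'" for c'
    proof -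
      have "c' \<in> ?S e"
        using sheet_eq[OF that(2) F(1)[OF that(1)]] sheet_self[OF F[OF that(1)]] by simp
      then show ?thesis
        using sheet_inj[OF B e(1) _ c(1)] c(2) that(1) by (simp add: F_def)
    qed
    moreover have "c \<in> F"
      using c2 c(2) by (simp add: F_def)
    ultimately show ?thesis
      by (intro ex1I[of _ c]) blast+
  qed
  define \<kappa> where "\<kappa> e = (THE c. c \<in> F \<and> e \<in> ?S c)" for e
  have \<kappa>: "\<kappa> e \<in> F" "e \<in> ?S (\<kappa> e)" if "e \<in> two_tracks X" "boundary_pair e \<in> ?N" for e
    using theI'[OF ex1[OF that]] unfolding \<kappa>_def by auto
  have \<kappa>_eq: "\<kappa> e = c" if "c \<in> F" "e \<in> ?S c" for e c
    using sheet_boundary(1,2)[OF that(2) F(1)[OF that(1)]] ex1[of e] \<kappa>[of e] that by blast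
  define \<Phi> where "\<Phi> e = (boundary_pair e, \<kappa> e)" for e
  have "homeomorphic_map ?E' ?P \<Phi>"
  proof (rule bijective_open_imp_homeomorphic_map)
    show "continuous_map ?E' ?P \<Phi>"
      unfolding \<Phi>_def
    proof (rule continuous_map_pairedI)
      show "continuous_map ?E' (subtopology (parallel_paths X) ?N) boundary_pair"
        using continuous_map_boundary_pair[OF X]
        by (auto simp: continuous_map_in_subtopology continuous_map_from_subtopology)
      \<comment> \<open>The label is constant on each sheet, and sheets are open.\<close>
      have "openin ?E' {e \<in> topspace ?E'. \<kappa> e \<in> G}" for G
      proof (subst openin_subopen, intro ballI)
        fix e assume "e \<in> {e \<in> topspace ?E'. \<kappa> e \<in> G}"
        then have e: "e \<in> two_tracks X" "boundary_pair e \<in> ?N" "\<kappa> e \<in> G"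
          unfolding tE' by auto
        have "openin ?E (?S (\<kappa> e))"
          by (rule openin_sheet[OF B F[OF \<kappa>(1)[OF e(1,2)]]])
        then have "openin ?E' (?S (\<kappa> e) \<inter> {e. boundary_pair e \<in> ?N})"
          by (auto simp: openin_subtopology)
        moreover have "?S (\<kappa> e) \<inter> {e. boundary_pair e \<in> ?N} \<subseteq> {e \<in> topspace ?E'. \<kappa> e \<in> G}"
        proof
          fix d assume d: "d \<in> ?S (\<kappa> e) \<inter> {e. boundary_pair e \<in> ?N}"
          then have "\<kappa> d = \<kappa> e" "d \<in> two_tracks X"
            using \<kappa>_eq[OF \<kappa>(1)[OF e(1,2)]] sheet_boundary(1)[OF _ F(1)[OF \<kappa>(1)[OF e(1,2)]]] by blast+
          then show "d \<in> {e \<in> topspace ?E'. \<kappa> e \<in> G}"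
            unfolding tE' using d e(3) by simp
        qed
        ultimately show "\<exists>T. openin ?E' T \<and> e \<in> T \<and> T \<subseteq> {e \<in> topspace ?E'. \<kappa> e \<in> G}"
          using \<kappa>(2)[OF e(1,2)] e(2) by blast
      qed
      then show "continuous_map ?E' (discrete_topology F) \<kappa>"
        unfolding continuous_map_def tE' topspace_discrete_topology using \<kappa>(1) by auto
    qed
    show "open_map ?E' ?P \<Phi>"
      unfolding open_map_def
    proof (intro allI impI)
      fix M assume "openin ?E' M"
      then obtain M' where M': "openin ?E M'" "M = M' \<inter> {e. boundary_pair e \<in> ?N}"
        unfolding openin_subtopology by blast
      show "openin ?P (\<Phi> ` M)"
      proof (subst openin_subopen, intro ballI)
        fix z assume "z \<in> \<Phi> ` M"
        then obtain e where e: "z = \<Phi> e" "e \<in> M'" "boundary_pair e \<in> ?N"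
          using M'(2) by blast
        have et: "e \<in> two_tracks X"
          using openin_subset[OF M'(1)] e(2) topspace_two_track_topology[OF X] by blast
        let ?c = "\<kappa> e"
        have c: "?c \<in> F" "e \<in> ?S ?c"
          using \<kappa>[OF et e(3)] by auto
        have "openin ?E (M' \<inter> ?S ?c)"
          by (rule openin_Int[OF M'(1) openin_sheet[OF B F[OF c(1)]]])
        \<comment> \<open>The sheet over a smaller box fits into the given open set and into the
          sheet labelled \<open>?c\<close>; by lifting it covers the smaller box, so the image
          contains a product neighbourhood of \<open>z\<close>.\<close>
        then obtain C0 C1 S0 S1 where C: "nbhd_box X C0 C1 S0 S1" "boundary_pair e \<in> box_pairs C0 C1 S0 S1"
          "sheet X C0 C1 S0 S1 e \<subseteq> M' \<inter> ?S ?c"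
          using sheet_basis[OF X, of "M' \<inter> ?S ?c" e] e(2) c(2) by blast
        let ?T = "(?N \<inter> box_pairs C0 C1 S0 S1) \<times> {?c}"
        have "openin (subtopology (parallel_paths X) ?N) (?N \<inter> box_pairs C0 C1 S0 S1)"
          using openin_box_pairs[OF C(1)] by (auto simp: openin_subtopology)
        then have "openin ?P ?T"
          using c(1) by (simp add: openin_prod_Times_iff)
        moreover have "z \<in> ?T"
          using e(1,3) C(2) by (simp add: \<Phi>_def)
        moreover have "?T \<subseteq> \<Phi> ` M"
        proof
          fix w assume "w \<in> ?T"
          then obtain x where x: "w = (x, ?c)" "x \<in> ?N" "x \<in> box_pairs C0 C1 S0 S1"
            by blast
          obtain d where d: "d \<in> sheet X C0 C1 S0 S1 e" "boundary_pair d = x"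
            using sheet_lift[OF C(1) et C(2) x(3)] by blast
          then have "d \<in> M'" "d \<in> ?S ?c"
            using C(3) by auto
          then have "d \<in> M" "\<Phi> d = w"
            using M'(2) d(2) x \<kappa>_eq[OF c(1)] by (auto simp: \<Phi>_def)
          then show "w \<in> \<Phi> ` M"
            by blast
        qed
        ultimately show "\<exists>T. openin ?P T \<and> z \<in> T \<and> T \<subseteq> \<Phi> ` M"
          by blast
      qed
    qed
    show "\<Phi> ` topspace ?E' = topspace ?P"
      unfolding tE' tP
    proof (intro subset_antisym subsetI)
      fix z assume "z \<in> \<Phi> ` {e \<in> two_tracks X. boundary_pair e \<in> ?N}"
      then show "z \<in> ?N \<times> F"
        using \<kappa>(1) by (auto simp: \<Phi>_def)
    next
      fix z assume "z \<in> ?N \<times> F"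
      then obtain x c where z: "z = (x, c)" "x \<in> ?N" "c \<in> F"
        by blast
      obtain d where d: "d \<in> ?S c" "boundary_pair d = x"
        using sheet_lift[OF B F[OF z(3)] z(2)] by blast
      then have "\<Phi> d = z" "d \<in> two_tracks X"
        using \<kappa>_eq[OF z(3) d(1)] z sheet_boundary(1)[OF d(1) F(1)[OF z(3)]] by (auto simp: \<Phi>_def)
      then show "z \<in> \<Phi> ` {e \<in> two_tracks X. boundary_pair e \<in> ?N}"
        using d(2) z(2) by blast
    qed
    show "inj_on \<Phi> (topspace ?E')"
      unfolding tE'
    proof (rule inj_onI)
      fix d e assume de: "d \<in> {e \<in> two_tracks X. boundary_pair e \<in> ?N}" "e \<in> {e \<in> two_tracks X. boundary_pair e \<in> ?N}" "\<Phi> d = \<Phi> e"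
      then have "d \<in> ?S (\<kappa> d)" "e \<in> ?S (\<kappa> d)" "\<kappa> d \<in> F"
        using \<kappa>[of d] \<kappa>[of e] by (auto simp: \<Phi>_def)
      then show "d = e"
        using sheet_inj[OF B F(1)] de(3) by (auto simp: \<Phi>_def)
    qed
  qed
  then show ?thesis
    unfolding trivial_discrete_over_def by (intro exI[of _ F] exI[of _ \<Phi>]) (simp add: \<Phi>_def)
qed

text \<open>An open sheet meets the fibre in a single point, by injectivity of the boundary map on
  sheets.\<close>

lemma discrete_boundary_fibre:
  assumes X: "semilocally_2_connected X" and y: "y \<in> topspace (parallel_paths X)"
  shows "subtopology (two_track_topology X) {c. boundary_pair c = y} =
    discrete_topology {c \<in> topspace (two_track_topology X). boundary_pair c = y}"
proof -
  let ?E = "two_track_topology X"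
  let ?F = "{c \<in> topspace ?E. boundary_pair c = y}"
  have "openin (subtopology ?E {c. boundary_pair c = y}) {c}" if "c \<in> ?F" for c
  proof -
    have c: "c \<in> two_tracks X" "boundary_pair c = y"
      using that topspace_two_track_topology[OF X] by auto
    obtain A0 A1 V0 V1 where B: "nbhd_box X A0 A1 V0 V1" "y \<in> box_pairs A0 A1 V0 V1"
      using ex_box_at[OF X y] .
    have self: "c \<in> sheet X A0 A1 V0 V1 c"
      using sheet_self c B(2) by blast
    have "{c} = sheet X A0 A1 V0 V1 c \<inter> {c. boundary_pair c = y}"
      using sheet_inj[OF B(1) c(1) _ self] self c(2) by auto
    then show ?thesis
      using openin_sheet[OF B(1) c(1)] B(2) c(2) unfolding openin_subtopology by metis
  qed
  moreover have "topspace (subtopology ?E {c. boundary_pair c = y}) = ?F"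
    by auto
  ultimately show ?thesis
    by (intro discrete_topology_unique[THEN iffD2, symmetric] conjI ballI)
qed

lemma fundamental_bigroupoid_locally_weakly_discrete:
  assumes X: "semilocally_2_connected X"
  shows "locally_weakly_discrete (fundamental_bigroupoid X)"
  unfolding locally_weakly_discrete_def fundamental_bigroupoid_simps
proof (intro conjI ballI)
  fix y assume y: "y \<in> topspace (parallel_paths X)"
  show "subtopology (two_track_topology X) {c. boundary_pair c = y} =
    discrete_topology {c \<in> topspace (two_track_topology X). boundary_pair c = y}"
    by (rule discrete_boundary_fibre[OF X y])
  obtain A0 A1 V0 V1 where B: "nbhd_box X A0 A1 V0 V1" "y \<in> box_pairs A0 A1 V0 V1"
    using ex_box_at[OF X y] .
  show "\<exists>N. openin (parallel_paths X) N \<and> y \<in> N \<and>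
      trivial_discrete_over (two_track_topology X) (parallel_paths X) boundary_pair N"
    by (intro exI conjI) (rule openin_box_pairs[OF B(1)], rule B(2), rule trivial_discrete_over_box[OF X B])
qed

section \<open>Image and local sections of the boundary map\<close>

lemma openin_boundary_image:
  assumes X: "semilocally_2_connected X"
  shows "openin (parallel_paths X) (boundary_pair ` two_tracks X)"
proof (subst openin_subopen, intro ballI)
  fix y assume "y \<in> boundary_pair ` two_tracks X"
  then obtain c where c: "c \<in> two_tracks X" "y = boundary_pair c"
    by blast
  obtain A0 A1 V0 V1 where B: "nbhd_box X A0 A1 V0 V1" "y \<in> box_pairs A0 A1 V0 V1"
    using ex_box_at[OF X boundary_pair_in_parallel_paths[OF c(1)]] c(2) by metis
  have "z \<in> boundary_pair ` two_tracks X" if z: "z \<in> box_pairs A0 A1 V0 V1" for z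
    using sheet_lift[OF B(1) c(1) _ z] B(2) c sheet_boundary(1)[OF _ c(1)] by blast
  then show "\<exists>T. openin (parallel_paths X) T \<and> y \<in> T \<and> T \<subseteq> boundary_pair ` two_tracks X"
    using openin_box_pairs[OF B(1)] B(2) by blast
qed

text \<open>A box containing some boundary pair consists of boundary pairs, since lifting reaches
  all of it. So a box around a point outside the image misses the image entirely.\<close>

lemma closedin_boundary_image:
  assumes X: "semilocally_2_connected X"
  shows "closedin (parallel_paths X) (boundary_pair ` two_tracks X)"
  unfolding closedin_def
proof
  show "boundary_pair ` two_tracks X \<subseteq> topspace (parallel_paths X)"
    using boundary_pair_in_parallel_paths by blast
  show "openin (parallel_paths X) (topspace (parallel_paths X) - boundary_pair ` two_tracks X)"
  proof (subst openin_subopen, intro ballI)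
    fix y assume y: "y \<in> topspace (parallel_paths X) - boundary_pair ` two_tracks X"
    obtain A0 A1 V0 V1 where B: "nbhd_box X A0 A1 V0 V1" "y \<in> box_pairs A0 A1 V0 V1"
      using ex_box_at[OF X] y by blast
    have "boundary_pair c \<notin> box_pairs A0 A1 V0 V1" if c: "c \<in> two_tracks X" for c
      using sheet_lift[OF B(1) c _ B(2)] y sheet_boundary(1)[OF _ c] by blast
    then show "\<exists>T. openin (parallel_paths X) T \<and> y \<in> T \<and> T \<subseteq> topspace (parallel_paths X) - boundary_pair ` two_tracks X"
      using openin_box_pairs[OF B(1)] B(2) openin_subset[OF openin_box_pairs[OF B(1)]] by blast
  qed
qed

text \<open>The section inverts the bijection from one sheet to its box. It is continuous because
  the sheet over a smaller box lies in the given one.\<close>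

lemma boundary_local_section:
  assumes X: "semilocally_2_connected X" and B: "nbhd_box X A0 A1 V0 V1"
    and c: "c \<in> two_tracks X" "boundary_pair c \<in> box_pairs A0 A1 V0 V1"
  shows "\<exists>\<sigma>. continuous_map (subtopology (parallel_paths X) (box_pairs A0 A1 V0 V1)) (two_track_topology X) \<sigma> \<and>
    (\<forall>y\<in>box_pairs A0 A1 V0 V1. boundary_pair (\<sigma> y) = y)"
proof -
  let ?N = "box_pairs A0 A1 V0 V1" and ?S = "sheet X A0 A1 V0 V1 c" and ?E = "two_track_topology X"
  have "\<forall>y\<in>?N. \<exists>d. d \<in> ?S \<and> boundary_pair d = y"
    using sheet_lift[OF B c] by blast
  then obtain \<sigma> where \<sigma>: "\<And>y. y \<in> ?N \<Longrightarrow> \<sigma> y \<in> ?S" "\<And>y. y \<in> ?N \<Longrightarrow> boundary_pair (\<sigma> y) = y"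
    by metis
  have Nop: "openin (parallel_paths X) ?N"
    by (rule openin_box_pairs[OF B])
  have tN: "topspace (subtopology (parallel_paths X) ?N) = ?N"
    using openin_subset[OF Nop] by auto
  have "continuous_map (subtopology (parallel_paths X) ?N) ?E \<sigma>"
    unfolding continuous_map_def tN topspace_two_track_topology[OF X]
  proof (intro conjI allI impI)
    show "\<sigma> \<in> ?N \<rightarrow> two_tracks X"
      using \<sigma>(1) sheet_boundary(1)[OF _ c(1)] by blast
    fix M assume M: "openin ?E M"
    show "openin (subtopology (parallel_paths X) ?N) {y \<in> ?N. \<sigma> y \<in> M}"
    proof (subst openin_subopen, intro ballI)
      fix y assume y: "y \<in> {y \<in> ?N. \<sigma> y \<in> M}"
      have "openin ?E (M \<inter> ?S)"
        by (rule openin_Int[OF M openin_sheet[OF B c]])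
      then obtain C0 C1 S0 S1 where C: "nbhd_box X C0 C1 S0 S1" "boundary_pair (\<sigma> y) \<in> box_pairs C0 C1 S0 S1"
        "sheet X C0 C1 S0 S1 (\<sigma> y) \<subseteq> M \<inter> ?S"
        using sheet_basis[OF X, of "M \<inter> ?S" "\<sigma> y"] y \<sigma>(1) by blast
      have \<sigma>y: "\<sigma> y \<in> two_tracks X"
        using \<sigma>(1) y sheet_boundary(1)[OF _ c(1)] by blast
      \<comment> \<open>The lift of \<open>z\<close> to the smaller sheet also lies in the large
        one, so by injectivity it is \<open>\<sigma> z\<close>.\<close>
      have "\<sigma> z \<in> M" if z: "z \<in> ?N" "z \<in> box_pairs C0 C1 S0 S1" for z
      proof -
        obtain d where d: "d \<in> sheet X C0 C1 S0 S1 (\<sigma> y)" "boundary_pair d = z"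
          using sheet_lift[OF C(1) \<sigma>y C(2) z(2)] by blast
        then have "d = \<sigma> z"
          using C(3) \<sigma>[OF z(1)] by (intro sheet_inj[OF B c(1)]) auto
        then show ?thesis
          using d(1) C(3) by blast
      qed
      moreover have "openin (subtopology (parallel_paths X) ?N) (?N \<inter> box_pairs C0 C1 S0 S1)"
        using openin_box_pairs[OF C(1)] by (auto simp: openin_subtopology)
      moreover have "y \<in> ?N \<inter> box_pairs C0 C1 S0 S1"
        using y C(2) \<sigma>(2) by auto
      ultimately show "\<exists>T. openin (subtopology (parallel_paths X) ?N) T \<and> y \<in> T \<and> T \<subseteq> {y \<in> ?N. \<sigma> y \<in> M}"
        by (intro exI[of _ "?N \<inter> box_pairs C0 C1 S0 S1"]) blast
    qed
  qed
  then show ?thesis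
    using \<sigma>(2) by blast
qed

text \<open>A path from \<open>b\<close> to \<open>x\<close> follows the contraction from
  \<open>b\<close> to \<open>c\<close> and then the contraction of \<open>x\<close> backwards. It
  depends continuously on \<open>x\<close> jointly with the time, and currying turns this into a map
  to the path space.\<close>

lemma out_arrows_local_section:
  assumes X: "locally_relatively_contractible X" and b: "b \<in> topspace X"
  shows "\<exists>U. openin X U \<and> b \<in> U \<and>
    has_section_over (out_arrows (fundamental_bigroupoid X) b) X (tgt (fundamental_bigroupoid X)) U"
proof -
  obtain U V c where U: "openin X U" "b \<in> U" "U \<subseteq> V"
    and "homotopic_with (\<lambda>_. True) (subtopology X V) X id (\<lambda>_. c)"
    using X b unfolding locally_relatively_contractible_def neighbourhood_base_of
    by (metis openin_topspace)
  then obtain h where h: "continuous_map (prod_topology unit_interval (subtopology X V)) X h"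
    "\<forall>x. h (0, x) = x" "\<forall>x. h (1, x) = c"
    unfolding homotopic_with_def by auto
  let ?Y = "subtopology X U"
  \<comment> \<open>The halves meet at \<open>c\<close>. The second depends on \<open>x\<close>,
    while the first is the same for all \<open>x\<close>, so every path starts at
    \<open>b\<close>.\<close>
  define F where "F = (\<lambda>z :: 'a \<times> real. if snd z \<le> 1 / 2 then h (2 * snd z, b) else h (2 - 2 * snd z, fst z))"
  have UX: "U \<subseteq> topspace X"
    by (rule openin_subset[OF U(1)])
  have "continuous_map (prod_topology ?Y unit_interval) X F"
    unfolding F_def
  proof (rule continuous_map_cases_le)
    let ?Z = "prod_topology ?Y unit_interval"
    have snd: "continuous_map ?Z euclideanreal snd"
      using continuous_map_snd[of ?Y unit_interval] by (simp add: continuous_map_in_subtopology)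
    then show "continuous_map ?Z euclideanreal snd" .
    show "continuous_map ?Z euclideanreal (\<lambda>z. 1 / 2)"
      by simp
    let ?Z1 = "subtopology ?Z {z \<in> topspace ?Z. snd z \<le> 1 / 2}"
    let ?Z2 = "subtopology ?Z {z \<in> topspace ?Z. 1 / 2 \<le> snd z}"
    have snd1: "continuous_map ?Z1 euclideanreal snd" and snd2: "continuous_map ?Z2 euclideanreal snd"
      using snd by (auto intro: continuous_map_from_subtopology)
    have "continuous_map ?Z1 unit_interval (\<lambda>z. 2 * snd z)"
      using snd1 by (auto simp: continuous_map_in_subtopology intro!: continuous_intros)
    moreover have "continuous_map ?Z1 (subtopology X V) (\<lambda>z. b)"
      using U UX by auto
    ultimately show "continuous_map ?Z1 X (\<lambda>z. h (2 * snd z, b))"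
      by (rule continuous_map_compose[OF continuous_map_pairedI h(1), unfolded o_def])
    have "continuous_map ?Z2 unit_interval (\<lambda>z. 2 - 2 * snd z)"
      using snd2 by (auto simp: continuous_map_in_subtopology intro!: continuous_intros)
    moreover have "continuous_map ?Z2 (subtopology X V) fst"
    proof -
      have "continuous_map ?Z2 ?Y fst"
        by (intro continuous_map_from_subtopology continuous_map_fst)
      then show ?thesis
        using U(3) by (auto simp: continuous_map_in_subtopology)
    qed
    ultimately show "continuous_map ?Z2 X (\<lambda>z. h (2 - 2 * snd z, fst z))"
      by (rule continuous_map_compose[OF continuous_map_pairedI h(1), unfolded o_def])
    show "h (2 * snd z, b) = h (2 - 2 * snd z, fst z)" if "snd z = 1 / 2" for z :: "'a \<times> real"
      unfolding that using h(3) by simp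
  qed
  then have "continuous_map ?Y (path_space X) (\<lambda>x. restrict (\<lambda>t. F (x, t)) {0..1})"
    by (rule continuous_map_curry_path_space)
  then have "continuous_map ?Y (out_arrows (fundamental_bigroupoid X) b) (\<lambda>x. restrict (\<lambda>t. F (x, t)) {0..1})"
    using h(2) by (auto simp: out_arrows_def fundamental_bigroupoid_simps continuous_map_in_subtopology F_def)
  moreover have "\<forall>x\<in>U. tgt (fundamental_bigroupoid X) (restrict (\<lambda>t. F (x, t)) {0..1}) = x"
    using h(2) by (simp add: fundamental_bigroupoid_simps F_def)
  ultimately show ?thesis
    using U(1,2) unfolding has_section_over_def by blast
qed

lemma fundamental_bigroupoid_locally_trivial:
  assumes X: "semilocally_2_connected X" "locally_relatively_contractible X"
  shows "locally_trivial (fundamental_bigroupoid X)"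
proof -
  \<comment> \<open>Local path-connectedness of the object space is part of
    \<open>locally_trivial\<close>; basic open sets are path-connected, so they supply it.\<close>
  have "neighbourhood_base_of (path_connectedin X) X"
    using X(1) unfolding semilocally_2_connected_def
    by (rule neighbourhood_base_of_mono) (auto simp: basic_open_def simply_connected_in_def)
  then have lpc: "locally_path_connected_space X"
    by (simp add: locally_path_connected_space_def)
  have im: "boundary_image (fundamental_bigroupoid X) = boundary_pair ` two_tracks X" (is "_ = ?I")
    by (simp add: boundary_image_def fundamental_bigroupoid_simps topspace_two_track_topology[OF X(1)])
  have "\<exists>N. openin (subtopology (parallel_paths X) ?I) N \<and> y \<in> N \<and>
      has_section_over (two_track_topology X) (subtopology (parallel_paths X) ?I) boundary_pair N"
    if "y \<in> ?I" for y
  proof -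
    obtain c where c: "c \<in> two_tracks X" "y = boundary_pair c"
      using \<open>y \<in> ?I\<close> by blast
    obtain A0 A1 V0 V1 where B: "nbhd_box X A0 A1 V0 V1" "y \<in> box_pairs A0 A1 V0 V1"
      using ex_box_at[OF X(1) boundary_pair_in_parallel_paths[OF c(1)]] c(2) by metis
    let ?N = "box_pairs A0 A1 V0 V1"
    \<comment> \<open>The box contains a boundary pair, hence consists of them, so a section over
      the box is a section over an open subset of the image.\<close>
    have "?N \<subseteq> ?I"
      using sheet_lift[OF B(1) c(1)] B(2) c(2) sheet_boundary(1)[OF _ c(1)] by blast
    then have "?N = ?N \<inter> ?I" "subtopology (subtopology (parallel_paths X) ?I) ?N = subtopology (parallel_paths X) ?N"
      by (auto simp: subtopology_subtopology inf.absorb2)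
    then show ?thesis
      using boundary_local_section[OF X(1) B(1) c(1)] B(2) c(2) openin_box_pairs[OF B(1)]
      unfolding has_section_over_def openin_subtopology by metis
  qed
  then show ?thesis
    using lpc out_arrows_local_section[OF X(2)] openin_boundary_image[OF X(1)] closedin_boundary_image[OF X(1)]
    unfolding locally_trivial_def fundamental_bigroupoid_simps im by blast
qed

theorem proposition4p4:
  fixes X :: "'a topology"
  assumes "semilocally_2_connected X"
  shows "locally_weakly_discrete (fundamental_bigroupoid X) \<and>
    (locally_relatively_contractible X \<longrightarrow> locally_trivial (fundamental_bigroupoid X))"
  using fundamental_bigroupoid_locally_weakly_discrete[OF assms]
    fundamental_bigroupoid_locally_trivial[OF assms] by blast

end
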